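(* Let $x_1, x_2, \ldots, x_n$ be weakly fully independent symmetric random variables in $\mathfrak{M}^{sa}$ whose partial sums $s_k = x_1+\cdots+x_k$ satisfy $s_k s_n = s_n s_k$ for all $1\leq k\leq n$. Then, for each $\lambda>0$, there exist two projections $p$ and $q$ in $\mathfrak{M}$ such that $$\max_{1 \leq k \leq n} \frac{1}{2^{k-1}}\, \tau\left( e_{(\lambda, \infty)}(s_k) \right) \leq \tau(p) \leq 2\, \tau \left( e_{(\lambda, \infty)}( s_n ) \right)$$ and $$\max_{1 \leq k \leq n} \frac{1}{2^{k-1}}\, \tau\left( e_{(\lambda, \infty)}( |s_k| ) \right) \leq \tau(p + q) \leq 2\, \tau \left( e_{(\lambda, \infty)}( | s_n | ) \right),$$ and such that, if $e_{(\lambda, \infty)}(s_k)$ (respectively, $e_{(\lambda, \infty)}(-s_k)$) is nonzero for some $1 \leq k \leq n$, then $p$ (respectively, $q$) is a nonzero projection.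
   Context: $\mathfrak{M}$ is a von Neumann algebra on a Hilbert space equipped with a normal faithful tracial state $\tau$; its elements are called random variables and $\mathfrak{M}^{sa}$ is its self-adjoint part. For self-adjoint $x\in\mathfrak{M}$ and a Borel set $B\subseteq\mathbb{R}$, $e_B(x)$ is the spectral projection of $x$ corresponding to $B$. For $S\subseteq \mathfrak{M}$, $W^*(S)$ is the von Neumann subalgebra generated by $S$. A sequence $(x_k)_{k=1}^n$ in $\mathfrak{M}$ is weakly fully independent if for every $1<j\leq n$ one has $\tau(ab)=\tau(a)\tau(b)$ for all $a\in W^*(x_1,\ldots,x_{j-1})$ and $b\in W^*(x_j,\ldots,x_n)$. Two normal random variables $x,y$ are identically distributed if $\tau(e_B(x))=\tau(e_B(y))$ for every complex Borel set $B$. A random variable $x\in\mathfrak{M}^{sa}$ is symmetric if $x$ and $-x$ are identically distributed. *)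

theory Defs
  imports "HOL-Analysis.Analysis"
begin

(* Complex Hilbert spaces. The underlying real Hilbert space structure is the real part of the
   complex one, so the norm is the usual one; the complex inner product is linear in its second
   argument. *)
class chilbert_space = real_inner + complete_space +
  fixes scaleC :: "complex \<Rightarrow> 'a \<Rightarrow> 'a" (infixr "*\<^sub>C" 75)
    and cinner :: "'a \<Rightarrow> 'a \<Rightarrow> complex"
  assumes scaleR_scaleC: "r *\<^sub>R x = complex_of_real r *\<^sub>C x"
    and scaleC_add_right: "c *\<^sub>C (x + y) = c *\<^sub>C x + c *\<^sub>C y"
    and scaleC_add_left: "(c + d) *\<^sub>C x = c *\<^sub>C x + d *\<^sub>C x"
    and scaleC_scaleC: "c *\<^sub>C d *\<^sub>C x = (c * d) *\<^sub>C x"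
    and cinner_commute: "cinner x y = cnj (cinner y x)"
    and cinner_add_right: "cinner x (y + z) = cinner x y + cinner x z"
    and cinner_scaleC_right: "cinner x (c *\<^sub>C y) = c * cinner x y"
    and inner_eq_Re_cinner: "inner x y = Re (cinner x y)"

type_synonym 'a operator = "'a \<Rightarrow>\<^sub>L 'a"

(* B(H): the library type 'a \<Rightarrow>\<^sub>L 'a consists of the bounded real-linear operators. *)
definition bounded_operators :: "('a::chilbert_space) operator set" where
  "bounded_operators = {x. \<forall>c v. blinfun_apply x (c *\<^sub>C v) = c *\<^sub>C blinfun_apply x v}"

definition scaleC_op :: "complex \<Rightarrow> ('a::chilbert_space) operator \<Rightarrow> 'a operator" where
  "scaleC_op c x = Blinfun (\<lambda>v. c *\<^sub>C blinfun_apply x v)"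

definition adj :: "('a::chilbert_space) operator \<Rightarrow> 'a operator" where
  "adj x = (THE y. \<forall>u v. cinner (blinfun_apply x u) v = cinner u (blinfun_apply y v))"

definition positive_op :: "('a::chilbert_space) operator \<Rightarrow> bool" where
  "positive_op x \<longleftrightarrow>
     x \<in> bounded_operators \<and> (\<forall>v. cinner v (blinfun_apply x v) \<in> \<real>\<^sub>\<ge>\<^sub>0)"

definition op_le :: "('a::chilbert_space) operator \<Rightarrow> 'a operator \<Rightarrow> bool" where
  "op_le x y \<longleftrightarrow> positive_op (y - x)"

definition projection_op :: "('a::chilbert_space) operator \<Rightarrow> bool" where
  "projection_op p \<longleftrightarrow> p \<in> bounded_operators \<and> p o\<^sub>L p = p \<and> adj p = p"

(* |x|, the positive square root of x* x *)
definition op_abs :: "('a::chilbert_space) operator \<Rightarrow> 'a operator" where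
  "op_abs x = (THE y. positive_op y \<and> y o\<^sub>L y = adj x o\<^sub>L x)"

definition commutant :: "('a::chilbert_space) operator set \<Rightarrow> 'a operator set" where
  "commutant S = {y \<in> bounded_operators. \<forall>x\<in>S. x o\<^sub>L y = y o\<^sub>L x}"

(* Concrete von Neumann algebras, as self-adjoint sets of operators equal to their bicommutant. *)
definition von_neumann_algebra :: "('a::chilbert_space) operator set \<Rightarrow> bool" where
  "von_neumann_algebra M \<longleftrightarrow>
     M \<subseteq> bounded_operators \<and> (\<forall>x\<in>M. adj x \<in> M) \<and> commutant (commutant M) = M"

(* W*(S) *)
definition vN_generated :: "('a::chilbert_space) operator set \<Rightarrow> 'a operator set" where
  "vN_generated S = \<Inter>{N. von_neumann_algebra N \<and> S \<subseteq> N}"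

definition sa_part :: "('a::chilbert_space) operator set \<Rightarrow> 'a operator set" where
  "sa_part M = {x \<in> M. adj x = x}"

(* A functional tr is only constrained on M. Normality: tr preserves suprema of increasing nets
   of self-adjoint elements that are bounded above; such a net is given by its range, an upward
   directed set. *)
locale tracial_von_neumann_algebra =
  fixes M :: "('a::chilbert_space) operator set"
    and tr :: "'a operator \<Rightarrow> complex"
  assumes von_neumann_algebra: "von_neumann_algebra M"
    and tr_add: "\<lbrakk>x \<in> M; y \<in> M\<rbrakk> \<Longrightarrow> tr (x + y) = tr x + tr y"
    and tr_scaleC: "x \<in> M \<Longrightarrow> tr (scaleC_op c x) = c * tr x"
    and tr_positive: "\<lbrakk>x \<in> M; positive_op x\<rbrakk> \<Longrightarrow> tr x \<in> \<real>\<^sub>\<ge>\<^sub>0"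
    and tr_unit: "tr id_blinfun = 1"
    and tr_faithful: "\<lbrakk>x \<in> M; positive_op x; tr x = 0\<rbrakk> \<Longrightarrow> x = 0"
    and tr_commute: "\<lbrakk>x \<in> M; y \<in> M\<rbrakk> \<Longrightarrow> tr (x o\<^sub>L y) = tr (y o\<^sub>L x)"
    and tr_normal:
      "\<lbrakk>D \<subseteq> sa_part M; D \<noteq> {}; \<forall>a\<in>D. \<forall>b\<in>D. \<exists>c\<in>D. op_le a c \<and> op_le b c;
        s \<in> sa_part M; \<forall>a\<in>D. op_le a s;
        \<forall>t\<in>sa_part M. (\<forall>a\<in>D. op_le a t) \<longrightarrow> op_le s t\<rbrakk>
       \<Longrightarrow> Re (tr s) = (SUP a\<in>D. Re (tr a))"

(* For a projection-valued measure E, the measure B \<mapsto> \<langle>v, E(B) v\<rangle>. *)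
definition scalar_measure ::
    "(complex set \<Rightarrow> ('a::chilbert_space) operator) \<Rightarrow> 'a \<Rightarrow> complex measure" where
  "scalar_measure E v =
     measure_of UNIV (sets borel) (\<lambda>B. ennreal (Re (cinner v (blinfun_apply (E B) v))))"

(* E is a projection-valued measure on the complex Borel sets, strongly countably additive, with
   x = \<integral> z dE(z). By polarization it suffices to express the integral through the quadratic
   forms. *)
definition is_spectral_measure ::
    "('a::chilbert_space) operator \<Rightarrow> (complex set \<Rightarrow> 'a operator) \<Rightarrow> bool" where
  "is_spectral_measure x E \<longleftrightarrow>
     (\<forall>B\<in>sets borel. projection_op (E B)) \<and>
     E UNIV = id_blinfun \<and>
     (\<forall>A\<in>sets borel. \<forall>B\<in>sets borel. E (A \<inter> B) = E A o\<^sub>L E B) \<and>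
     (\<forall>A :: nat \<Rightarrow> complex set. range A \<subseteq> sets borel \<longrightarrow> disjoint_family A \<longrightarrow>
        (\<forall>v. (\<lambda>i. blinfun_apply (E (A i)) v) sums blinfun_apply (E (\<Union>i. A i)) v)) \<and>
     (\<forall>v. integrable (scalar_measure E v) (\<lambda>z. z) \<and>
        cinner v (blinfun_apply x v) = integral\<^sup>L (scalar_measure E v) (\<lambda>z. z))"

(* e_B(x) for x normal and B a complex Borel set. The spectral measure is unique on Borel sets
   only, hence the choice of the single operator E B. *)
definition spectral_projection ::
    "complex set \<Rightarrow> ('a::chilbert_space) operator \<Rightarrow> 'a operator" where
  "spectral_projection B x = (THE P. \<exists>E. is_spectral_measure x E \<and> P = E B)"

(* e_B(x) for x self-adjoint and B a real Borel set *)
definition real_spectral_projection ::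
    "real set \<Rightarrow> ('a::chilbert_space) operator \<Rightarrow> 'a operator" where
  "real_spectral_projection B x = spectral_projection (complex_of_real ` B) x"

(* for normal x and y *)
definition identically_distributed ::
    "(('a::chilbert_space) operator \<Rightarrow> complex) \<Rightarrow> 'a operator \<Rightarrow> 'a operator \<Rightarrow> bool" where
  "identically_distributed tr x y \<longleftrightarrow>
     (\<forall>B\<in>sets borel. tr (spectral_projection B x) = tr (spectral_projection B y))"

definition symmetric_rv ::
    "('a::chilbert_space) operator set \<Rightarrow> ('a operator \<Rightarrow> complex) \<Rightarrow> 'a operator \<Rightarrow> bool" where
  "symmetric_rv M tr x \<longleftrightarrow> x \<in> sa_part M \<and> identically_distributed tr x (- x)"

(* for the sequence x 1, ..., x n *)
definition weakly_fully_independent ::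
    "(('a::chilbert_space) operator \<Rightarrow> complex) \<Rightarrow> (nat \<Rightarrow> 'a operator) \<Rightarrow> nat \<Rightarrow> bool" where
  "weakly_fully_independent tr x n \<longleftrightarrow>
     (\<forall>j. 1 < j \<and> j \<le> n \<longrightarrow>
        (\<forall>a\<in>vN_generated (x ` {1..<j}). \<forall>b\<in>vN_generated (x ` {j..n}).
           tr (a o\<^sub>L b) = tr a * tr b))"

end

theory Submission
  imports Defs "HOL-Probability.Distribution_Functions"
begin

text \<open>Write \<open>y = s\<^sub>n - s\<^sub>k\<close>. Since \<open>s\<^sub>n\<close> commutes with every \<open>x\<^sub>i\<close>, weak full independence forces \<open>y\<close> to commute
  with \<open>x\<^sub>k\<^sub>+\<^sub>1\<close>: the conditional expectation of \<open>s\<^sub>n\<close> onto the algebra generated by \<open>x\<^sub>k\<^sub>+\<^sub>1, \<dots>, x\<^sub>n\<close> is \<open>y\<close>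
  plus a scalar, and it is central there. Hence \<open>y\<close> is a sum of the commuting independent variables \<open>x\<^sub>k\<^sub>+\<^sub>1\<close>
  and \<open>s\<^sub>n - s\<^sub>k\<^sub>+\<^sub>1\<close>, so by induction all its odd moments vanish and \<open>0\<close> is a median of it. As \<open>s\<^sub>k\<close> and \<open>y\<close>
  commute, the product of the projections \<open>s\<^sub>k > r\<close> and \<open>y \<ge> 0\<close> lies below \<open>s\<^sub>n > r\<close>, and independence
  gives \<open>\<tau>(s\<^sub>k > r) \<le> 2 \<tau>(s\<^sub>n > r)\<close>. One may then take for \<open>p\<close> and \<open>q\<close> the largest of the projections
  \<open>s\<^sub>k > r\<close>, respectively \<open>- s\<^sub>k > r\<close>.

  The spectral theorem is obtained over real Hilbert spaces: everything that is constructed from a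
  self-adjoint \<open>x\<close> commutes with all operators commuting with \<open>x\<close>, in particular with complex scalars.\<close>

section \<open>Positive operators and square roots\<close>

text \<open>The values of \<open>spectral_projection\<close> and \<open>op_abs\<close>, being
  definite descriptions, are known only once existence and uniqueness are proved. Both rest on one
  characterisation: the projection for "x above a" commutes with x, its range carries the quadratic
  form of x strictly above a, and its kernel carries it at most a. Comparing projections then means
  finding one vector with contradictory bounds. Symmetry is carried along as vanishing of the odd
  moments, since for a sum of commuting independent variables this is pure algebra under the trace,
  while distributions of sums would call for joint distributions. The way back to a median is that
  compactly supported measures are determined by their moments. The factor 2 is the reciprocal of
  the bound 1/2 for the trace of {y >= 0}, and it is the same for every k; the weights in the
  statement are at most 1 and only lower the left-hand sides. For r > 0 the event |s_k| > r is the
  orthogonal sum of s_k > r and -s_k > r, so the two-sided bounds are sums of one-sided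
  ones.\<close>

definition selfadj :: "('a::real_inner) operator \<Rightarrow> bool" where
  "selfadj T \<longleftrightarrow> (\<forall>u v. T u \<bullet> v = u \<bullet> T v)"

text \<open>Over a real space a nonnegative quadratic form does not force symmetry (a rotation by a
  right angle has form zero), so self-adjointness is part of the notion.\<close>

definition posop :: "('a::real_inner) operator \<Rightarrow> bool" where
  "posop T \<longleftrightarrow> selfadj T \<and> (\<forall>v. 0 \<le> v \<bullet> T v)"

definition pcontr :: "('a::real_inner) operator \<Rightarrow> bool" where
  "pcontr T \<longleftrightarrow> posop T \<and> (\<forall>v. v \<bullet> T v \<le> v \<bullet> v)"

definition orthproj :: "('a::real_inner) operator \<Rightarrow> bool" where
  "orthproj P \<longleftrightarrow> selfadj P \<and> P o\<^sub>L P = P"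

text \<open>The commutant is taken among all real-linear operators, which makes the double commutant
  small: its elements are complex-linear as soon as x is, and it lies in every von Neumann algebra
  containing x.\<close>

definition bicomm :: "('a::real_inner) operator \<Rightarrow> 'a operator set" where
  "bicomm x = {z. \<forall>y. y o\<^sub>L x = x o\<^sub>L y \<longrightarrow> y o\<^sub>L z = z o\<^sub>L y}"

lemmas op_simps = blinfun.bilinear_simps inner_simps

lemma selfadjD: "selfadj T \<Longrightarrow> T u \<bullet> v = u \<bullet> T v"
  by (simp add: selfadj_def)

lemma commute_apply:
  fixes x y :: "('a::real_normed_vector) operator"
  shows "x o\<^sub>L y = y o\<^sub>L x \<Longrightarrow> x (y v) = y (x v)"
  by (metis blinfun_apply_blinfun_compose)

lemma commuteI:
  fixes x y :: "('a::real_normed_vector) operator"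
  shows "(\<And>v. x (y v) = y (x v)) \<Longrightarrow> x o\<^sub>L y = y o\<^sub>L x"
  by (rule blinfun_eqI) simp

lemma compose_assoc: "(x o\<^sub>L y) o\<^sub>L z = x o\<^sub>L (y o\<^sub>L z)"
  by (rule blinfun_eqI) simp

lemma compose_id [simp]: "x o\<^sub>L id_blinfun = x" "id_blinfun o\<^sub>L x = x"
  by (auto intro: blinfun_eqI)

lemma selfadj_id [simp]: "selfadj id_blinfun" and selfadj_zero [simp]: "selfadj 0"
  by (simp_all add: selfadj_def)

lemma selfadj_add: "selfadj S \<Longrightarrow> selfadj T \<Longrightarrow> selfadj (S + T)"
  and selfadj_diff: "selfadj S \<Longrightarrow> selfadj T \<Longrightarrow> selfadj (S - T)"
  and selfadj_uminus: "selfadj S \<Longrightarrow> selfadj (- S)"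
  and selfadj_scaleR: "selfadj S \<Longrightarrow> selfadj (c *\<^sub>R S)"
  by (simp_all add: selfadj_def op_simps)

lemma selfadj_compose: "selfadj S \<Longrightarrow> selfadj T \<Longrightarrow> S o\<^sub>L T = T o\<^sub>L S \<Longrightarrow> selfadj (S o\<^sub>L T)"
  by (simp add: selfadj_def) (metis blinfun_apply_blinfun_compose)

lemma selfadj_sum: "(\<And>i. i \<in> I \<Longrightarrow> selfadj (f i)) \<Longrightarrow> selfadj (sum f I)"
  by (induction I rule: infinite_finite_induct) (auto intro: selfadj_add)

lemma inner_eqI:
  fixes a b :: "'a::real_inner"
  assumes "\<And>u. u \<bullet> a = u \<bullet> b" shows "a = b"
proof -
  have "(a - b) \<bullet> (a - b) = 0" using assms[of "a - b"] by (simp add: inner_diff_right)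
  then show ?thesis by simp
qed

text \<open>Polarization: the forms at \<open>u + w\<close>, \<open>u\<close> and \<open>w\<close>
  isolate the cross term, which symmetry makes a single inner product.\<close>

lemma selfadj_eqI:
  assumes "selfadj S" "selfadj T" "\<And>v. v \<bullet> S v = v \<bullet> T v" shows "S = T"
proof (rule blinfun_eqI)
  fix v
  have "u \<bullet> S w = u \<bullet> T w" for u w
    using assms(3)[of "u + w"] assms(3)[of u] assms(3)[of w]
      selfadjD[OF assms(1), of u w] selfadjD[OF assms(2), of u w]
    by (simp add: op_simps inner_commute)
  then show "S v = T v" by (rule inner_eqI)
qed

lemma posop_add: "posop S \<Longrightarrow> posop T \<Longrightarrow> posop (S + T)"
  by (simp add: posop_def selfadj_add op_simps)

lemma posop_scaleR: "posop S \<Longrightarrow> 0 \<le> c \<Longrightarrow> posop (c *\<^sub>R S)"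
  by (simp add: posop_def selfadj_scaleR op_simps)

lemma posop_square: "selfadj T \<Longrightarrow> posop (T o\<^sub>L T)"
  by (simp add: posop_def selfadj_compose) (metis inner_ge_zero selfadj_def)

lemma inner_apply_le: "v \<bullet> blinfun_apply T v \<le> norm T * (v \<bullet> v)"
proof -
  have "v \<bullet> T v \<le> norm v * norm (T v)" by (rule norm_cauchy_schwarz)
  also have "\<dots> \<le> norm v * (norm T * norm v)"
    by (intro mult_left_mono norm_blinfun) auto
  finally show ?thesis by (simp add: dot_square_norm power2_eq_square mult_ac)
qed

lemma pcontr_scale:
  assumes "posop A" shows "pcontr ((1 / (norm A + 1)) *\<^sub>R A)"
proof -
  have "v \<bullet> A v / (norm A + 1) \<le> v \<bullet> v" for v
  proof -
    have "v \<bullet> A v \<le> (norm A + 1) * (v \<bullet> v)"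
      using inner_apply_le[of v A] by (simp add: distrib_right add_increasing2)
    then show ?thesis by (simp add: divide_le_eq mult.commute add_nonneg_pos)
  qed
  then show ?thesis
    using assms posop_scaleR[OF assms, of "1 / (norm A + 1)"] by (simp add: pcontr_def op_simps)
qed

text \<open>A - A^2 = A (1 - A) A + (1 - A) A (1 - A) is a sum of two positive operators; the test
  vectors are \<open>A v\<close> and \<open>v - A v\<close>.\<close>

lemma pcontr_square_le:
  assumes "pcontr A" shows "A v \<bullet> A v \<le> v \<bullet> A v"
proof -
  have sa: "A u \<bullet> w = u \<bullet> A w" for u w using assms by (simp add: pcontr_def posop_def selfadjD)
  let ?w = "v - A v"
  have "0 \<le> A v \<bullet> A v - A v \<bullet> A (A v)" using assms by (simp add: pcontr_def)
  moreover have "0 \<le> ?w \<bullet> A ?w" using assms by (simp add: pcontr_def posop_def)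
  moreover have "?w \<bullet> A ?w = v \<bullet> A v - A v \<bullet> A v - A v \<bullet> A v + A v \<bullet> A (A v)"
    by (simp add: op_simps sa)
  ultimately show ?thesis by (simp add: sa)
qed

lemma pcontr_norm_le:
  assumes "pcontr A" shows "norm (A v) \<le> norm v"
proof -
  have "A v \<bullet> A v \<le> v \<bullet> v" using pcontr_square_le[OF assms, of v] assms
    by (meson order_trans pcontr_def)
  then show ?thesis by (simp add: norm_le)
qed

lemma pcontr_diff_square:
  assumes "pcontr A" shows "pcontr (A - (A o\<^sub>L A))"
proof -
  have sa: "A u \<bullet> w = u \<bullet> A w" for u w using assms by (simp add: pcontr_def posop_def selfadjD)
  have "selfadj (A - (A o\<^sub>L A))" using assms
    by (intro selfadj_diff selfadj_compose) (auto simp: pcontr_def posop_def)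
  moreover have "v \<bullet> (A - (A o\<^sub>L A)) v = v \<bullet> A v - A v \<bullet> A v" for v
    by (simp add: op_simps sa)
  moreover have "v \<bullet> A v - A v \<bullet> A v \<le> v \<bullet> v" for v
    using assms inner_ge_zero[of "A v"] by (smt (verit) pcontr_def)
  ultimately show ?thesis using pcontr_square_le[OF assms] by (simp add: pcontr_def posop_def)
qed

text \<open>Riesz's iteration S_{k+1} = S_k - S_k^2 started at c A peels off squares, and each
  square contributes \<open>S k v \<bullet> B (S k v) \<ge> 0\<close>. A square root of A would give
  the claim at once, but the construction of square roots relies on this lemma.\<close>

lemma posop_compose:
  fixes A B :: "('a::real_inner) operator"
  assumes A: "posop A" and B: "posop B" and comm: "A o\<^sub>L B = B o\<^sub>L A"
  shows "posop (A o\<^sub>L B)"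
proof -
  define c where "c = 1 / (norm A + 1)"
  have c: "c > 0" by (simp add: c_def add_nonneg_pos)
  define S where "S k = ((\<lambda>T. T - (T o\<^sub>L T)) ^^ k) (c *\<^sub>R A)" for k
  have S_Suc: "S (Suc k) = S k - (S k o\<^sub>L S k)" for k by (simp add: S_def)
  have pc: "pcontr (S k)" for k
    by (induction k) (use pcontr_scale[OF A] pcontr_diff_square in \<open>auto simp: S_def c_def\<close>)
  have sa: "S k u \<bullet> w = u \<bullet> S k w" for k u w
    using pc by (simp add: pcontr_def posop_def selfadjD)
  have SB: "S k (B v) = B (S k v)" for k v
  proof (induction k arbitrary: v)
    case 0 then show ?case using commute_apply[OF comm] by (simp add: S_def op_simps)
  next
    case (Suc k) then show ?case by (simp add: S_Suc op_simps)
  qed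
  have nonneg: "0 \<le> v \<bullet> A (B v)" for v
  proof -
    have "v \<bullet> S (Suc k) (B v) \<le> v \<bullet> S k (B v)" for k
    proof -
      have "0 \<le> S k v \<bullet> B (S k v)" using B by (simp add: posop_def)
      also have "\<dots> = v \<bullet> S k (S k (B v))" by (simp add: SB sa)
      finally show ?thesis by (simp add: S_Suc op_simps)
    qed
    then have le: "v \<bullet> S k (B v) \<le> v \<bullet> S 0 (B v)" for k
      by (induction k) (auto intro: order_trans)
    let ?u = "B v"
    have partial: "(\<Sum>k<m. S k ?u \<bullet> S k ?u) = ?u \<bullet> S 0 ?u - ?u \<bullet> S m ?u" for m
      by (induction m) (auto simp: S_Suc op_simps sa)
    \<comment> \<open>Square-summability drives \<open>S k (B v)\<close> to 0. The decreasing
      numbers \<open>v \<bullet> S k (B v)\<close> thus tend to 0, so the initial one is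
      nonnegative.\<close>
    have "summable (\<lambda>k. S k ?u \<bullet> S k ?u)"
    proof (rule summableI_nonneg_bounded[where x = "?u \<bullet> S 0 ?u"])
      show "(\<Sum>k<m. S k ?u \<bullet> S k ?u) \<le> ?u \<bullet> S 0 ?u" for m
        using pc[of m] unfolding partial by (simp add: pcontr_def posop_def)
    qed simp
    then have "(\<lambda>k. (norm (S k ?u))\<^sup>2) \<longlonglongrightarrow> 0"
      using summable_LIMSEQ_zero by (fastforce simp: power2_norm_eq_inner)
    then have "(\<lambda>k. norm (S k ?u)) \<longlonglongrightarrow> 0"
      using tendsto_real_sqrt by fastforce
    then have "(\<lambda>k. S k ?u) \<longlonglongrightarrow> 0" by (simp add: tendsto_norm_zero_iff)
    then have "(\<lambda>k. v \<bullet> S k ?u) \<longlonglongrightarrow> v \<bullet> 0" by (intro tendsto_intros)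
    then have "0 \<le> v \<bullet> S 0 ?u"
      using LIMSEQ_le_const2[of "\<lambda>k. v \<bullet> S k ?u" 0] le by fastforce
    then show ?thesis using c by (simp add: S_def op_simps zero_le_mult_iff)
  qed
  have "selfadj (A o\<^sub>L B)" using A B comm by (auto simp: posop_def intro: selfadj_compose)
  with nonneg show ?thesis by (simp add: posop_def)
qed

section \<open>Strong limits of monotone sequences of operators\<close>

lemma blinfun_limit_exists:
  fixes A :: "nat \<Rightarrow> ('a::real_normed_vector) operator"
  assumes lim: "\<And>v. (\<lambda>n. A n v) \<longlonglongrightarrow> g v" and bd: "\<And>n v. norm (A n v) \<le> norm v"
  shows "\<exists>G. blinfun_apply G = g"
proof -
  have "bounded_linear g"
  proof (rule bounded_linear_intro[where K = 1])
    show "g (u + v) = g u + g v" for u v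
      using tendsto_add[OF lim[of u] lim[of v]] lim[of "u + v"]
      by (auto simp: op_simps intro: LIMSEQ_unique)
    show "g (c *\<^sub>R v) = c *\<^sub>R g v" for c v
      using tendsto_scaleR[OF tendsto_const lim[of v], of c] lim[of "c *\<^sub>R v"]
      by (auto simp: op_simps intro: LIMSEQ_unique)
    show "norm (g v) \<le> norm v * 1" for v
      using LIMSEQ_le_const2[OF tendsto_norm[OF lim[of v]]] bd by auto
  qed
  then show ?thesis using bounded_linear_Blinfun_apply by blast
qed

text \<open>The differences A_m - A_n are again positive contractions, so
  \<open>pcontr_square_le\<close> bounds |A_m v - A_n v|^2 by the drop of the real sequence
  \<open>v \<bullet> A n v\<close>, which converges because it is monotone and bounded.\<close>

lemma decreasing_pcontr_limit:
  fixes A :: "nat \<Rightarrow> ('a::{real_inner, complete_space}) operator"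
  assumes pc: "\<And>n. pcontr (A n)" and dec: "\<And>n v. v \<bullet> A (Suc n) v \<le> v \<bullet> A n v"
  obtains G where "pcontr G" "\<And>v. (\<lambda>n. A n v) \<longlonglongrightarrow> G v"
proof -
  have sa: "selfadj (A n)" for n using pc by (simp add: pcontr_def posop_def)
  have mono: "v \<bullet> A n v \<le> v \<bullet> A m v" if "m \<le> n" for m n v
    using that by (rule lift_Suc_antimono_le[rotated]) (rule dec)
  have ineq: "(norm (A m v - A n v))\<^sup>2 \<le> v \<bullet> A m v - v \<bullet> A n v" if "m \<le> n" for m n v
  proof -
    have "pcontr (A m - A n)"
      unfolding pcontr_def posop_def
    proof (intro conjI allI)
      show "v \<bullet> (A m - A n) v \<le> v \<bullet> v" for v
        using pc[of m] pc[of n] unfolding pcontr_def posop_def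
        by (simp add: op_simps) (smt (verit))
    qed (use sa mono[OF that] in \<open>auto simp: op_simps selfadj_diff\<close>)
    from pcontr_square_le[OF this, of v] show ?thesis
      by (simp add: power2_norm_eq_inner op_simps)
  qed
  have "\<exists>l. (\<lambda>n. A n v) \<longlonglongrightarrow> l" for v
  proof -
    have "convergent (\<lambda>n. v \<bullet> A n v)"
    proof (rule Bseq_monoseq_convergent)
      show "monoseq (\<lambda>n. v \<bullet> A n v)" using mono by (auto intro: decseq_imp_monoseq simp: decseq_def)
      show "Bseq (\<lambda>n. v \<bullet> A n v)"
        by (rule BseqI'[where K = "v \<bullet> v"]) (use pc in \<open>auto simp: pcontr_def posop_def\<close>)
    qed
    then have cau: "Cauchy (\<lambda>n. v \<bullet> A n v)" by (rule convergent_Cauchy)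
    have "Cauchy (\<lambda>n. A n v)"
    proof (rule CauchyI')
      fix e :: real assume e: "e > 0"
      obtain M where M: "\<And>m n. m \<ge> M \<Longrightarrow> n \<ge> M \<Longrightarrow> norm (v \<bullet> A m v - v \<bullet> A n v) < e\<^sup>2"
        using CauchyD[OF cau, of "e\<^sup>2"] e by auto
      show "\<exists>M. \<forall>m\<ge>M. \<forall>n>m. dist (A m v) (A n v) < e"
      proof (intro exI allI impI)
        fix m n assume "M \<le> m" "m < n"
        then have "(norm (A m v - A n v))\<^sup>2 < e\<^sup>2"
          using ineq[of m n v] M[of m n] by auto
        then show "dist (A m v) (A n v) < e"
          using e by (simp add: dist_norm power_less_imp_less_base)
      qed
    qed
    then show ?thesis using Cauchy_convergent_iff convergent_def by blast
  qed
  then obtain g where g: "\<And>v. (\<lambda>n. A n v) \<longlonglongrightarrow> g v" by metis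
  from blinfun_limit_exists[OF g pcontr_norm_le[OF pc]] obtain G where "blinfun_apply G = g"
    by blast
  with g have G: "(\<lambda>n. A n v) \<longlonglongrightarrow> G v" for v by simp
  have lim: "(\<lambda>n. u \<bullet> A n v) \<longlonglongrightarrow> u \<bullet> G v" for u v by (intro tendsto_intros G)
  have "G u \<bullet> v = u \<bullet> G v" for u v
    by (rule LIMSEQ_unique[OF lim[of v u, unfolded inner_commute[of v]]])
      (use lim[of u v] in \<open>simp add: selfadjD[OF sa]\<close>)
  moreover have "0 \<le> v \<bullet> G v" for v
    by (rule LIMSEQ_le_const[OF lim]) (use pc in \<open>auto simp: pcontr_def posop_def\<close>)
  moreover have "v \<bullet> G v \<le> v \<bullet> v" for v
    by (rule LIMSEQ_le_const2[OF lim]) (use pc in \<open>auto simp: pcontr_def posop_def\<close>)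
  ultimately have "pcontr G" by (auto simp: pcontr_def posop_def selfadj_def)
  with G show ?thesis by (rule that[rotated -1])
qed

lemma commute_limit:
  assumes "\<And>v. (\<lambda>n. blinfun_apply (A n) v) \<longlonglongrightarrow> blinfun_apply G v"
    and "\<And>n. y o\<^sub>L A n = A n o\<^sub>L y"
  shows "y o\<^sub>L G = G o\<^sub>L y"
proof (rule commuteI)
  fix v
  have "(\<lambda>n. y (A n v)) \<longlonglongrightarrow> y (G v)" by (intro blinfun.tendsto assms tendsto_const)
  moreover have "(\<lambda>n. y (A n v)) \<longlonglongrightarrow> G (y v)"
    using assms(1)[of "y v"] by (simp add: commute_apply[OF assms(2)])
  ultimately show "y (G v) = G (y v)" by (rule LIMSEQ_unique)
qed

lemma pcontr_compl: "pcontr A \<Longrightarrow> pcontr (id_blinfun - A)"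
  by (simp add: pcontr_def posop_def selfadj_diff op_simps)

lemma pcontr_compose:
  assumes "pcontr A" "pcontr B" "A o\<^sub>L B = B o\<^sub>L A" shows "pcontr (A o\<^sub>L B)"
proof -
  have "posop (A o\<^sub>L B)" using posop_compose[OF _ _ assms(3)] assms(1,2) unfolding pcontr_def by blast
  moreover have "v \<bullet> A (B v) \<le> v \<bullet> v" for v
  proof -
    have "v \<bullet> A (B v) \<le> norm v * norm (A (B v))" by (rule norm_cauchy_schwarz)
    also have "\<dots> \<le> norm v * norm v"
      using pcontr_norm_le[OF assms(1), of "B v"] pcontr_norm_le[OF assms(2), of v]
      by (intro mult_left_mono) auto
    finally show ?thesis by (simp add: dot_square_norm power2_eq_square)
  qed
  ultimately show ?thesis by (simp add: pcontr_def)
qed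

section \<open>Closure properties of the double commutant of one operator\<close>

lemma bicommD: "z \<in> bicomm x \<Longrightarrow> y o\<^sub>L x = x o\<^sub>L y \<Longrightarrow> y o\<^sub>L z = z o\<^sub>L y"
  by (simp add: bicomm_def)

lemma bicomm_self: "x \<in> bicomm x" and bicomm_id: "id_blinfun \<in> bicomm x"
  and bicomm_zero: "0 \<in> bicomm x"
  by (auto simp: bicomm_def intro!: blinfun_eqI simp: op_simps)

lemmas compose_bilinear =
  bounded_bilinear.add_left[OF bounded_bilinear_blinfun_compose]
  bounded_bilinear.add_right[OF bounded_bilinear_blinfun_compose]
  bounded_bilinear.diff_left[OF bounded_bilinear_blinfun_compose]
  bounded_bilinear.diff_right[OF bounded_bilinear_blinfun_compose]
  bounded_bilinear.minus_left[OF bounded_bilinear_blinfun_compose]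
  bounded_bilinear.minus_right[OF bounded_bilinear_blinfun_compose]
  bounded_bilinear.scaleR_left[OF bounded_bilinear_blinfun_compose]
  bounded_bilinear.scaleR_right[OF bounded_bilinear_blinfun_compose]
  bounded_bilinear.zero_left[OF bounded_bilinear_blinfun_compose]
  bounded_bilinear.zero_right[OF bounded_bilinear_blinfun_compose]
  bounded_bilinear.sum_left[OF bounded_bilinear_blinfun_compose]
  bounded_bilinear.sum_right[OF bounded_bilinear_blinfun_compose]

lemma bicomm_add: "a \<in> bicomm x \<Longrightarrow> b \<in> bicomm x \<Longrightarrow> a + b \<in> bicomm x"
  and bicomm_diff: "a \<in> bicomm x \<Longrightarrow> b \<in> bicomm x \<Longrightarrow> a - b \<in> bicomm x"
  and bicomm_scaleR: "a \<in> bicomm x \<Longrightarrow> c *\<^sub>R a \<in> bicomm x"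
  by (simp_all add: bicomm_def compose_bilinear)

lemma bicomm_compose:
  assumes "a \<in> bicomm x" "b \<in> bicomm x" shows "a o\<^sub>L b \<in> bicomm x"
  unfolding bicomm_def
proof (intro CollectI allI impI commuteI)
  fix y v assume y: "y o\<^sub>L x = x o\<^sub>L y"
  show "y ((a o\<^sub>L b) v) = (a o\<^sub>L b) (y v)"
    using commute_apply[OF bicommD[OF assms(1) y]] commute_apply[OF bicommD[OF assms(2) y]] by simp
qed

lemma bicomm_uminus: "a \<in> bicomm x \<Longrightarrow> - a \<in> bicomm x"
  using bicomm_scaleR[of a x "- 1"] by simp

lemma bicomm_sum: "(\<And>i. i \<in> I \<Longrightarrow> f i \<in> bicomm x) \<Longrightarrow> sum f I \<in> bicomm x"
  by (induction I rule: infinite_finite_induct) (auto intro: bicomm_add bicomm_zero)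

lemma bicomm_trans: "a \<in> bicomm x \<Longrightarrow> x \<in> bicomm y \<Longrightarrow> a \<in> bicomm y"
  unfolding bicomm_def by blast

lemma bicomm_commute:
  assumes "a \<in> bicomm x" "b \<in> bicomm x" shows "a o\<^sub>L b = b o\<^sub>L a"
  by (rule bicommD[OF assms(2)]) (rule bicommD[OF assms(1) refl, symmetric])

lemma bicomm_limit:
  "(\<And>v. (\<lambda>n. blinfun_apply (A n) v) \<longlonglongrightarrow> blinfun_apply G v) \<Longrightarrow> (\<And>n. A n \<in> bicomm x)
    \<Longrightarrow> G \<in> bicomm x"
  unfolding bicomm_def using commute_limit[of A G] by blast

text \<open>With B = 1 - A, a solution of Z = (B + Z^2) / 2 satisfies (1 - Z)^2 = A. The iterates
  from 0 increase, because Z_{n+2} - Z_{n+1} = (Z_{n+1} - Z_n) (Z_{n+1} + Z_n) / 2 is half a product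
  of commuting positive operators.\<close>

lemma pcontr_sqrt:
  fixes A :: "('a::{real_inner, complete_space}) operator"
  assumes A: "pcontr A"
  obtains R where "pcontr R" "R o\<^sub>L R = A" "R \<in> bicomm A"
proof -
  define B where "B = id_blinfun - A"
  have B: "pcontr B" unfolding B_def by (rule pcontr_compl[OF A])
  define Z where "Z n = ((\<lambda>Z. (1/2) *\<^sub>R (B + (Z o\<^sub>L Z))) ^^ n) 0" for n
  have Z_Suc: "Z (Suc n) = (1/2) *\<^sub>R (B + (Z n o\<^sub>L Z n))" for n by (simp add: Z_def)
  have bc: "Z n \<in> bicomm A" for n
  proof (induction n)
    case 0 show ?case by (simp add: Z_def bicomm_zero)
  next
    case (Suc n)
    show ?case unfolding Z_Suc B_def
      by (intro bicomm_scaleR bicomm_add bicomm_diff bicomm_compose bicomm_self bicomm_id Suc)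
  qed
  have pc: "pcontr (Z n)" for n
  proof (induction n)
    case 0 show ?case by (simp add: Z_def pcontr_def posop_def)
  next
    case (Suc n)
    have ZZ: "pcontr (Z n o\<^sub>L Z n)" by (intro pcontr_compose Suc) simp
    have "posop (Z (Suc n))" unfolding Z_Suc
      using B ZZ by (intro posop_scaleR posop_add) (auto simp: pcontr_def)
    moreover have "v \<bullet> B v + v \<bullet> Z n (Z n v) \<le> 2 * (v \<bullet> v)" for v
      using B ZZ unfolding pcontr_def by (smt (verit) blinfun_apply_blinfun_compose)
    ultimately show ?case by (simp add: pcontr_def Z_Suc op_simps mult.commute)
  qed
  have inc: "posop (Z (Suc n) - Z n)" for n
  proof (induction n)
    case 0 then show ?case using pc[of 1] by (simp add: Z_def pcontr_def)
  next
    case (Suc n)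
    have comm: "Z (Suc n) o\<^sub>L Z n = Z n o\<^sub>L Z (Suc n)" by (rule bicomm_commute[OF bc bc])
    have "posop ((Z (Suc n) - Z n) o\<^sub>L (Z (Suc n) + Z n))"
    proof (rule posop_compose[OF Suc])
      show "posop (Z (Suc n) + Z n)" using pc by (simp add: pcontr_def posop_add)
      show "(Z (Suc n) - Z n) o\<^sub>L (Z (Suc n) + Z n) = (Z (Suc n) + Z n) o\<^sub>L (Z (Suc n) - Z n)"
        by (rule bicomm_commute[of _ A]) (intro bicomm_add bicomm_diff bc)+
    qed
    moreover have "(1/2) *\<^sub>R ((Z (Suc n) - Z n) o\<^sub>L (Z (Suc n) + Z n)) = Z (Suc (Suc n)) - Z (Suc n)"
      by (rule blinfun_eqI)
        (simp add: Z_Suc[of "Suc n"] Z_Suc[of n, symmetric], subst (3) Z_Suc,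
         simp add: op_simps commute_apply[OF comm] algebra_simps)
    ultimately show ?case by (metis posop_scaleR zero_le_divide_1_iff zero_le_numeral)
  qed
  have dec: "v \<bullet> (id_blinfun - Z (Suc n)) v \<le> v \<bullet> (id_blinfun - Z n) v" for n v
    using inc[of n] by (simp add: posop_def op_simps)
  obtain R where R: "pcontr R" and lim: "\<And>v. (\<lambda>n. (id_blinfun - Z n) v) \<longlonglongrightarrow> R v"
    by (rule decreasing_pcontr_limit[of "\<lambda>n. id_blinfun - Z n"]) (use pc dec in \<open>auto intro: pcontr_compl\<close>)
  have "R o\<^sub>L R = A"
  proof (rule blinfun_eqI)
    fix v
    let ?D = "\<lambda>n. id_blinfun - Z n"
    have "(\<lambda>n. ?D n (?D n v - R v)) \<longlonglongrightarrow> 0"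
    proof (rule Lim_null_comparison)
      show "\<forall>\<^sub>F n in sequentially. norm (?D n (?D n v - R v)) \<le> norm (?D n v - R v)"
        by (intro always_eventually allI pcontr_norm_le pcontr_compl pc)
      show "(\<lambda>n. norm (?D n v - R v)) \<longlonglongrightarrow> 0"
        using tendsto_diff[OF lim[of v] tendsto_const[of "R v"]] by (intro tendsto_norm_zero) simp
    qed
    from tendsto_add[OF this lim[of "R v"]] have D2: "(\<lambda>n. ?D n (?D n v)) \<longlonglongrightarrow> R (R v)"
      by (simp add: op_simps)
    \<comment> \<open>The recursion says D_n^2 = A + 2 (D_n - D_{n+1}) for D_n = 1 - Z_n; the
      correction vanishes in the limit since D_n converges strongly.\<close>
    have eq: "?D n (?D n v) = A v + 2 *\<^sub>R (?D n v - ?D (Suc n) v)" for n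
    proof -
      have ZZ: "Z n (Z n v) = 2 *\<^sub>R Z (Suc n) v - (v - A v)"
        by (simp add: Z_Suc B_def op_simps)
      have "?D n (?D n v) = v - Z n v - (Z n v - Z n (Z n v))" by (simp add: op_simps)
      also have "\<dots> = A v + 2 *\<^sub>R ((v - Z n v) - (v - Z (Suc n) v))"
        unfolding ZZ scaleR_2 by simp
      finally show ?thesis by (simp add: op_simps)
    qed
    have "(\<lambda>n. A v + 2 *\<^sub>R (?D n v - ?D (Suc n) v)) \<longlonglongrightarrow> A v + 2 *\<^sub>R (R v - R v)"
      by (rule tendsto_add[OF tendsto_const tendsto_scaleR[OF tendsto_const
            tendsto_diff[OF lim LIMSEQ_Suc[OF lim]]]])
    then have "(\<lambda>n. ?D n (?D n v)) \<longlonglongrightarrow> A v" unfolding eq by simp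
    from LIMSEQ_unique[OF D2 this] show "(R o\<^sub>L R) v = A v" by simp
  qed
  moreover have "R \<in> bicomm A"
    using lim by (rule bicomm_limit) (intro bicomm_diff bicomm_id bc)
  ultimately show ?thesis using that R by blast
qed

section \<open>Spectral projections onto half-lines\<close>

primrec opow :: "('a::real_normed_vector) operator \<Rightarrow> nat \<Rightarrow> 'a operator" where
  "opow x 0 = id_blinfun"
| "opow x (Suc n) = x o\<^sub>L opow x n"

lemma opow_bicomm: "x \<in> bicomm y \<Longrightarrow> opow x n \<in> bicomm y"
  by (induction n) (auto intro: bicomm_id bicomm_compose)

lemma pcontr_opow: "pcontr K \<Longrightarrow> pcontr (opow K n)"
proof (induction n)
  case 0 show ?case by (simp add: pcontr_def posop_def)
next
  case (Suc n)
  have "K o\<^sub>L opow K n = opow K n o\<^sub>L K"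
    by (rule bicomm_commute[of _ K]) (intro bicomm_self opow_bicomm)+
  with Suc show ?case by (simp add: pcontr_compose)
qed

text \<open>The powers of K = 1 - H decrease strongly to the projection onto the fixed vectors of K,
  which are the kernel of H.\<close>

lemma kernel_projection:
  fixes H :: "('a::{real_inner, complete_space}) operator"
  assumes H: "pcontr H"
  obtains F where "orthproj F" "F \<in> bicomm H" "\<And>v. F v = v \<longleftrightarrow> H v = 0"
proof -
  define K where "K = id_blinfun - H"
  have K: "pcontr K" unfolding K_def by (rule pcontr_compl[OF H])
  have KH: "opow K n \<in> bicomm H" for n
    unfolding K_def by (intro opow_bicomm bicomm_diff bicomm_id bicomm_self)
  have "v \<bullet> opow K (Suc n) v \<le> v \<bullet> opow K n v" for n v
  proof -
    have "posop (H o\<^sub>L opow K n)"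
      using H pcontr_opow[OF K, of n] bicomm_commute[OF bicomm_self KH[of n]]
      by (intro posop_compose) (auto simp: pcontr_def)
    then show ?thesis by (simp add: posop_def K_def op_simps)
  qed
  with pcontr_opow[OF K] obtain F where F: "pcontr F" and lim: "\<And>v. (\<lambda>n. opow K n v) \<longlonglongrightarrow> F v"
    using decreasing_pcontr_limit[of "opow K"] by blast
  have KF: "K (F v) = F v" for v
  proof (rule LIMSEQ_unique)
    show "(\<lambda>n. K (opow K n v)) \<longlonglongrightarrow> K (F v)" by (intro blinfun.tendsto tendsto_const lim)
    show "(\<lambda>n. K (opow K n v)) \<longlonglongrightarrow> F v" using LIMSEQ_Suc[OF lim[of v]] by simp
  qed
  have HF: "H (F v) = 0" for v using KF[of v] by (simp add: K_def op_simps)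
  have fix_F: "F v = v" if "H v = 0" for v
  proof -
    have "opow K n v = v" for n by (induction n) (use that in \<open>auto simp: K_def op_simps\<close>)
    then show ?thesis using lim[of v] by (simp add: LIMSEQ_const_iff)
  qed
  have "F o\<^sub>L F = F" by (rule blinfun_eqI) (simp add: fix_F HF)
  moreover have "F \<in> bicomm H" using lim KH by (rule bicomm_limit)
  moreover have "F v = v \<longleftrightarrow> H v = 0" for v using fix_F HF[of v] by auto
  ultimately show ?thesis using F by (intro that[of F]) (auto simp: orthproj_def pcontr_def posop_def)
qed

text \<open>A measure-free description of the spectral projection of the open half-line above a. The
  strict bound on the range against the weak bound on the kernel is what makes it unique.\<close>

definition is_gtproj :: "('a::real_inner) operator \<Rightarrow> real \<Rightarrow> 'a operator \<Rightarrow> bool" where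
  "is_gtproj x a P \<longleftrightarrow> orthproj P \<and> x o\<^sub>L P = P o\<^sub>L x \<and>
     (\<forall>v. P v = v \<and> v \<noteq> 0 \<longrightarrow> a * (v \<bullet> v) < v \<bullet> x v) \<and>
     (\<forall>v. P v = 0 \<longrightarrow> v \<bullet> x v \<le> a * (v \<bullet> v))"

text \<open>Splitting into positive and negative parts: with b = |S| for a scaled copy S of T, the
  operators h = (b + S) / 2 and g = (b - S) / 2 satisfy h g = 0, and P projects onto the orthogonal
  complement of the kernel of h.\<close>

lemma gtproj_zero_exists:
  fixes T :: "('a::{real_inner, complete_space}) operator"
  assumes T: "selfadj T"
  obtains P where "is_gtproj T 0 P" "P \<in> bicomm T"
proof -
  define c where "c = 1 / (norm T + 1)"
  have c: "c > 0" by (simp add: c_def add_nonneg_pos)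
  define S where "S = c *\<^sub>R T"
  have S: "selfadj S" unfolding S_def by (rule selfadj_scaleR[OF T])
  have contr: "norm (S v) \<le> norm v" for v
  proof -
    have "norm (T v) \<le> norm T * norm v" by (rule norm_blinfun)
    also have "\<dots> \<le> (norm T + 1) * norm v" by (intro mult_right_mono) auto
    finally show ?thesis by (simp add: S_def op_simps c_def divide_le_eq mult.commute add_nonneg_pos)
  qed
  have sq: "pcontr (h o\<^sub>L h)" if "selfadj h" "\<And>v. norm (h v) \<le> norm v" for h :: "'a operator"
  proof -
    have "v \<bullet> h (h v) \<le> v \<bullet> v" for v
      using that(2)[of v] by (simp add: selfadjD[OF that(1), symmetric] norm_le)
    then show ?thesis using posop_square[OF that(1)] by (simp add: pcontr_def)
  qed
  obtain b where b: "pcontr b" "b o\<^sub>L b = S o\<^sub>L S" "b \<in> bicomm (S o\<^sub>L S)"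
    using pcontr_sqrt[OF sq[OF S contr]] by blast
  have bS: "b \<in> bicomm S" by (rule bicomm_trans[OF b(3)]) (intro bicomm_compose bicomm_self)
  define h where "h = (1/2) *\<^sub>R (b + S)"
  define g where "g = (1/2) *\<^sub>R (b - S)"
  have hS: "h \<in> bicomm S" and gS: "g \<in> bicomm S" unfolding h_def g_def
    by (intro bicomm_scaleR bicomm_add bicomm_diff bicomm_self bS)+
  have sa_h: "selfadj h"
    unfolding h_def using b(1) S by (intro selfadj_scaleR selfadj_add) (auto simp: pcontr_def posop_def)
  have norm_h: "norm (h v) \<le> norm v" for v
  proof -
    have "norm (b v + S v) \<le> norm v + norm v"
      by (intro norm_triangle_mono pcontr_norm_le b contr)
    then show ?thesis by (simp add: h_def op_simps)
  qed
  \<comment> \<open>\<open>h o\<^sub>L h\<close> has the kernel of h, and it is a positive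
    contraction as the square of a self-adjoint contraction.\<close>
  obtain F where F: "orthproj F" "F \<in> bicomm (h o\<^sub>L h)" "\<And>v. F v = v \<longleftrightarrow> (h o\<^sub>L h) v = 0"
    using kernel_projection[OF sq[OF sa_h norm_h]] by blast
  have FS: "F \<in> bicomm S"
    by (rule bicomm_trans[OF F(2)]) (intro bicomm_compose hS)
  have ker: "F v = v \<longleftrightarrow> h v = 0" for v
  proof -
    have "h v = 0" if "h (h v) = 0"
      using that selfadjD[OF sa_h, of v "h v"] by simp
    then show ?thesis using F(3)[of v] by auto
  qed
  have split: "b v = h v + g v" "S v = h v - g v" for v
    by (simp_all add: h_def g_def op_simps algebra_simps flip: scaleR_add_left)
  have hg: "h (g v) = 0" for v
    using commute_apply[OF bicomm_commute[OF bS bicomm_self], of v] b(2)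
    by (simp add: h_def g_def op_simps) (metis blinfun_apply_blinfun_compose)
  have neg: "v \<bullet> S v \<le> 0" if "F v = v" for v
    using split[of v] that ker[of v] b(1) by (simp add: pcontr_def posop_def) (metis add_0)
  \<comment> \<open>The range of g lies in the kernel of h, where F is the identity; as F and g
    commute, g vanishes on the kernel of F.\<close>
  have pos: "S v = b v" if "F v = 0" for v
  proof -
    have "g v = F (g v)" using ker[of "g v"] hg by simp
    also have "\<dots> = g (F v)" using commute_apply[OF bicomm_commute[OF FS gS]] .
    finally show ?thesis using that split[of v] by simp
  qed
  have pos': "0 < v \<bullet> S v" if "F v = 0" "v \<noteq> 0" for v
  proof (rule ccontr)
    assume "\<not> 0 < v \<bullet> S v"
    then have "b v \<bullet> b v \<le> 0" using pcontr_square_le[OF b(1), of v] pos[OF that(1)] by simp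
    then have "b v = 0" by (simp flip: power2_norm_eq_inner)
    then have "h v = 0" using pos[OF that(1)] by (simp add: h_def op_simps)
    then have "F v = v" using ker[of v] by simp
    then show False using that by simp
  qed
  define P where "P = id_blinfun - F"
  have "is_gtproj T 0 P"
    unfolding is_gtproj_def
  proof (intro conjI allI impI)
    show "orthproj P" using F(1)
      by (auto simp: orthproj_def P_def selfadj_diff compose_bilinear intro!: blinfun_eqI)
    have "P \<in> bicomm S" unfolding P_def by (intro bicomm_diff bicomm_id FS)
    moreover have "S \<in> bicomm T" unfolding S_def by (intro bicomm_scaleR bicomm_self)
    ultimately show "T o\<^sub>L P = P o\<^sub>L T" using bicomm_trans bicommD[of P T T] by blast
    fix v
    show "0 * (v \<bullet> v) < v \<bullet> T v" if "P v = v \<and> v \<noteq> 0"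
      using pos'[of v] that c by (simp add: P_def S_def op_simps zero_less_mult_iff)
    show "v \<bullet> T v \<le> 0 * (v \<bullet> v)" if "P v = 0"
      using neg[of v] that c by (simp add: P_def S_def op_simps mult_le_0_iff)
  qed
  moreover have "P \<in> bicomm T" unfolding P_def
    by (intro bicomm_diff bicomm_id bicomm_trans[OF FS]) (auto simp: S_def intro: bicomm_scaleR bicomm_self)
  ultimately show ?thesis by (rule that)
qed

lemma gtproj_exists:
  fixes x :: "('a::{real_inner, complete_space}) operator"
  assumes x: "selfadj x"
  obtains P where "is_gtproj x a P" "P \<in> bicomm x"
proof -
  let ?T = "x - a *\<^sub>R id_blinfun"
  have "selfadj ?T" by (intro selfadj_diff x selfadj_scaleR selfadj_id)
  then obtain P where P: "is_gtproj ?T 0 P" "P \<in> bicomm ?T" by (rule gtproj_zero_exists)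
  have "P \<in> bicomm x"
    by (rule bicomm_trans[OF P(2)]) (intro bicomm_diff bicomm_scaleR bicomm_self bicomm_id)
  moreover from this have "is_gtproj x a P"
    using P(1) bicommD[of P x x] by (auto simp: is_gtproj_def op_simps)
  ultimately show ?thesis using that by blast
qed

section \<open>Calculus of orthogonal projections and of half-line projections\<close>

lemma orthproj_idem: "orthproj P \<Longrightarrow> P (P v) = P v"
  unfolding orthproj_def by (metis blinfun_apply_blinfun_compose)

lemma orthproj_sa: "orthproj P \<Longrightarrow> P u \<bullet> v = u \<bullet> P v"
  by (simp add: orthproj_def selfadjD)

lemma orthproj_inner: "orthproj P \<Longrightarrow> v \<bullet> P v = P v \<bullet> P v"
  by (simp add: orthproj_sa orthproj_idem)

lemma orthproj_pcontr: assumes "orthproj P" shows "pcontr P"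
proof -
  have "(v - P v) \<bullet> (v - P v) = v \<bullet> v - v \<bullet> P v" for v
    using orthproj_inner[OF assms] by (simp add: op_simps inner_commute)
  then have "v \<bullet> P v \<le> v \<bullet> v" for v by (metis diff_ge_0_iff_ge inner_ge_zero)
  then show ?thesis
    using assms orthproj_inner[OF assms] by (simp add: pcontr_def posop_def orthproj_def)
qed

lemma orthproj_posop: "orthproj P \<Longrightarrow> posop P"
  using orthproj_pcontr by (auto simp: pcontr_def)

lemma orthproj_compl:
  assumes "orthproj P" shows "orthproj (id_blinfun - P)"
  unfolding orthproj_def
  by (auto intro!: selfadj_diff blinfun_eqI simp: op_simps orthproj_idem[OF assms])
    (use assms in \<open>simp add: orthproj_def\<close>)

lemma orthproj_selfadj: "orthproj P \<Longrightarrow> selfadj P"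
  by (simp add: orthproj_def)

lemma orthproj_add:
  assumes P: "orthproj P" and Q: "orthproj Q" and "P o\<^sub>L Q = 0" shows "orthproj (P + Q)"
proof -
  have "Q o\<^sub>L P = 0"
  proof (rule blinfun_eqI)
    fix v
    have "P (Q w) = 0" for w using arg_cong[OF assms(3), of "\<lambda>T. blinfun_apply T w"] by simp
    then have "u \<bullet> Q (P v) = 0" for u
      by (metis inner_zero_left orthproj_sa[OF P] orthproj_sa[OF Q])
    then show "(Q o\<^sub>L P) v = blinfun_apply 0 v"
      by (metis blinfun_apply_blinfun_compose inner_eq_zero_iff zero_blinfun.rep_eq)
  qed
  then show ?thesis using assms by (auto simp: orthproj_def compose_bilinear selfadj_add)
qed

text \<open>At \<open>v = Q w\<close> the form of Q already exhausts \<open>v \<bullet> v\<close>,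
  so nothing is left for P.\<close>

lemma orthproj_compose_zero:
  assumes P: "orthproj P" and Q: "orthproj Q" and le: "\<And>v. v \<bullet> P v + v \<bullet> Q v \<le> v \<bullet> v"
  shows "P o\<^sub>L Q = 0"
proof (rule blinfun_eqI)
  fix w
  have "Q w \<bullet> P (Q w) \<le> 0" using le[of "Q w"] by (simp add: orthproj_idem[OF Q])
  then have "P (Q w) \<bullet> P (Q w) \<le> 0" by (simp add: orthproj_inner[OF P])
  then show "(P o\<^sub>L Q) w = blinfun_apply 0 w" by (simp flip: power2_norm_eq_inner)
qed

lemma orthproj_limit:
  assumes lim: "\<And>v. (\<lambda>n. blinfun_apply (A n) v) \<longlonglongrightarrow> blinfun_apply P v" and A: "\<And>n. orthproj (A n)"
  shows "orthproj P"
proof -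
  have l: "(\<lambda>n. u \<bullet> A n v) \<longlonglongrightarrow> u \<bullet> P v" for u v by (rule tendsto_inner[OF tendsto_const lim])
  have sa: "P u \<bullet> v = u \<bullet> P v" for u v
  proof (rule LIMSEQ_unique[OF _ l])
    show "(\<lambda>n. u \<bullet> A n v) \<longlonglongrightarrow> P u \<bullet> v"
      using tendsto_inner[OF lim[of u] tendsto_const[of v]] by (simp add: orthproj_sa[OF A])
  qed
  have "u \<bullet> P (P v) = u \<bullet> P v" for u v
  proof (rule LIMSEQ_unique[OF _ l])
    show "(\<lambda>n. u \<bullet> A n v) \<longlonglongrightarrow> u \<bullet> P (P v)"
      using tendsto_inner[OF lim[of u] lim[of v]]
      by (simp add: orthproj_sa[OF A] orthproj_idem[OF A] sa)
  qed
  then have "P (P v) = P v" for v by (rule inner_eqI)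
  then show ?thesis using sa by (auto simp: orthproj_def selfadj_def intro: blinfun_eqI)
qed

lemma is_gtproj_less: "is_gtproj x a P \<Longrightarrow> P v = v \<Longrightarrow> v \<noteq> 0 \<Longrightarrow> a * (v \<bullet> v) < v \<bullet> x v"
  and is_gtproj_le: "is_gtproj x a P \<Longrightarrow> P v = 0 \<Longrightarrow> v \<bullet> x v \<le> a * (v \<bullet> v)"
  by (simp_all add: is_gtproj_def)

text \<open>A vector in the range of \<open>P\<close> and in the kernel of \<open>Q\<close> would satisfy contradictory bounds.\<close>

lemma gtproj_le:
  assumes P: "is_gtproj x a P" and Q: "is_gtproj x b Q" and "b \<le> a" and comm: "P o\<^sub>L Q = Q o\<^sub>L P"
  shows "P o\<^sub>L Q = P"
proof (rule blinfun_eqI)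
  fix w
  have p: "orthproj P" and q: "orthproj Q" using P Q by (auto simp: is_gtproj_def)
  let ?v = "P w - Q (P w)"
  have "P ?v = ?v" "Q ?v = 0"
    using commute_apply[OF comm] by (simp_all add: op_simps orthproj_idem p q)
  then have "?v \<noteq> 0 \<longrightarrow> a * (?v \<bullet> ?v) < ?v \<bullet> x ?v" "?v \<bullet> x ?v \<le> b * (?v \<bullet> ?v)"
    using P Q unfolding is_gtproj_def by blast+
  moreover have "b * (?v \<bullet> ?v) \<le> a * (?v \<bullet> ?v)" using \<open>b \<le> a\<close> by (intro mult_right_mono) auto
  ultimately have "?v = 0" by linarith
  then show "(P o\<^sub>L Q) w = P w" using commute_apply[OF comm] by simp
qed

text \<open>Membership in \<open>bicomm x\<close> is part of the choice: it makes the chosen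
  projection commute with any competitor, which \<open>gtproj_le\<close> demands in the proof of
  uniqueness.\<close>

definition gtproj :: "('a::real_inner) operator \<Rightarrow> real \<Rightarrow> 'a operator" where
  "gtproj x a = (SOME P. is_gtproj x a P \<and> P \<in> bicomm x)"

context
  fixes x :: "('a::{real_inner, complete_space}) operator"
  assumes x: "selfadj x"
begin

lemma is_gtproj_gtproj: "is_gtproj x a (gtproj x a)"
  and gtproj_bicomm: "gtproj x a \<in> bicomm x"
proof -
  have "\<exists>P. is_gtproj x a P \<and> P \<in> bicomm x" using gtproj_exists[OF x] by metis
  then have "is_gtproj x a (gtproj x a) \<and> gtproj x a \<in> bicomm x"
    unfolding gtproj_def by (rule someI_ex)
  then show "is_gtproj x a (gtproj x a)" "gtproj x a \<in> bicomm x" by auto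
qed

lemma orthproj_gtproj: "orthproj (gtproj x a)"
  using is_gtproj_gtproj by (auto simp: is_gtproj_def)

lemma gtproj_unique:
  assumes Q: "is_gtproj x a Q" shows "Q = gtproj x a"
proof -
  let ?P = "gtproj x a"
  have "x o\<^sub>L Q = Q o\<^sub>L x" using Q by (auto simp: is_gtproj_def)
  then have comm: "Q o\<^sub>L ?P = ?P o\<^sub>L Q" using bicommD[OF gtproj_bicomm, of Q a] by simp
  have "Q o\<^sub>L ?P = Q" by (rule gtproj_le[OF Q is_gtproj_gtproj order_refl comm])
  moreover have "?P o\<^sub>L Q = ?P" by (rule gtproj_le[OF is_gtproj_gtproj Q order_refl comm[symmetric]])
  ultimately show ?thesis using comm by simp
qed

lemma gtproj_commute: "gtproj x a o\<^sub>L gtproj x b = gtproj x b o\<^sub>L gtproj x a"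
  by (rule bicomm_commute[OF gtproj_bicomm gtproj_bicomm])

lemma gtproj_compose: "gtproj x a o\<^sub>L gtproj x b = gtproj x (max a b)"
  using gtproj_le[OF is_gtproj_gtproj is_gtproj_gtproj _ gtproj_commute, of b a]
    gtproj_le[OF is_gtproj_gtproj is_gtproj_gtproj _ gtproj_commute, of a b] gtproj_commute[of a b]
  by (auto simp: max_def)

lemma gtproj_mono: "a \<le> b \<Longrightarrow> v \<bullet> gtproj x b v \<le> v \<bullet> gtproj x a v"
proof -
  assume "a \<le> b"
  then have "gtproj x b v = gtproj x b (gtproj x a v)"
    using gtproj_compose[of b a] by (metis blinfun_apply_blinfun_compose max.absorb1)
  then have "norm (gtproj x b v) \<le> norm (gtproj x a v)"
    by (metis orthproj_gtproj orthproj_pcontr pcontr_norm_le)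
  then show ?thesis by (simp add: orthproj_inner[OF orthproj_gtproj] norm_le)
qed

lemma gtproj_ge_norm: "norm x \<le> a \<Longrightarrow> gtproj x a = 0"
proof (rule gtproj_unique[symmetric])
  assume a: "norm x \<le> a"
  have "v \<bullet> x v \<le> a * (v \<bullet> v)" for v
    using inner_apply_le[of v x] mult_right_mono[OF a inner_ge_zero[of v]] by linarith
  then show "is_gtproj x a 0" by (simp add: is_gtproj_def orthproj_def compose_bilinear)
qed

text \<open>The bound on a is strict, unlike in \<open>gtproj_ge_norm\<close>:
  \<open>- norm x\<close> may be an eigenvalue, and the half-line above it is open.\<close>

lemma gtproj_less_norm: "a < - norm x \<Longrightarrow> gtproj x a = id_blinfun"
proof (rule gtproj_unique[symmetric])
  assume a: "a < - norm x"
  have "a * (v \<bullet> v) < v \<bullet> x v" if "v \<noteq> 0" for v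
    using inner_apply_le[of v "- x"] mult_strict_right_mono[OF a, of "v \<bullet> v"] that by (simp add: op_simps)
  then show "is_gtproj x a id_blinfun"
    by (auto simp: is_gtproj_def orthproj_def intro!: blinfun_eqI)
qed

text \<open>The projections for a + 1/(n+1) increase, so they have a strong limit; it satisfies the
  characterisation at a and is identified by uniqueness.\<close>

lemma gtproj_right_cont:
  "(\<lambda>n. gtproj x (a + 1 / real (Suc n)) v) \<longlonglongrightarrow> gtproj x a v"
proof -
  let ?A = "\<lambda>n. id_blinfun - gtproj x (a + 1 / real (Suc n))"
  have dec: "v \<bullet> ?A (Suc n) v \<le> v \<bullet> ?A n v" for n v
    using gtproj_mono[of "a + 1 / real (Suc (Suc n))" "a + 1 / real (Suc n)" v]
    by (simp add: op_simps frac_le)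
  have pc: "pcontr (?A n)" for n
    by (intro orthproj_pcontr orthproj_compl orthproj_gtproj)
  obtain G where G: "pcontr G" and lim: "\<And>v. (\<lambda>n. ?A n v) \<longlonglongrightarrow> G v"
    using decreasing_pcontr_limit[of ?A] pc dec by blast
  define P where "P = id_blinfun - G"
  have limP: "(\<lambda>n. gtproj x (a + 1 / real (Suc n)) v) \<longlonglongrightarrow> P v" for v
    using tendsto_diff[OF tendsto_const[of v] lim[of v]] by (simp add: P_def op_simps)
  have bc: "P \<in> bicomm x" using limP by (rule bicomm_limit) (rule gtproj_bicomm)
  have PQ: "P (gtproj x a v) = P v" for v
  proof (rule LIMSEQ_unique[OF limP])
    have "gtproj x (a + 1 / real (Suc n)) (gtproj x a v) = gtproj x (a + 1 / real (Suc n)) v" for n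
      using gtproj_compose[of "a + 1 / real (Suc n)" a] by (metis blinfun_apply_blinfun_compose max.absorb1
          le_add_same_cancel1 of_nat_0_le_iff zero_le_divide_1_iff)
    then show "(\<lambda>n. gtproj x (a + 1 / real (Suc n)) (gtproj x a v)) \<longlonglongrightarrow> P v" using limP by simp
  qed
  have "is_gtproj x a P" unfolding is_gtproj_def
  proof (intro conjI allI impI)
    show "orthproj P" using limP orthproj_gtproj by (rule orthproj_limit)
    show "x o\<^sub>L P = P o\<^sub>L x" using bicommD[OF bc refl] .
    fix v
    \<comment> \<open>A strict inequality would be lost in the limit. It is inherited instead from
      \<open>gtproj x a\<close>, whose range contains that of P.\<close>
    show "a * (v \<bullet> v) < v \<bullet> x v" if "P v = v \<and> v \<noteq> 0"
    proof -
      have "P (gtproj x a v) = gtproj x a (P v)"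
        by (rule commute_apply[OF bicomm_commute[OF bc gtproj_bicomm]])
      then have "gtproj x a v = v" using PQ[of v] that by simp
      then show ?thesis using is_gtproj_gtproj[of a] that unfolding is_gtproj_def by blast
    qed
    show "v \<bullet> x v \<le> a * (v \<bullet> v)" if v: "P v = 0"
    proof (rule LIMSEQ_le)
      \<comment> \<open>The vectors \<open>?w n\<close> lie in the kernels of the approximating
        projections and tend to v, so the weak bound does pass to the limit.\<close>
      let ?w = "\<lambda>n. v - gtproj x (a + 1 / real (Suc n)) v"
      have w: "?w \<longlonglongrightarrow> v" using tendsto_diff[OF tendsto_const limP[of v], of v] v by simp
      show "(\<lambda>n. ?w n \<bullet> x (?w n)) \<longlonglongrightarrow> v \<bullet> x v" by (intro tendsto_intros blinfun.tendsto w)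
      have "(\<lambda>n. 1 / real (Suc n)) \<longlonglongrightarrow> 0" using LIMSEQ_inverse_real_of_nat by (simp add: inverse_eq_divide)
      then have "(\<lambda>n. (a + 1 / real (Suc n)) * (?w n \<bullet> ?w n)) \<longlonglongrightarrow> (a + 0) * (v \<bullet> v)"
        by (intro tendsto_intros w)
      then show "(\<lambda>n. (a + 1 / real (Suc n)) * (?w n \<bullet> ?w n)) \<longlonglongrightarrow> a * (v \<bullet> v)" by simp
      have "?w n \<bullet> x (?w n) \<le> (a + 1 / real (Suc n)) * (?w n \<bullet> ?w n)" for n
      proof -
        have "gtproj x (a + 1 / real (Suc n)) (?w n) = 0"
          by (simp add: op_simps orthproj_idem[OF orthproj_gtproj])
        then show ?thesis using is_gtproj_gtproj[of "a + 1 / real (Suc n)"] unfolding is_gtproj_def by blast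
      qed
      then show "\<exists>N. \<forall>n\<ge>N. ?w n \<bullet> x (?w n) \<le> (a + 1 / real (Suc n)) * (?w n \<bullet> ?w n)" by blast
    qed
  qed
  then have "P = gtproj x a" by (rule gtproj_unique)
  with limP show ?thesis by simp
qed

end

section \<open>Distributions of self-adjoint operators\<close>

text \<open>The functionals of interest are the vector states and the trace.\<close>

locale spectral_functional =
  fixes x :: "('a::{real_inner, complete_space}) operator" and L :: "'a operator \<Rightarrow> real"
  assumes selfadj: "selfadj x"
    and L_add: "a \<in> bicomm x \<Longrightarrow> b \<in> bicomm x \<Longrightarrow> L (a + b) = L a + L b"
    and L_scaleR: "a \<in> bicomm x \<Longrightarrow> L (c *\<^sub>R a) = c * L a"
    and L_nonneg: "a \<in> bicomm x \<Longrightarrow> posop a \<Longrightarrow> 0 \<le> L a"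
    and L_right_cont: "(\<lambda>n. L (gtproj x (t + 1 / real (Suc n)))) \<longlonglongrightarrow> L (gtproj x t)"
begin

lemmas gt = orthproj_gtproj[OF selfadj] and gt_bicomm = gtproj_bicomm[OF selfadj]

lemma L_zero: "L 0 = 0"
  using L_scaleR[OF bicomm_zero, of 0] by simp

lemma L_diff: "a \<in> bicomm x \<Longrightarrow> b \<in> bicomm x \<Longrightarrow> L (a - b) = L a - L b"
  using L_add[of "a - b" b] by (simp add: bicomm_diff)

lemma L_sum: "(\<And>i. i \<in> I \<Longrightarrow> f i \<in> bicomm x) \<Longrightarrow> L (sum f I) = (\<Sum>i\<in>I. L (f i))"
  by (induction I rule: infinite_finite_induct) (auto simp: L_zero L_add bicomm_sum)

lemma L_abs_le:
  assumes "selfadj z" "z \<in> bicomm x" shows "\<bar>L z\<bar> \<le> norm z * L id_blinfun"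
proof -
  have *: "w \<in> bicomm x \<Longrightarrow> selfadj w \<Longrightarrow> L w \<le> norm w * L id_blinfun" for w
  proof -
    assume w: "w \<in> bicomm x" "selfadj w"
    have "posop (norm w *\<^sub>R id_blinfun - w)"
      unfolding posop_def
    proof (intro conjI allI)
      show "selfadj (norm w *\<^sub>R id_blinfun - w)" by (intro selfadj_diff selfadj_scaleR selfadj_id w)
      show "0 \<le> v \<bullet> (norm w *\<^sub>R id_blinfun - w) v" for v
        using inner_apply_le[of v w] by (simp add: op_simps)
    qed
    then have "0 \<le> L (norm w *\<^sub>R id_blinfun - w)"
      by (intro L_nonneg bicomm_diff bicomm_scaleR bicomm_id w)
    then show ?thesis by (simp add: L_diff L_scaleR bicomm_scaleR bicomm_id w)
  qed
  have "L (- z) = - L z" using L_scaleR[OF assms(2), of "-1"] by simp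
  then show ?thesis using *[OF assms(2,1)] *[of "- z"] assms
    by (auto simp: bicomm_uminus selfadj_uminus abs_le_iff)
qed

definition cdf_fun :: "real \<Rightarrow> real" where
  "cdf_fun a = L id_blinfun - L (gtproj x a)"

definition dist_measure :: "real measure" where
  "dist_measure = interval_measure cdf_fun"

lemma cdf_fun_mono: assumes "a \<le> b" shows "cdf_fun a \<le> cdf_fun b"
proof -
  have "posop (gtproj x a - gtproj x b)"
    using gtproj_mono[OF selfadj assms] gt[of a] gt[of b]
    by (auto simp: posop_def orthproj_def op_simps intro: selfadj_diff)
  then have "0 \<le> L (gtproj x a - gtproj x b)" by (intro L_nonneg bicomm_diff gt_bicomm)
  then show ?thesis by (simp add: cdf_fun_def L_diff gt_bicomm)
qed

lemma cdf_fun_right_cont: "continuous (at_right a) cdf_fun"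
  unfolding continuous_within
proof (rule order_tendstoI)
  fix y assume "y < cdf_fun a"
  then show "\<forall>\<^sub>F t in at_right a. y < cdf_fun t"
    using cdf_fun_mono[of a] by (auto simp: eventually_at_filter intro!: always_eventually intro: less_le_trans)
next
  fix y assume y: "cdf_fun a < y"
  have "(\<lambda>n. cdf_fun (a + 1 / real (Suc n))) \<longlonglongrightarrow> cdf_fun a"
    unfolding cdf_fun_def by (rule tendsto_diff[OF tendsto_const L_right_cont])
  from order_tendstoD(2)[OF this y] obtain n where n: "cdf_fun (a + 1 / real (Suc n)) < y"
    by (auto simp: eventually_sequentially)
  show "\<forall>\<^sub>F t in at_right a. cdf_fun t < y"
    unfolding eventually_at_right_field
  proof (intro exI[of _ "a + 1 / real (Suc n)"] conjI allI impI)
    fix t assume "a < t" "t < a + 1 / real (Suc n)"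
    then show "cdf_fun t < y" using cdf_fun_mono[of t "a + 1 / real (Suc n)"] n by linarith
  qed simp
qed

lemma L_id_nonneg: "0 \<le> L id_blinfun"
  by (rule L_nonneg[OF bicomm_id]) (simp add: posop_def)

lemma cdf_fun_at_bot: "(cdf_fun \<longlongrightarrow> 0) at_bot"
proof (rule tendsto_eventually)
  show "\<forall>\<^sub>F a in at_bot. cdf_fun a = 0"
    by (rule eventually_mono[OF eventually_le_at_bot[of "- norm x - 1"]])
      (simp add: cdf_fun_def gtproj_less_norm[OF selfadj])
qed

lemma cdf_fun_at_top: "(cdf_fun \<longlongrightarrow> L id_blinfun) at_top"
proof (rule tendsto_eventually)
  show "\<forall>\<^sub>F a in at_top. cdf_fun a = L id_blinfun"
    by (rule eventually_mono[OF eventually_ge_at_top[of "norm x"]])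
      (simp add: cdf_fun_def gtproj_ge_norm[OF selfadj] L_zero)
qed

lemma sets_dist_measure [simp, measurable_cong]: "sets dist_measure = sets borel"
  and space_dist_measure [simp]: "space dist_measure = UNIV"
  by (simp_all add: dist_measure_def)

sublocale dist: finite_measure dist_measure
proof
  show "emeasure dist_measure (space dist_measure) \<noteq> \<infinity>"
    using interval_measure_UNIV[OF cdf_fun_mono cdf_fun_right_cont cdf_fun_at_bot cdf_fun_at_top L_id_nonneg]
    by (simp add: dist_measure_def)
qed

lemma measure_UNIV: "measure dist_measure UNIV = L id_blinfun"
  using interval_measure_UNIV[OF cdf_fun_mono cdf_fun_right_cont cdf_fun_at_bot cdf_fun_at_top L_id_nonneg]
  by (simp add: dist_measure_def measure_def L_id_nonneg)

lemma measure_Ioc: "a \<le> b \<Longrightarrow> measure dist_measure {a<..b} = L (gtproj x a) - L (gtproj x b)"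
  using measure_interval_measure_Ioc[OF _ cdf_fun_mono cdf_fun_right_cont, of a b]
  by (simp add: dist_measure_def cdf_fun_def)

lemma AE_bounded: assumes "norm x < K" shows "AE t in dist_measure. t \<in> {- K<..K}"
proof (rule AE_I)
  have K: "0 < K" using assms norm_ge_zero[of x] by linarith
  have "measure dist_measure (UNIV - {- K<..K}) = 0"
    using dist.finite_measure_compl[of "{- K<..K}"] measure_Ioc[of "- K" K] assms K measure_UNIV
    by (simp add: gtproj_less_norm[OF selfadj] gtproj_ge_norm[OF selfadj] L_zero)
  then show "emeasure dist_measure (UNIV - {- K<..K}) = 0"
    by (simp add: dist.emeasure_eq_measure)
qed auto

lemma measure_greaterThan: "measure dist_measure {a<..} = L (gtproj x a)"
proof -
  define b where "b = max a (norm x + 1)"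
  have "norm x < b" by (simp add: b_def)
  have "measure dist_measure {a<..} = measure dist_measure {a<..b}"
    by (rule dist.finite_measure_eq_AE)
      (auto intro!: eventually_mono[OF AE_bounded[OF \<open>norm x < b\<close>]])
  also have "\<dots> = L (gtproj x a)"
    using \<open>norm x < b\<close> by (subst measure_Ioc) (auto simp: b_def gtproj_ge_norm[OF selfadj] L_zero)
  finally show ?thesis .
qed

lemma integrable_bounded_on:
  assumes [measurable]: "f \<in> borel_measurable borel"
    and "norm x < K" "\<And>t. t \<in> {- K<..K} \<Longrightarrow> \<bar>f t\<bar> \<le> (C::real)"
  shows "integrable dist_measure f"
  by (rule dist.integrable_const_bound[of _ C])
    (use assms(3) in \<open>auto intro!: eventually_mono[OF AE_bounded[OF assms(2)]]\<close>)

section \<open>Step approximations of x by spectral projections of cells\<close>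

context
  fixes K :: real and N :: nat
  assumes K: "norm x < K" and N: "0 < N"
begin

definition node :: "nat \<Rightarrow> real" where "node i = - K + i * (2 * K / N)"

definition piece :: "nat \<Rightarrow> 'a operator" where
  "piece i = gtproj x (node i) - gtproj x (node (Suc i))"

text \<open>The lower Riemann sum of the spectral integral: on the cell (node i, node (i+1)] the
  value is the left endpoint.\<close>

definition step_op :: "'a operator" where "step_op = (\<Sum>i<N. node i *\<^sub>R piece i)"

lemma K_pos: "0 < K"
  using K norm_ge_zero[of x] by linarith

lemma node_mono: "i \<le> j \<Longrightarrow> node i \<le> node j"
  using K_pos by (auto simp: node_def intro!: mult_right_mono divide_right_mono)

lemma node_0: "node 0 = - K" and node_N: "node N = K" and node_Suc: "node (Suc i) = node i + 2 * K / N"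
  using N by (auto simp: node_def field_simps)

lemma piece_compose: "piece i o\<^sub>L piece j = (if i = j then piece i else 0)"
proof -
  have mx: "max (node i) (node j) = node (max i j)" for i j
    using node_mono[of i j] node_mono[of j i] by (cases "i \<le> j") (auto simp: max_def intro: antisym)
  show ?thesis
    by (cases i j rule: linorder_cases)
      (simp_all add: piece_def compose_bilinear gtproj_compose[OF selfadj] mx max_absorb1 max_absorb2)
qed

lemma piece_bicomm: "piece i \<in> bicomm x"
  unfolding piece_def by (intro bicomm_diff gt_bicomm)

lemma piece_selfadj: "selfadj (piece i)"
  unfolding piece_def using gt by (auto intro: selfadj_diff simp: orthproj_def)

lemma sum_piece: "(\<Sum>i<N. piece i) = id_blinfun"
  using sum_lessThan_telescope'[of "\<lambda>i. gtproj x (node i)" N] K K_pos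
  by (simp add: piece_def node_0 node_N gtproj_less_norm[OF selfadj] gtproj_ge_norm[OF selfadj])

lemma piece_bounds:
  "node i * (v \<bullet> piece i v) \<le> v \<bullet> x (piece i v) \<and> v \<bullet> x (piece i v) \<le> node (Suc i) * (v \<bullet> piece i v)"
proof -
  let ?w = "piece i v"
  have idem: "piece i ?w = ?w" using piece_compose[of i i] by (metis blinfun_apply_blinfun_compose)
  have comm: "x (piece i w) = piece i (x w)" for w
    using commute_apply[OF bicommD[OF piece_bicomm refl]] .
  have 1: "v \<bullet> ?w = ?w \<bullet> ?w" using selfadjD[OF piece_selfadj, of i v "?w"] idem by simp
  have 2: "v \<bullet> x ?w = ?w \<bullet> x ?w"
    using selfadjD[OF piece_selfadj, of i v "x ?w"] comm[of "?w"] idem by simp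
  have le: "node i \<le> node (Suc i)" by (rule node_mono) simp
  have "gtproj x (node i) ?w = ?w" "gtproj x (node (Suc i)) ?w = 0"
  proof -
    have "gtproj x (node i) (gtproj x (node (Suc i)) v) = gtproj x (node (Suc i)) v"
      "gtproj x (node (Suc i)) (gtproj x (node i) v) = gtproj x (node (Suc i)) v"
      using gtproj_compose[OF selfadj, of "node i" "node (Suc i)"]
        gtproj_compose[OF selfadj, of "node (Suc i)" "node i"] le
      by (metis blinfun_apply_blinfun_compose max.absorb1 max.absorb2)+
    then show "gtproj x (node i) ?w = ?w" "gtproj x (node (Suc i)) ?w = 0"
      by (simp_all add: piece_def op_simps orthproj_idem[OF gt])
  qed
  then have "?w \<noteq> 0 \<longrightarrow> node i * (?w \<bullet> ?w) < ?w \<bullet> x ?w" "?w \<bullet> x ?w \<le> node (Suc i) * (?w \<bullet> ?w)"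
    using is_gtproj_gtproj[OF selfadj] unfolding is_gtproj_def by blast+
  then show ?thesis unfolding 1 2 by (cases "?w = 0") auto
qed

lemma step_op_bicomm: "step_op \<in> bicomm x"
  unfolding step_op_def by (intro bicomm_sum bicomm_scaleR piece_bicomm)

lemma step_op_selfadj: "selfadj step_op"
  unfolding step_op_def by (intro selfadj_sum selfadj_scaleR piece_selfadj)

text \<open>The form of x - step_op splits over the pieces and is between 0 and the mesh d times the
  form of the identity. Hence (x - step_op) / d is a positive contraction, whose operator norm is at
  most 1.\<close>

lemma norm_step_op: "norm (x - step_op) \<le> 2 * K / N"
proof -
  define d where "d = 2 * K / N"
  have d: "d > 0" using K_pos N by (simp add: d_def)
  let ?D = "x - step_op"
  have vx: "v \<bullet> x v = (\<Sum>i<N. v \<bullet> x (piece i v))" for v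
  proof -
    have "v \<bullet> x v = v \<bullet> x ((\<Sum>i<N. piece i) v)" by (simp add: sum_piece)
    then show ?thesis by (simp add: op_simps blinfun.sum_left blinfun.sum_right inner_sum_right)
  qed
  have vv: "v \<bullet> v = (\<Sum>i<N. v \<bullet> piece i v)" for v
  proof -
    have "v \<bullet> v = v \<bullet> (\<Sum>i<N. piece i) v" by (simp add: sum_piece)
    then show ?thesis by (simp add: blinfun.sum_left inner_sum_right)
  qed
  have D: "v \<bullet> ?D v = (\<Sum>i<N. v \<bullet> x (piece i v) - node i * (v \<bullet> piece i v))" for v
    by (simp add: vx step_op_def op_simps blinfun.sum_left inner_sum_right sum_subtractf)
  have "0 \<le> v \<bullet> ?D v" for v
    unfolding D using piece_bounds by (intro sum_nonneg) simp
  moreover have "v \<bullet> ?D v \<le> d * (v \<bullet> v)" for v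
    unfolding D vv sum_distrib_left
  proof (rule sum_mono)
    fix i
    show "v \<bullet> x (piece i v) - node i * (v \<bullet> piece i v) \<le> d * (v \<bullet> piece i v)"
      using piece_bounds[of i v] unfolding node_Suc d_def by (simp add: distrib_right)
  qed
  moreover have "selfadj ?D" by (intro selfadj_diff selfadj step_op_selfadj)
  ultimately have pc: "pcontr ((1 / d) *\<^sub>R ?D)"
    using d by (simp add: pcontr_def posop_def selfadj_scaleR blinfun.scaleR_left pos_divide_le_eq mult.commute)
  have "norm (?D v) \<le> d * norm v" for v
    using pcontr_norm_le[OF pc, of v] d by (simp add: blinfun.scaleR_left pos_divide_le_eq mult.commute)
  then have "norm ?D \<le> d" using d by (intro norm_blinfun_bound) auto
  then show ?thesis by (simp add: d_def)
qed

text \<open>The pieces are mutually orthogonal projections with sum 1, so powers act on the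
  coefficients alone.\<close>

lemma opow_step_op: "opow step_op m = (\<Sum>i<N. node i ^ m *\<^sub>R piece i)"
proof (induction m)
  case 0 show ?case by (simp add: sum_piece)
next
  case (Suc m)
  have "step_op o\<^sub>L opow step_op m
      = (\<Sum>j<N. \<Sum>i<N. (node j * node i ^ m) *\<^sub>R (piece j o\<^sub>L piece i))"
    unfolding Suc by (simp add: step_op_def compose_bilinear scaleR_sum_right)
      (subst sum.swap, simp add: mult.commute)
  also have "\<dots> = (\<Sum>j<N. node j ^ Suc m *\<^sub>R piece j)"
    by (simp add: piece_compose if_distrib[of "scaleR _"] sum.delta cong: if_cong)
  finally show ?case by simp
qed

lemma L_opow_step_op:
  "L (opow step_op m) = (\<integral>t. (\<Sum>i<N. node i ^ m * indicator {node i<..node (Suc i)} t) \<partial>dist_measure)"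
proof -
  have "L (opow step_op m) = (\<Sum>i<N. node i ^ m * L (piece i))"
    unfolding opow_step_op by (subst L_sum) (auto intro: bicomm_scaleR piece_bicomm simp: L_scaleR[OF piece_bicomm])
  also have "\<dots> = (\<Sum>i<N. node i ^ m * measure dist_measure {node i<..node (Suc i)})"
    by (simp add: measure_Ioc node_mono piece_def L_diff gt_bicomm)
  also have "\<dots> = (\<integral>t. (\<Sum>i<N. node i ^ m * indicator {node i<..node (Suc i)} t) \<partial>dist_measure)"
    by (subst Bochner_Integration.integral_sum) (auto simp: dist.emeasure_eq_measure)
  finally show ?thesis .
qed

lemma step_fun_close:
  fixes t :: real
  assumes "t \<in> {- K<..K}"
  obtains i where "i < N" "\<bar>node i - t\<bar> \<le> 2 * K / N" "node i \<in> {- K..K}"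
    "\<And>m. (\<Sum>i<N. node i ^ m * indicator {node i<..node (Suc i)} t) = node i ^ m"
proof -
  have "\<exists>i. t \<le> node (Suc i)" using node_N assms N by (intro exI[of _ "N - 1"]) auto
  \<comment> \<open>Minimality puts t strictly above \<open>node i\<close>, as the half-open cells
    require; for i = 0 this is the open left end of the interval.\<close>
  define i where "i = (LEAST i. t \<le> node (Suc i))"
  have i: "t \<le> node (Suc i)" unfolding i_def by (rule LeastI_ex) fact
  have "node i < t"
  proof (cases i)
    case 0 then show ?thesis using assms node_0 by simp
  next
    case (Suc j)
    then have "\<not> t \<le> node (Suc j)" using not_less_Least[of j "\<lambda>i. t \<le> node (Suc i)"] by (simp add: i_def)
    then show ?thesis using Suc by simp
  qed
  have "i < N"
  proof (rule ccontr)
    assume "\<not> i < N"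
    then show False using node_mono[of N i] node_N \<open>node i < t\<close> assms by auto
  qed
  have other: "t \<notin> {node j<..node (Suc j)}" if "j \<noteq> i" for j
  proof (cases "j < i")
    case True then show ?thesis using node_mono[of "Suc j" i] \<open>node i < t\<close> by auto
  next
    case False then show ?thesis using node_mono[of "Suc i" j] i that by auto
  qed
  have "(\<Sum>i<N. node i ^ m * indicator {node i<..node (Suc i)} t) = node i ^ m" for m
  proof -
    have "(\<Sum>j<N. node j ^ m * indicator {node j<..node (Suc j)} t)
        = (\<Sum>j<N. if j = i then node i ^ m else 0)"
      using i \<open>node i < t\<close> other by (intro sum.cong) (auto simp: indicator_def)
    then show ?thesis using \<open>i < N\<close> by simp
  qed
  moreover have "\<bar>node i - t\<bar> \<le> 2 * K / N" using i \<open>node i < t\<close> node_Suc[of i] by linarith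
  moreover have "node i \<in> {- K..K}"
    using node_mono[of 0 i] node_0 \<open>node i < t\<close> assms by auto
  ultimately show ?thesis using that \<open>i < N\<close> by blast
qed

end

lemma selfadj_opow: "selfadj y \<Longrightarrow> selfadj (opow y m)" for y :: "'a operator"
proof (induction m)
  case (Suc m)
  have "y o\<^sub>L opow y m = opow y m o\<^sub>L y"
    by (rule bicomm_commute[of _ y]) (intro bicomm_self opow_bicomm)+
  with Suc show ?case by (simp add: selfadj_compose)
qed simp

text \<open>For step operators the identity is a finite sum. Refining the mesh, the operator side
  converges in norm, which L respects by \<open>L_abs_le\<close>, and the integral side by dominated
  convergence.\<close>

theorem integral_power: "(\<integral>t. t ^ m \<partial>dist_measure) = L (opow x m)"
proof -
  define K where "K = norm x + 1"
  have K: "norm x < K" "0 < K" by (auto simp: K_def add_nonneg_pos)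
  let ?Y = "\<lambda>n. step_op K (Suc n)"
  let ?h = "\<lambda>n t. (\<Sum>i<Suc n. node K (Suc n) i ^ m * indicator {node K (Suc n) i<..node K (Suc n) (Suc i)} t)"
  have width: "(\<lambda>n. 2 * K / Suc n) \<longlonglongrightarrow> 0"
    using tendsto_mult[OF tendsto_const[of "2 * K"] LIMSEQ_inverse_real_of_nat] by (simp add: divide_inverse)
  have "(\<lambda>n. norm (?Y n - x)) \<longlonglongrightarrow> 0"
    by (rule real_tendsto_sandwich[OF _ _ tendsto_const width])
      (use norm_step_op[OF K(1) zero_less_Suc] in
        \<open>simp_all add: norm_minus_commute[of _ x] del: of_nat_Suc\<close>)
  then have Y: "?Y \<longlonglongrightarrow> x" by (rule LIM_zero_cancel[OF tendsto_norm_zero_cancel])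
  have "(\<lambda>n. opow (?Y n) m) \<longlonglongrightarrow> opow x m"
    by (induction m)
      (simp_all add: bounded_bilinear.tendsto[OF bounded_bilinear_blinfun_compose Y])
  then have "(\<lambda>n. norm (opow (?Y n) m - opow x m)) \<longlonglongrightarrow> 0"
    by (rule tendsto_norm_zero[OF LIM_zero])
  from tendsto_mult[OF this tendsto_const[of "L id_blinfun"]]
  have "(\<lambda>n. norm (opow (?Y n) m - opow x m) * L id_blinfun) \<longlonglongrightarrow> 0" by simp
  then have "(\<lambda>n. L (opow (?Y n) m) - L (opow x m)) \<longlonglongrightarrow> 0"
  proof (rule Lim_null_comparison[rotated], intro always_eventually allI)
    fix n
    have bc: "opow (?Y n) m \<in> bicomm x" "opow x m \<in> bicomm x"
      by (intro opow_bicomm step_op_bicomm[OF K(1)] bicomm_self; simp)+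
    moreover have "selfadj (opow (?Y n) m - opow x m)"
      by (intro selfadj_diff selfadj_opow selfadj step_op_selfadj[OF K(1)]) simp
    ultimately show "norm (L (opow (?Y n) m) - L (opow x m)) \<le> norm (opow (?Y n) m - opow x m) * L id_blinfun"
      using L_abs_le[of "opow (?Y n) m - opow x m"] by (simp add: L_diff bicomm_diff)
  qed
  then have lim1: "(\<lambda>n. L (opow (?Y n) m)) \<longlonglongrightarrow> L (opow x m)" by (rule LIM_zero_cancel)
  have "(\<lambda>n. \<integral>t. ?h n t \<partial>dist_measure) \<longlonglongrightarrow> (\<integral>t. t ^ m \<partial>dist_measure)"
  proof (rule integral_dominated_convergence[where w = "\<lambda>_. K ^ m"])
    show "AE t in dist_measure. (\<lambda>n. ?h n t) \<longlonglongrightarrow> t ^ m"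
    proof (rule eventually_mono[OF AE_bounded[OF K(1)]])
      fix t assume t: "t \<in> {- K<..K}"
      have "\<forall>n. \<exists>i. \<bar>node K (Suc n) i - t\<bar> \<le> 2 * K / Suc n \<and> ?h n t = node K (Suc n) i ^ m"
      proof
        fix n
        show "\<exists>i. \<bar>node K (Suc n) i - t\<bar> \<le> 2 * K / Suc n \<and> ?h n t = node K (Suc n) i ^ m"
          by (rule step_fun_close[OF K(1) zero_less_Suc t]) blast
      qed
      from choice[OF this] obtain i where "\<forall>n. \<bar>node K (Suc n) (i n) - t\<bar> \<le> 2 * K / Suc n \<and>
        ?h n t = node K (Suc n) (i n) ^ m" ..
      then have i: "\<bar>node K (Suc n) (i n) - t\<bar> \<le> 2 * K / Suc n"
        and h: "?h n t = node K (Suc n) (i n) ^ m" for n by blast+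
      have "(\<lambda>n. node K (Suc n) (i n) - t) \<longlonglongrightarrow> 0"
        by (rule Lim_null_comparison[OF _ width]) (use i in auto)
      then have "(\<lambda>n. node K (Suc n) (i n)) \<longlonglongrightarrow> t" by (rule LIM_zero_cancel)
      then show "(\<lambda>n. ?h n t) \<longlonglongrightarrow> t ^ m" unfolding h by (rule tendsto_power)
    qed
    show "AE t in dist_measure. norm (?h n t) \<le> K ^ m" for n
    proof (rule eventually_mono[OF AE_bounded[OF K(1)]])
      fix t assume t: "t \<in> {- K<..K}"
      obtain i where "node K (Suc n) i \<in> {- K..K}" "?h n t = node K (Suc n) i ^ m"
        by (rule step_fun_close[OF K(1) zero_less_Suc t]) blast
      moreover from this have "\<bar>node K (Suc n) i\<bar> ^ m \<le> K ^ m" by (intro power_mono) auto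
      ultimately show "norm (?h n t) \<le> K ^ m" by (simp only: real_norm_def power_abs)
    qed
    show "?h n \<in> borel_measurable dist_measure" for n by measurable
  qed auto
  then have "(\<lambda>n. L (opow (?Y n) m)) \<longlonglongrightarrow> (\<integral>t. t ^ m \<partial>dist_measure)"
    by (simp only: L_opow_step_op[OF K(1) zero_less_Suc])
  with lim1 show ?thesis by (rule LIMSEQ_unique[rotated])
qed

end

text \<open>Weierstrass approximation on [-K, K] passes from powers to continuous functions, and
  monotone ramps pass from these to the indicator of a half-line.\<close>

lemma measure_greaterThan_eq_of_moments:
  fixes M1 M2 :: "real measure"
  assumes "finite_measure M1" "finite_measure M2"
    and sets [measurable_cong]: "sets M1 = sets borel" "sets M2 = sets borel"
    and bd: "AE t in M1. \<bar>t\<bar> \<le> K" "AE t in M2. \<bar>t\<bar> \<le> K"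
    and mom: "\<And>m. (\<integral>t. t ^ m \<partial>M1) = (\<integral>t. t ^ m \<partial>M2)"
  shows "measure M1 {a<..} = measure M2 {a<..}"
proof -
  interpret M1: finite_measure M1 by fact
  interpret M2: finite_measure M2 by fact
  have space: "space M1 = UNIV" "space M2 = UNIV" using sets[THEN sets_eq_imp_space_eq] by auto
  have int: "integrable M1 f" "integrable M2 f" if "continuous_on UNIV f" for f :: "real \<Rightarrow> real"
  proof -
    have [measurable]: "f \<in> borel_measurable borel" using that by (rule borel_measurable_continuous_onI)
    have "compact (f ` {- K..K})"
      using that by (intro compact_continuous_image) (auto intro: continuous_on_subset)
    then have "\<exists>B. \<forall>t\<in>{- K..K}. \<bar>f t\<bar> \<le> B"
      by (auto simp: bounded_iff dest!: compact_imp_bounded)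
    then obtain B where B: "\<And>t. t \<in> {- K..K} \<Longrightarrow> \<bar>f t\<bar> \<le> B" by blast
    show "integrable M1 f" by (rule M1.integrable_const_bound[of _ B])
      (use B in \<open>auto intro!: eventually_mono[OF bd(1)] simp: abs_le_iff\<close>)
    show "integrable M2 f" by (rule M2.integrable_const_bound[of _ B])
      (use B in \<open>auto intro!: eventually_mono[OF bd(2)] simp: abs_le_iff\<close>)
  qed
  have eq: "(\<integral>t. f t \<partial>M1) = (\<integral>t. f t \<partial>M2)" if f: "continuous_on UNIV f" for f :: "real \<Rightarrow> real"
  proof -
    have "\<bar>(\<integral>t. f t \<partial>M1) - (\<integral>t. f t \<partial>M2)\<bar> \<le> e * (measure M1 UNIV + measure M2 UNIV)" if "e > 0" for e
    proof -
      obtain g where g: "real_polynomial_function g" "\<And>t. t \<in> {- K..K} \<Longrightarrow> \<bar>f t - g t\<bar> < e"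
        using Stone_Weierstrass_real_polynomial_function[of "{- K..K}" f e] \<open>e > 0\<close> f
        by (auto intro: continuous_on_subset)
      obtain c n where gsum: "g = (\<lambda>t. \<Sum>i\<le>n. c i * t ^ i)"
        using g(1) by (auto simp: real_polynomial_function_iff_sum)
      have ge: "\<bar>f t - g t\<bar> \<le> e" if "\<bar>t\<bar> \<le> K" for t
        by (rule less_imp_le[OF g(2)]) (use that in auto)
      have cg: "continuous_on UNIV g" unfolding gsum by (intro continuous_intros)
      have pw: "continuous_on UNIV (\<lambda>t::real. c i * t ^ i)" for i by (intro continuous_intros)
      have "(\<integral>t. g t \<partial>M1) = (\<integral>t. g t \<partial>M2)"
        unfolding gsum using int[OF pw] by (simp add: mom)
      moreover have "\<bar>(\<integral>t. f t \<partial>M1) - (\<integral>t. g t \<partial>M1)\<bar> \<le> e * measure M1 UNIV"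
      proof -
        have "\<bar>\<integral>t. f t - g t \<partial>M1\<bar> \<le> (\<integral>t. \<bar>f t - g t\<bar> \<partial>M1)" by (rule integral_abs_bound)
        also have "\<dots> \<le> (\<integral>t. e \<partial>M1)"
          using int(1)[OF continuous_on_diff[OF f cg]]
          by (intro integral_mono_AE) (auto intro!: eventually_mono[OF bd(1)] ge)
        finally show ?thesis using int[OF f] int[OF cg] by (simp add: space mult.commute)
      qed
      moreover have "\<bar>(\<integral>t. f t \<partial>M2) - (\<integral>t. g t \<partial>M2)\<bar> \<le> e * measure M2 UNIV"
      proof -
        have "\<bar>\<integral>t. f t - g t \<partial>M2\<bar> \<le> (\<integral>t. \<bar>f t - g t\<bar> \<partial>M2)" by (rule integral_abs_bound)
        also have "\<dots> \<le> (\<integral>t. e \<partial>M2)"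
          using int(2)[OF continuous_on_diff[OF f cg]]
          by (intro integral_mono_AE) (auto intro!: eventually_mono[OF bd(2)] ge)
        finally show ?thesis using int[OF f] int[OF cg] by (simp add: space mult.commute)
      qed
      ultimately show ?thesis by (simp add: distrib_left)
    qed
    then have le: "\<bar>(\<integral>t. f t \<partial>M1) - (\<integral>t. f t \<partial>M2)\<bar> \<le> e * (measure M1 UNIV + measure M2 UNIV)" if "e > 0" for e
      using that by blast
    define C where "C = measure M1 UNIV + measure M2 UNIV"
    have "\<bar>(\<integral>t. f t \<partial>M1) - (\<integral>t. f t \<partial>M2)\<bar> \<le> 0"
    proof (rule field_le_epsilon)
      fix e :: real assume "e > 0"
      have C: "0 \<le> C" by (simp add: C_def)
      \<comment> \<open>The divisor C + 1 keeps the tolerance meaningful when both measures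
        vanish.\<close>
      have "\<bar>(\<integral>t. f t \<partial>M1) - (\<integral>t. f t \<partial>M2)\<bar> \<le> e / (C + 1) * C"
        unfolding C_def by (rule le, rule divide_pos_pos) (use \<open>e > 0\<close> C[unfolded C_def] in linarith)+
      also have "\<dots> \<le> e" using \<open>e > 0\<close> C by (simp add: field_simps)
      finally show "\<bar>(\<integral>t. f t \<partial>M1) - (\<integral>t. f t \<partial>M2)\<bar> \<le> 0 + e" by simp
    qed
    then show ?thesis by simp
  qed
  \<comment> \<open>Each ramp is 0 up to and including a, so the limit is the indicator of the open
    half-line.\<close>
  define f :: "nat \<Rightarrow> real \<Rightarrow> real" where "f n t = min 1 (max 0 (real n * (t - a)))" for n t
  have f: "continuous_on UNIV (f n)" for n unfolding f_def by (intro continuous_intros)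
  have [measurable]: "f n \<in> borel_measurable borel" for n using f by (rule borel_measurable_continuous_onI)
  have lim: "(\<lambda>n. f n t) \<longlonglongrightarrow> indicator {a<..} t" for t
  proof (rule tendsto_eventually)
    show "\<forall>\<^sub>F n in sequentially. f n t = indicator {a<..} t"
    proof (cases "a < t")
      case True
      obtain n0 :: nat where "1 / (t - a) < n0" using reals_Archimedean2 by blast
      then have "1 \<le> real n * (t - a)" if "n0 \<le> n" for n
      proof -
        have "1 \<le> real n0 * (t - a)" using \<open>1 / (t - a) < n0\<close> True by (simp add: pos_divide_less_eq)
        also have "\<dots> \<le> real n * (t - a)" using that True by (intro mult_right_mono) auto
        finally show ?thesis .
      qed
      then show ?thesis using True unfolding eventually_sequentially
        by (auto simp: f_def intro!: exI[of _ n0])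
    next
      case False
      then have "real n * (t - a) \<le> 0" for n by (simp add: mult_le_0_iff)
      then show ?thesis using False by (auto simp: f_def intro!: always_eventually)
    qed
  qed
  have "(\<lambda>n. \<integral>t. f n t \<partial>M1) \<longlonglongrightarrow> (\<integral>t. indicator {a<..} t \<partial>M1)"
    by (rule integral_dominated_convergence[where w = "\<lambda>_. 1"]) (use lim in \<open>auto simp: f_def\<close>)
  moreover have "(\<lambda>n. \<integral>t. f n t \<partial>M2) \<longlonglongrightarrow> (\<integral>t. indicator {a<..} t \<partial>M2)"
    by (rule integral_dominated_convergence[where w = "\<lambda>_. 1"]) (use lim in \<open>auto simp: f_def\<close>)
  ultimately have "(\<integral>t. indicator {a<..} t \<partial>M1) = (\<integral>t. indicator {a<..} t \<partial>M2 :: real)"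
    unfolding eq[OF f] by (rule LIMSEQ_unique)
  then show ?thesis by (simp add: space)
qed

section \<open>Complex Hilbert spaces\<close>

lemma cinner_scaleC_left: "cinner (c *\<^sub>C u) v = cnj c * cinner u v"
  by (metis cinner_commute cinner_scaleC_right complex_cnj_mult complex_cnj_cnj)

text \<open>Through this formula an identity of real inner products that is compatible with
  multiplication by the imaginary unit becomes one of complex inner products.\<close>

lemma Im_cinner: "Im (cinner u v) = inner (\<i> *\<^sub>C u) v"
  by (simp add: inner_eq_Re_cinner cinner_scaleC_left)

lemma Re_cinner: "Re (cinner u v) = inner u v"
  by (simp add: inner_eq_Re_cinner)

lemma inner_iI: "inner (\<i> *\<^sub>C u) (\<i> *\<^sub>C v) = inner u v"
  by (simp add: inner_eq_Re_cinner cinner_scaleC_left cinner_scaleC_right flip: mult.assoc)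

lemma scaleC_iI: "\<i> *\<^sub>C \<i> *\<^sub>C v = - v"
  by (simp add: scaleC_scaleC) (metis scaleR_scaleC scaleR_minus1_left of_real_1 of_real_minus)

lemma inner_scaleC: "inner (c *\<^sub>C u) (c *\<^sub>C v) = (cmod c)\<^sup>2 * inner u v"
proof -
  have "cinner (c *\<^sub>C u) (c *\<^sub>C v) = complex_of_real ((cmod c)\<^sup>2) * cinner u v"
    by (simp only: cinner_scaleC_left cinner_scaleC_right complex_norm_square mult_ac)
  moreover have "Re (complex_of_real r * z) = r * Re z" for r z by simp
  ultimately show ?thesis by (simp only: inner_eq_Re_cinner)
qed

lemma norm_scaleC: "norm (c *\<^sub>C (v::'a::chilbert_space)) = cmod c * norm v"
  by (simp add: norm_eq_sqrt_inner inner_scaleC real_sqrt_mult)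

lemma bounded_linear_scaleC: "bounded_linear (\<lambda>v::'a::chilbert_space. c *\<^sub>C v)"
proof (rule bounded_linear_intro)
  show "c *\<^sub>C (r *\<^sub>R v) = r *\<^sub>R c *\<^sub>C v" for r and v :: 'a
    by (simp add: scaleR_scaleC scaleC_scaleC mult.commute)
  show "norm (c *\<^sub>C v) \<le> norm v * cmod c" for v :: 'a by (simp add: norm_scaleC)
qed (rule scaleC_add_right)

lemma scaleC_op_apply [simp]: "scaleC_op c x v = c *\<^sub>C x v"
  unfolding scaleC_op_def
  by (subst bounded_linear_Blinfun_apply)
    (auto intro: bounded_linear_compose[OF bounded_linear_scaleC] blinfun.bounded_linear_right)

lemma scaleC_op_of_real: "scaleC_op (of_real c) x = c *\<^sub>R x"
  by (rule blinfun_eqI) (simp add: scaleR_scaleC blinfun.scaleR_left)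

text \<open>Complex linearity restated as commutation with scalar operators, the form in which it
  passes to the double commutant.\<close>

lemma bounded_operators_iff:
  "x \<in> bounded_operators \<longleftrightarrow> (\<forall>c. x o\<^sub>L scaleC_op c id_blinfun = scaleC_op c id_blinfun o\<^sub>L x)"
  unfolding bounded_operators_def
  by (auto intro!: blinfun_eqI) (metis blinfun_apply_blinfun_compose scaleC_op_apply blinfun_apply_id_blinfun)

lemma bicomm_bounded: "z \<in> bicomm x \<Longrightarrow> x \<in> bounded_operators \<Longrightarrow> z \<in> bounded_operators"
  unfolding bounded_operators_iff bicomm_def by force

lemma bounded_operators_diff:
  "x \<in> bounded_operators \<Longrightarrow> y \<in> bounded_operators \<Longrightarrow> x - y \<in> bounded_operators"
  unfolding bounded_operators_iff by (simp add: compose_bilinear)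

lemma bicomm_subset_vN:
  assumes N: "von_neumann_algebra N" and x: "x \<in> N" shows "bicomm x \<subseteq> N"
proof
  fix z assume z: "z \<in> bicomm x"
  have "x \<in> bounded_operators" using N x by (auto simp: von_neumann_algebra_def)
  then have "z \<in> bounded_operators" using z by (rule bicomm_bounded[rotated])
  moreover have "w o\<^sub>L z = z o\<^sub>L w" if "w \<in> commutant N" for w
    by (rule bicommD[OF z]) (use that x in \<open>simp add: commutant_def\<close>)
  ultimately have "z \<in> commutant (commutant N)" by (simp add: commutant_def)
  then show "z \<in> N" using N by (simp add: von_neumann_algebra_def)
qed

text \<open>The representing vector minimises \<phi>(w) = |w|^2 / 2 - f(w). The parallelogram law
  makes minimising sequences Cauchy, and f is read off from stationarity at the minimum.\<close>

lemma riesz_representation: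
  fixes f :: "'a::{real_inner, complete_space} \<Rightarrow>\<^sub>L real"
  obtains w where "\<And>v. f v = w \<bullet> v"
proof -
  define \<phi> where "\<phi> w = (w \<bullet> w) / 2 - f w" for w
  have bd: "- (norm f)\<^sup>2 / 2 \<le> \<phi> w" for w
  proof -
    have "f w \<le> norm f * norm w" using norm_blinfun[of f w] by simp
    moreover have "0 \<le> (norm f - norm w)\<^sup>2" by simp
    ultimately show ?thesis by (simp add: \<phi>_def dot_square_norm power2_eq_square algebra_simps)
  qed
  define m where "m = Inf (range \<phi>)"
  have bdd: "bdd_below (range \<phi>)" using bd by (auto simp: bdd_below_def)
  have m_le: "m \<le> \<phi> w" for w unfolding m_def by (rule cInf_lower[OF rangeI bdd])
  have "\<exists>w. \<phi> w < m + 1 / Suc n" for n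
    using cInf_lessD[of "range \<phi>" "m + 1 / Suc n"] by (auto simp: m_def)
  then obtain w where w: "\<And>n. \<phi> (w n) < m + 1 / Suc n" by metis
  have par: "(norm (a - b))\<^sup>2 \<le> 4 * (\<phi> a + \<phi> b - 2 * m)" for a b
  proof -
    let ?c = "(1/2) *\<^sub>R (a + b)"
    have "\<phi> a + \<phi> b - 2 * \<phi> ?c = (norm (a - b))\<^sup>2 / 4"
      by (simp add: \<phi>_def power2_norm_eq_inner blinfun.bilinear_simps inner_simps inner_commute[of b a] field_simps)
    then show ?thesis using m_le[of ?c] by simp
  qed
  have width: "(\<lambda>n. 1 / real (Suc n)) \<longlonglongrightarrow> 0"
    using LIMSEQ_inverse_real_of_nat by (simp add: inverse_eq_divide)
  have "Cauchy w"
  proof (rule CauchyI)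
    fix e :: real assume e: "0 < e"
    then have "0 < e\<^sup>2 / 8" by simp
    from order_tendstoD(2)[OF width this] obtain N where N: "\<And>n. n \<ge> N \<Longrightarrow> 1 / real (Suc n) < e\<^sup>2 / 8"
      by (auto simp: eventually_sequentially)
    show "\<exists>M. \<forall>m\<ge>M. \<forall>n\<ge>M. norm (w m - w n) < e"
    proof (intro exI allI impI)
      fix i j assume "N \<le> i" "N \<le> j"
      have "\<phi> (w k) < m + e\<^sup>2 / 8" if "N \<le> k" for k
        using w[of k] N[OF that] by (meson add_less_cancel_left less_trans)
      from this[OF \<open>N \<le> i\<close>] this[OF \<open>N \<le> j\<close>]
      have "4 * (\<phi> (w i) + \<phi> (w j) - 2 * m) < e\<^sup>2" by (simp add: field_simps)
      with par[of "w i" "w j"] have "(norm (w i - w j))\<^sup>2 < e\<^sup>2" by (rule le_less_trans)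
      then show "norm (w i - w j) < e" using e by (simp add: power_less_imp_less_base)
    qed
  qed
  then obtain l where l: "w \<longlonglongrightarrow> l" using Cauchy_convergent_iff convergent_def by blast
  have "(\<lambda>n. \<phi> (w n)) \<longlonglongrightarrow> \<phi> l"
    unfolding \<phi>_def
    by (rule tendsto_diff[OF tendsto_divide[OF tendsto_inner[OF l l] tendsto_const]
          blinfun.tendsto[OF tendsto_const l]]) simp
  moreover have "(\<lambda>n. m + 1 / real (Suc n)) \<longlonglongrightarrow> m" using tendsto_add[OF tendsto_const width, of m] by simp
  ultimately have "\<phi> l \<le> m"
    by (rule LIMSEQ_le) (use w in \<open>auto intro: less_imp_le\<close>)
  then have min: "\<phi> l \<le> \<phi> w" for w using m_le[of w] by linarith
  have "f v = l \<bullet> v" for v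
  proof (cases "v = 0")
    case False
    then have vv: "v \<bullet> v > 0" by simp
    define d where "d = l \<bullet> v - f v"
    \<comment> \<open>The minimiser of the quadratic polynomial t d + t^2 |v|^2 / 2; its value -d^2
      / (2 |v|^2) can only be nonnegative if d = 0.\<close>
    define t where "t = - d / (v \<bullet> v)"
    have "\<phi> (l + t *\<^sub>R v) = \<phi> l + t * d + t\<^sup>2 * (v \<bullet> v) / 2"
      by (simp add: \<phi>_def d_def blinfun.bilinear_simps inner_simps inner_commute[of v l] power2_eq_square field_simps)
    then have "0 \<le> t * d + t\<^sup>2 * (v \<bullet> v) / 2" using min[of "l + t *\<^sub>R v"] by linarith
    also have "\<dots> = - d\<^sup>2 / (2 * (v \<bullet> v))" using vv by (simp add: t_def power2_eq_square field_simps)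
    finally have "d\<^sup>2 \<le> 0" using vv by (simp add: divide_le_0_iff not_le zero_le_divide_iff)
    then show ?thesis by (simp add: d_def)
  qed (simp add: blinfun.zero_right)
  then show ?thesis by (rule that)
qed

text \<open>Shows that the description defining \<open>adj\<close> has a value. Real Riesz
  representation gives the adjoint for the real inner product; inserting the imaginary unit in the
  first argument, where x is complex-linear, gives the imaginary part.\<close>

lemma cinner_adj:
  assumes x: "x \<in> bounded_operators"
  shows "cinner (blinfun_apply x u) v = cinner u (adj x v)"
proof -
  have "\<exists>w. \<forall>u. x u \<bullet> v = w \<bullet> u" for v
  proof -
    define f where "f = Blinfun (\<lambda>u. x u \<bullet> v)"
    have "bounded_linear (\<lambda>u. x u \<bullet> v)"
      by (intro bounded_linear_inner_left_comp blinfun.bounded_linear_right)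
    then have "f u = x u \<bullet> v" for u by (simp add: f_def bounded_linear_Blinfun_apply)
    then show ?thesis using riesz_representation[of f] by metis
  qed
  then obtain g where g: "\<And>u v. x u \<bullet> v = g v \<bullet> u" by metis
  have eqI: "a = b" if "\<And>u. a \<bullet> u = b \<bullet> u" for a b :: 'a
    by (rule inner_eqI) (use that in \<open>simp add: inner_commute\<close>)
  have "bounded_linear g"
  proof (rule bounded_linear_intro[where K = "norm x"])
    show "g (a + b) = g a + g b" for a b by (rule eqI) (simp add: inner_simps flip: g)
    show "g (c *\<^sub>R a) = c *\<^sub>R g a" for c a by (rule eqI) (simp add: inner_simps flip: g)
    show "norm (g v) \<le> norm v * norm x" for v
    proof (cases "g v = 0")
      case False
      have "norm (g v) * norm (g v) = x (g v) \<bullet> v" by (simp add: g dot_square_norm power2_eq_square)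
      also have "\<dots> \<le> norm (x (g v)) * norm v" by (rule norm_cauchy_schwarz)
      also have "\<dots> \<le> norm x * norm (g v) * norm v" by (intro mult_right_mono norm_blinfun) auto
      finally show ?thesis using False by (simp add: mult_ac)
    qed simp
  qed
  then obtain y where y: "blinfun_apply y = g" using bounded_linear_Blinfun_apply by blast
  have real: "x u \<bullet> v = u \<bullet> y v" for u v using g y by (simp add: inner_commute)
  have xi: "x (\<i> *\<^sub>C u) = \<i> *\<^sub>C x u" for u using x by (simp add: bounded_operators_def)
  have Y: "\<forall>u v. cinner (x u) v = cinner u (y v)"
  proof (intro allI complex_eqI)
    show "Re (cinner (x u) v) = Re (cinner u (y v))" for u v by (simp only: Re_cinner real)
    show "Im (cinner (x u) v) = Im (cinner u (y v))" for u v
      using real[of "\<i> *\<^sub>C u" v] by (simp only: Im_cinner xi)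
  qed
  have "adj x = y" unfolding adj_def
  proof (rule the_equality)
    show "\<forall>u v. cinner (x u) v = cinner u (y v)" by (rule Y)
    fix z assume z: "\<forall>u v. cinner (x u) v = cinner u (blinfun_apply z v)"
    show "z = y"
    proof (rule blinfun_eqI)
      fix v
      have "u \<bullet> z v = u \<bullet> y v" for u using Y z by (metis Re_cinner)
      then show "z v = y v" by (rule inner_eqI)
    qed
  qed
  with Y show ?thesis by simp
qed

lemma selfadj_cinner:
  assumes "x \<in> bounded_operators" "selfadj x"
  shows "cinner (blinfun_apply x u) v = cinner u (x v)"
proof -
  have "x (\<i> *\<^sub>C u) = \<i> *\<^sub>C x u" using assms(1) by (simp add: bounded_operators_def)
  then have "(\<i> *\<^sub>C x u) \<bullet> v = (\<i> *\<^sub>C u) \<bullet> x v"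
    using selfadjD[OF assms(2), of "\<i> *\<^sub>C u" v] by simp
  then show ?thesis
    by (intro complex_eqI) (simp_all only: Re_cinner Im_cinner selfadjD[OF assms(2)])
qed

lemma adj_eq_self_iff: "x \<in> bounded_operators \<Longrightarrow> adj x = x \<longleftrightarrow> selfadj x"
proof
  assume x: "x \<in> bounded_operators" and "adj x = x"
  then show "selfadj x" using cinner_adj[OF x] unfolding selfadj_def by (metis Re_cinner)
next
  assume x: "x \<in> bounded_operators" and sa: "selfadj x"
  show "adj x = x"
  proof (rule blinfun_eqI)
    fix v
    have "u \<bullet> adj x v = u \<bullet> x v" for u
      using cinner_adj[OF x] selfadj_cinner[OF x sa] by (metis Re_cinner)
    then show "adj x v = x v" by (rule inner_eqI)
  qed
qed

lemma projection_op_iff: "projection_op p \<longleftrightarrow> p \<in> bounded_operators \<and> orthproj p"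
  unfolding projection_op_def orthproj_def using adj_eq_self_iff by blast

lemma cinner_quadratic_real:
  assumes "x \<in> bounded_operators" "selfadj x"
  shows "cinner v (blinfun_apply x v) = complex_of_real (v \<bullet> x v)"
proof -
  have "cinner v (x v) = cnj (cinner v (x v))"
    using selfadj_cinner[OF assms, of v v] cinner_commute[of v "x v"] by simp
  then have "Im (cinner v (x v)) = 0" by (simp add: complex_eq_iff)
  then show ?thesis by (simp add: complex_eq_iff Re_cinner)
qed

text \<open>On a complex space a real-valued quadratic form already forces symmetry, so the two
  notions of positivity agree on complex-linear operators.\<close>

lemma positive_op_iff: "positive_op x \<longleftrightarrow> x \<in> bounded_operators \<and> posop x"
proof (intro iffI conjI)
  assume p: "positive_op x"
  then show x: "x \<in> bounded_operators" by (simp add: positive_op_def)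
  have xi: "x (\<i> *\<^sub>C u) = \<i> *\<^sub>C x u" for u using x by (simp add: bounded_operators_def)
  have re: "Im (cinner v (x v)) = 0" "0 \<le> Re (cinner v (x v))" for v
    using p by (auto simp: positive_op_def complex_nonneg_Reals_iff)
  have z: "(\<i> *\<^sub>C v) \<bullet> x v = 0" for v using re(1) by (simp add: Im_cinner)
  have "x u \<bullet> v = u \<bullet> x v" for u v
  proof -
    have "(\<i> *\<^sub>C a) \<bullet> x b + (\<i> *\<^sub>C b) \<bullet> x a = 0" for a b
      using z[of "a + b"] z[of a] z[of b]
      by (simp add: scaleC_add_right blinfun.add_right inner_simps)
    \<comment> \<open>The polarized identity at \<open>\<i> *\<^sub>C v\<close> trades the imaginary
      unit for a sign and leaves symmetry.\<close>
    from this[of u "\<i> *\<^sub>C v"] show ?thesis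
      by (simp add: xi inner_iI scaleC_iI inner_commute)
  qed
  then show "posop x" using re(2) by (simp add: posop_def selfadj_def Re_cinner)
next
  assume "x \<in> bounded_operators \<and> posop x"
  then show "positive_op x"
    by (auto simp: positive_op_def posop_def cinner_quadratic_real nonneg_Reals_of_real_iff)
qed

section \<open>The spectral theorem\<close>

lemma spectral_functional_vector_state:
  assumes "selfadj x" shows "spectral_functional x (\<lambda>z. v \<bullet> blinfun_apply z v)"
proof
  show "(\<lambda>n. v \<bullet> gtproj x (t + 1 / real (Suc n)) v) \<longlonglongrightarrow> v \<bullet> gtproj x t v" for t
    by (rule tendsto_inner[OF tendsto_const gtproj_right_cont[OF assms]])
qed (use assms in \<open>auto simp: posop_def op_simps\<close>)

definition vector_measure :: "('a::{real_inner, complete_space}) operator \<Rightarrow> 'a \<Rightarrow> real measure" where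
  "vector_measure x v = spectral_functional.dist_measure x (\<lambda>z. v \<bullet> blinfun_apply z v)"

text \<open>Dynkin's theorem extends the projections from half-lines to Borel sets: two projections whose
  sum is at most the identity are orthogonal, so that the property is stable under disjoint unions.\<close>

lemma vector_measure_projection:
  assumes x: "selfadj x" and B: "B \<in> sets borel"
  shows "\<exists>P. orthproj P \<and> P \<in> bicomm x \<and> (\<forall>v. v \<bullet> blinfun_apply P v = measure (vector_measure x v) B)"
proof -
  interpret spectral_functional x "\<lambda>z. v \<bullet> blinfun_apply z v" for v
    by (rule spectral_functional_vector_state[OF x])
  note vm = vector_measure_def
  have UNIV: "measure (vector_measure x v) UNIV = v \<bullet> v" for v
    using measure_UNIV[of v] by (simp add: vm)
  have "Int_stable (range (\<lambda>a::real. {a<..}))"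
    by (auto simp: Int_stable_def lessThan_Int_lessThan)
  moreover have "range (\<lambda>a::real. {a<..}) \<subseteq> Pow UNIV" by simp
  moreover have "B \<in> sigma_sets UNIV (range (\<lambda>a::real. {a<..}))" using B unfolding borel_Ioi by simp
  ultimately show ?thesis
  proof (induction rule: sigma_sets_induct_disjoint)
    case (basic A)
    then obtain a where "A = {a<..}" by auto
    then show ?case using gt gt_bicomm measure_greaterThan by (auto simp: vm)
  next
    case empty
    show ?case by (intro exI[of _ 0]) (simp add: orthproj_def bicomm_zero compose_bilinear)
  next
    case (compl A)
    then obtain P where P: "orthproj P" "P \<in> bicomm x" "\<And>v. v \<bullet> P v = measure (vector_measure x v) A"
      by auto
    have A: "A \<in> sets borel" using compl.hyps unfolding borel_Ioi by simp
    have "v \<bullet> (id_blinfun - P) v = measure (vector_measure x v) (UNIV - A)" for v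
      using dist.finite_measure_compl[of A v] A UNIV[of v] P(3)[of v] by (simp add: vm op_simps)
    then show ?case using P by (intro exI[of _ "id_blinfun - P"])
        (auto intro: orthproj_compl bicomm_diff bicomm_id)
  next
    case (union A)
    have A: "A i \<in> sets borel" for i using union.hyps unfolding borel_Ioi by auto
    obtain P where P: "\<And>i. orthproj (P i)" "\<And>i. P i \<in> bicomm x"
      "\<And>i v. v \<bullet> P i v = measure (vector_measure x v) (A i)"
      using union.IH by metis
    have orth: "P i o\<^sub>L P j = 0" if "i \<noteq> j" for i j
    proof (rule orthproj_compose_zero[OF P(1) P(1)])
      fix v
      have "measure (vector_measure x v) (A i \<union> A j)
          = measure (vector_measure x v) (A i) + measure (vector_measure x v) (A j)"
        unfolding vm using A that union.hyps(1)
        by (intro dist.finite_measure_Union) (auto simp: disjoint_family_on_def)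
      then show "v \<bullet> P i v + v \<bullet> P j v \<le> v \<bullet> v"
        using dist.bounded_measure[of v "A i \<union> A j"] UNIV[of v] P(3) by (simp add: vm)
    qed
    define S where "S n = (\<Sum>i<n. P i)" for n
    have S: "orthproj (S n)" for n
    proof (induction n)
      case 0 show ?case by (simp add: S_def orthproj_def compose_bilinear)
    next
      case (Suc n)
      have "S n o\<^sub>L P n = 0" by (simp add: S_def compose_bilinear orth)
      then show ?case using orthproj_add[OF Suc P(1)] by (simp add: S_def)
    qed
    \<comment> \<open>The partial sums increase; their complements are the decreasing contractions
      to which the limit lemma applies.\<close>
    obtain G where lim: "\<And>v. (\<lambda>n. (id_blinfun - S n) v) \<longlonglongrightarrow> blinfun_apply G v"
    proof (rule decreasing_pcontr_limit[of "\<lambda>n. id_blinfun - S n"])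
      show "pcontr (id_blinfun - S n)" for n by (intro orthproj_pcontr orthproj_compl S)
      show "v \<bullet> (id_blinfun - S (Suc n)) v \<le> v \<bullet> (id_blinfun - S n) v" for n v
        using orthproj_inner[OF P(1), of v n] by (simp add: S_def op_simps)
    qed blast
    define Q where "Q = id_blinfun - G"
    have limQ: "(\<lambda>n. S n v) \<longlonglongrightarrow> Q v" for v
      using tendsto_diff[OF tendsto_const[of v] lim[of v]] by (simp add: Q_def op_simps)
    have "v \<bullet> Q v = measure (vector_measure x v) (\<Union>i. A i)" for v
    proof (rule LIMSEQ_unique)
      show "(\<lambda>n. v \<bullet> S n v) \<longlonglongrightarrow> v \<bullet> Q v" by (rule tendsto_inner[OF tendsto_const limQ])
      have "(\<lambda>i. measure (vector_measure x v) (A i)) sums measure (vector_measure x v) (\<Union>i. A i)"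
        unfolding vm using A union.hyps(1) by (intro dist.finite_measure_UNION) auto
      then show "(\<lambda>n. v \<bullet> S n v) \<longlonglongrightarrow> measure (vector_measure x v) (\<Union>i. A i)"
        by (simp add: sums_def S_def blinfun.sum_left inner_sum_right P(3))
    qed
    moreover have "orthproj Q" using limQ S by (rule orthproj_limit)
    moreover have "Q \<in> bicomm x" using limQ
      by (rule bicomm_limit) (simp add: S_def bicomm_sum P(2))
    ultimately show ?case by blast
  qed
qed

text \<open>The projections with the vector measures as quadratic forms are additive in the set.
  Orthogonality on disjoint sets yields multiplicativity, and the first moment of each vector
  measure recovers the form of x.\<close>

lemma spectral_measure_exists:
  fixes x :: "('a::chilbert_space) operator"
  assumes x: "selfadj x" "x \<in> bounded_operators"
  shows "\<exists>E. is_spectral_measure x E"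
proof -
  interpret spectral_functional x "\<lambda>z. v \<bullet> blinfun_apply z v" for v
    by (rule spectral_functional_vector_state[OF x(1)])
  let ?m = "vector_measure x"
  note vm = vector_measure_def
  have sets [measurable_cong]: "sets (?m v) = sets borel" and space: "space (?m v) = UNIV" for v
    by (simp_all add: vm)
  interpret vm: finite_measure "?m v" for v unfolding vm by (rule dist.finite_measure_axioms)
  have "\<exists>F. \<forall>B\<in>sets borel. orthproj (F B) \<and> F B \<in> bicomm x \<and> (\<forall>v. v \<bullet> blinfun_apply (F B) v = measure (?m v) B)"
    using vector_measure_projection[OF x(1)] by (intro bchoice) blast
  then obtain F where F: "\<And>B. B \<in> sets borel \<Longrightarrow> orthproj (F B)" "\<And>B. B \<in> sets borel \<Longrightarrow> F B \<in> bicomm x"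
    "\<And>B v. B \<in> sets borel \<Longrightarrow> v \<bullet> blinfun_apply (F B) v = measure (?m v) B" by blast
  have F_UNIV: "F UNIV = id_blinfun"
    by (rule selfadj_eqI)
      (use F(1,3)[of UNIV] measure_UNIV in \<open>auto simp: vm orthproj_def\<close>)
  have F_Un: "F (A \<union> B) = F A + F B" if "A \<in> sets borel" "B \<in> sets borel" "A \<inter> B = {}" for A B
  proof (rule selfadj_eqI)
    show "selfadj (F (A \<union> B))" "selfadj (F A + F B)"
      using that F(1) by (auto simp: orthproj_def intro!: selfadj_add)
    show "v \<bullet> F (A \<union> B) v = v \<bullet> (F A + F B) v" for v
      using that vm.finite_measure_Union[of A v B] by (simp add: F(3) op_simps sets)
  qed
  have F_disj: "F A o\<^sub>L F B = 0" if "A \<in> sets borel" "B \<in> sets borel" "A \<inter> B = {}" for A B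
  proof (rule orthproj_compose_zero)
    fix v
    have "v \<bullet> F (A \<union> B) v \<le> v \<bullet> v"
      using orthproj_pcontr[OF F(1), of "A \<union> B"] that by (auto simp: pcontr_def)
    then show "v \<bullet> F A v + v \<bullet> F B v \<le> v \<bullet> v" using F_Un[OF that] by (simp add: op_simps)
  qed (use that F(1) in auto)
  have F_Int: "F (A \<inter> B) = F A o\<^sub>L F B" if A: "A \<in> sets borel" and B: "B \<in> sets borel" for A B
  proof -
    have "F A = F (A \<inter> B) + F (A - B)" "F B = F (A \<inter> B) + F (B - A)"
    proof -
      have "A \<inter> B \<union> (A - B) = A" "A \<inter> B \<union> (B - A) = B" by auto
      then show "F A = F (A \<inter> B) + F (A - B)" "F B = F (A \<inter> B) + F (B - A)"
        using F_Un[of "A \<inter> B" "A - B"] F_Un[of "A \<inter> B" "B - A"] A B by auto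
    qed
    moreover have "F (A \<inter> B) o\<^sub>L F (A \<inter> B) = F (A \<inter> B)" using F(1)[of "A \<inter> B"] A B by (simp add: orthproj_def)
    moreover have "F (A - B) o\<^sub>L F (A \<inter> B) = 0" "F (A \<inter> B) o\<^sub>L F (B - A) = 0" "F (A - B) o\<^sub>L F (B - A) = 0"
      using A B by (auto intro!: F_disj)
    ultimately show ?thesis by (simp add: compose_bilinear)
  qed
  have F_sums: "(\<lambda>i. F (A i) v) sums F (\<Union>i. A i) v"
    if A: "range A \<subseteq> sets borel" "disjoint_family A" for A :: "nat \<Rightarrow> real set" and v
  proof -
    let ?U = "\<Union>i. A i"
    have Ai: "A i \<in> sets borel" for i using A by auto
    have part: "(\<Sum>i<n. F (A i)) = F (\<Union>i<n. A i)" for n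
    proof (induction n)
      case 0
      have "F {} = 0" using F_disj[of "{}" "{}"] F(1)[of "{}"] by (simp add: orthproj_def)
      then show ?case by simp
    next
      case (Suc n)
      have "A i \<inter> A n = {}" if "i < n" for i using that by (intro disjoint_family_onD[OF A(2)]) auto
      then have "(\<Union>i<n. A i) \<inter> A n = {}" by blast
      then have "F ((\<Union>i<n. A i) \<union> A n) = F (\<Union>i<n. A i) + F (A n)"
        using Ai by (intro F_Un) auto
      then show ?case using Suc by (simp add: lessThan_Suc Un_commute)
    qed
    \<comment> \<open>The remainder is \<open>F (?U - ?V) v\<close>, and the squared norm of a
      projected vector is its quadratic form. Thus scalar countable additivity becomes strong
      convergence.\<close>
    have sq: "(norm (F ?U v - (\<Sum>i<n. F (A i) v)))\<^sup>2 = measure (?m v) ?U - (\<Sum>i<n. measure (?m v) (A i))" for n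
    proof -
      let ?V = "\<Union>i<n. A i"
      have U: "?U = ?V \<union> (?U - ?V)" by auto
      have b: "?V \<in> sets borel" "?U - ?V \<in> sets borel" using Ai by auto
      have D: "F ?U = F ?V + F (?U - ?V)" by (subst U, rule F_Un[OF b]) auto
      have "F ?U v - (\<Sum>i<n. F (A i) v) = F (?U - ?V) v"
        using D part[of n] by (simp add: op_simps flip: blinfun.sum_left)
      then have "(norm (F ?U v - (\<Sum>i<n. F (A i) v)))\<^sup>2 = v \<bullet> F (?U - ?V) v"
        using orthproj_inner[OF F(1)[OF b(2)], of v] by (simp add: power2_norm_eq_inner)
      also have "\<dots> = v \<bullet> F ?U v - v \<bullet> (\<Sum>i<n. F (A i)) v" using D part[of n] by (simp add: op_simps)
      also have "\<dots> = measure (?m v) ?U - (\<Sum>i<n. measure (?m v) (A i))"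
        using Ai by (simp add: F(3) blinfun.sum_left inner_sum_right)
      finally show ?thesis .
    qed
    have "(\<lambda>i. measure (?m v) (A i)) sums measure (?m v) ?U"
      by (rule vm.finite_measure_UNION) (use A in \<open>auto simp: sets\<close>)
    then have "(\<lambda>n. (norm (F ?U v - (\<Sum>i<n. F (A i) v)))\<^sup>2) \<longlonglongrightarrow> measure (?m v) ?U - measure (?m v) ?U"
      unfolding sq sums_def by (rule tendsto_diff[OF tendsto_const])
    then have "(\<lambda>n. sqrt ((norm (F ?U v - (\<Sum>i<n. F (A i) v)))\<^sup>2)) \<longlonglongrightarrow> sqrt 0"
      by (intro tendsto_real_sqrt) simp
    then have "(\<lambda>n. norm ((\<Sum>i<n. F (A i) v) - F ?U v)) \<longlonglongrightarrow> 0" by (simp add: norm_minus_commute)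
    then show ?thesis unfolding sums_def by (rule LIM_zero_cancel[OF tendsto_norm_zero_cancel])
  qed
  \<comment> \<open>The definition asks for a measure on the complex plane, so F is transported
    along the embedding of the real line.\<close>
  define E where "E B = F (complex_of_real -` B)" for B
  have pre: "complex_of_real -` B \<in> sets borel" if "B \<in> sets borel" for B
    using measurable_sets[of complex_of_real borel borel B] that by simp
  have scalar: "scalar_measure E v = distr (?m v) borel complex_of_real" for v
  proof -
    let ?D = "distr (?m v) borel complex_of_real"
    have "scalar_measure E v = measure_of UNIV (sets borel) (emeasure ?D)"
      unfolding scalar_measure_def
    proof (rule measure_of_eq)
      fix B :: "complex set" assume "B \<in> sigma_sets UNIV (sets borel)"
      then have B: "B \<in> sets borel" using sets.sigma_sets_eq[of "borel :: complex measure"] by simp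
      show "ennreal (Re (cinner v (blinfun_apply (E B) v))) = emeasure ?D B"
        using B pre[OF B] by (simp add: emeasure_distr vm.emeasure_eq_measure space E_def F(3) Re_cinner)
    qed simp
    also have "\<dots> = ?D" using measure_of_of_measure[of ?D] by simp
    finally show ?thesis .
  qed
  obtain K where K: "norm x < K" using gt_ex by blast
  have "is_spectral_measure x E"
    unfolding is_spectral_measure_def
  proof (intro conjI ballI allI impI)
    show "projection_op (E B)" if "B \<in> sets borel" for B
      using pre[OF that] F(1,2) bicomm_bounded[OF _ x(2)] by (auto simp: projection_op_iff E_def)
    show "E UNIV = id_blinfun" by (simp add: E_def F_UNIV)
    show "E (A \<inter> B) = E A o\<^sub>L E B" if "A \<in> sets borel" "B \<in> sets borel" for A B
      using F_Int[OF pre[OF that(1)] pre[OF that(2)]] by (simp add: E_def)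
    show "(\<lambda>i. E (A i) v) sums E (\<Union>i. A i) v"
      if "range A \<subseteq> sets borel" "disjoint_family A" for A :: "nat \<Rightarrow> complex set" and v
      unfolding E_def vimage_UN
      by (rule F_sums) (use that pre in \<open>auto simp: disjoint_family_on_def\<close>)
    fix v
    have int: "integrable (?m v) (\<lambda>t. t)"
      unfolding vm by (rule integrable_bounded_on[OF _ K, where C = K]) auto
    show "integrable (scalar_measure E v) (\<lambda>z. z)"
      unfolding scalar by (subst integrable_distr_eq) (auto intro: integrable_of_real int)
    have "integral\<^sup>L (scalar_measure E v) (\<lambda>z. z) = (\<integral>t. complex_of_real t \<partial>?m v)"
      unfolding scalar by (subst integral_distr) auto
    also have "\<dots> = complex_of_real (\<integral>t. t \<partial>?m v)" by simp
    also have "(\<integral>t. t \<partial>?m v) = v \<bullet> x v"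
      using integral_power[of v 1] by (simp add: vm)
    finally show "cinner v (blinfun_apply x v) = integral\<^sup>L (scalar_measure E v) (\<lambda>z. z)"
      by (simp add: cinner_quadratic_real[OF x(2,1)])
  qed
  then show ?thesis by blast
qed

text \<open>The absence of cross terms in the form says x = P x P + (1 - P) x (1 - P), because a
  self-adjoint operator is determined by its form.\<close>

lemma commute_of_quadratic_split:
  assumes P: "orthproj P" and x: "selfadj x"
    and split: "\<And>v. v \<bullet> x v = P v \<bullet> x (P v) + (v - P v) \<bullet> x (v - P v)"
  shows "x o\<^sub>L P = P o\<^sub>L x"
proof -
  let ?Q = "id_blinfun - P"
  let ?y = "(P o\<^sub>L x o\<^sub>L P) + (?Q o\<^sub>L x o\<^sub>L ?Q)"
  have eq: "x = ?y"
  proof (rule selfadj_eqI[OF x])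
    show "selfadj ?y"
      by (simp add: selfadj_def op_simps orthproj_sa[OF P] selfadjD[OF x])
    show "v \<bullet> x v = v \<bullet> ?y v" for v
      by (subst split) (simp add: op_simps orthproj_sa[OF P] selfadjD[OF x])
  qed
  have y: "x v = P (x (P v)) + ((x (v - P v)) - P (x (v - P v)))" for v
    using arg_cong[OF eq, of "\<lambda>T. blinfun_apply T v"] by (simp add: op_simps algebra_simps)
  show ?thesis
  proof (rule commuteI)
    show "x (P v) = P (x v)" for v
      using y[of "P v"] arg_cong[OF y[of v], of "blinfun_apply P"]
      by (simp add: orthproj_idem[OF P] op_simps)
  qed
qed

lemma image_greaterThan_eq: "complex_of_real ` {a<..} = {z. Im z = 0 \<and> a < Re z}"
  by (auto simp: complex_eq_iff image_iff intro!: bexI[of _ "Re _"])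

lemma image_greaterThan_borel: "complex_of_real ` {a<..} \<in> sets borel"
  unfolding image_greaterThan_eq by measurable

context
  fixes x :: "('a::chilbert_space) operator" and E :: "complex set \<Rightarrow> 'a operator"
  assumes E: "is_spectral_measure x E" and x: "x \<in> bounded_operators" "selfadj x"
begin

lemma E_orthproj: "B \<in> sets borel \<Longrightarrow> orthproj (E B)"
  using E by (simp add: is_spectral_measure_def projection_op_iff)

lemma E_Int: "A \<in> sets borel \<Longrightarrow> B \<in> sets borel \<Longrightarrow> E (A \<inter> B) = E A o\<^sub>L E B"
  using E by (simp add: is_spectral_measure_def)

lemma sets_scalar_measure [simp, measurable_cong]: "sets (scalar_measure E v) = sets borel"
  and space_scalar_measure [simp]: "space (scalar_measure E v) = UNIV"
  using sets.sigma_sets_eq[of "borel :: complex measure"] by (simp_all add: scalar_measure_def)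

lemma emeasure_scalar_measure:
  assumes B: "B \<in> sets borel" shows "emeasure (scalar_measure E v) B = ennreal (v \<bullet> E B v)"
proof -
  have nonneg: "0 \<le> v \<bullet> E B v" if "B \<in> sets borel" for B
    using orthproj_inner[OF E_orthproj[OF that], of v] by simp
  have sums: "(\<lambda>i. v \<bullet> E (A i) v) sums (v \<bullet> E (\<Union>i. A i) v)"
    if "range A \<subseteq> sets borel" "disjoint_family A" for A
  proof -
    have "(\<lambda>i. blinfun_apply (E (A i)) v) sums blinfun_apply (E (\<Union>i. A i)) v"
      using E that by (simp add: is_spectral_measure_def)
    then show ?thesis by (rule bounded_linear.sums[OF bounded_linear_inner_right])
  qed
  have "emeasure (scalar_measure E v) B = ennreal (Re (cinner v (blinfun_apply (E B) v)))"
    unfolding scalar_measure_def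
  proof (rule emeasure_measure_of_sigma[OF _ _ _ B])
    show "sigma_algebra UNIV (sets (borel :: complex measure))"
      using sets.sigma_algebra_axioms[of "borel :: complex measure"] by simp
    \<comment> \<open>The empty set is the disjoint union of countably many copies of itself, and a
      convergent series with constant terms has terms 0.\<close>
    have "E {} = 0"
    proof (rule selfadj_eqI)
      show "v \<bullet> E {} v = v \<bullet> blinfun_apply 0 v" for v
      proof -
        have "(\<lambda>i::nat. blinfun_apply (E {}) v) sums blinfun_apply (E (\<Union>i::nat. {})) v"
          using E[unfolded is_spectral_measure_def] by (auto simp: disjoint_family_on_def)
        then have "(\<lambda>i::nat. blinfun_apply (E {}) v) \<longlonglongrightarrow> 0"
          by (intro summable_LIMSEQ_zero) (rule sums_summable)
        then show ?thesis by (simp add: LIMSEQ_const_iff)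
      qed
    qed (use E_orthproj[of "{}"] in \<open>auto simp: orthproj_def\<close>)
    then show "positive (sets borel) (\<lambda>B. ennreal (Re (cinner v (blinfun_apply (E B) v))))"
      by (simp add: positive_def Re_cinner)
    show "countably_additive (sets borel) (\<lambda>B. ennreal (Re (cinner v (blinfun_apply (E B) v))))"
      unfolding countably_additive_def Re_cinner
      by (intro allI impI suminf_ennreal_eq nonneg sums) auto
  qed
  then show ?thesis by (simp add: Re_cinner)
qed

lemma finite_scalar_measure: "finite_measure (scalar_measure E v)"
  by (rule finite_measureI) (simp add: emeasure_scalar_measure)

lemma measure_scalar_measure:
  "B \<in> sets borel \<Longrightarrow> measure (scalar_measure E v) B = v \<bullet> E B v"
  using orthproj_inner[OF E_orthproj, of B v] by (simp add: measure_def emeasure_scalar_measure)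

lemma measure_scalar_measure_UNIV: "measure (scalar_measure E v) UNIV = v \<bullet> v"
  using E by (simp add: measure_scalar_measure is_spectral_measure_def)

lemma E_compl: assumes B: "B \<in> sets borel" shows "E (- B) = id_blinfun - E B"
proof (rule selfadj_eqI)
  interpret finite_measure "scalar_measure E v" for v by (rule finite_scalar_measure)
  have [measurable]: "- B \<in> sets borel" using B by simp
  show "selfadj (E (- B))" "selfadj (id_blinfun - E B)"
    using E_orthproj[of "- B"] E_orthproj[OF B] by (auto simp: orthproj_def selfadj_diff)
  show "v \<bullet> E (- B) v = v \<bullet> (id_blinfun - E B) v" for v
    using finite_measure_compl[of B v] B
    by (simp add: measure_scalar_measure_UNIV measure_scalar_measure op_simps Compl_eq_Diff_UNIV)
qed

text \<open>The measure of \<open>E B v\<close> is the restriction to \<open>B\<close> of that of \<open>v\<close>.\<close>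

lemma cinner_localized:
  assumes B: "B \<in> sets borel"
  shows "cinner (blinfun_apply (E B) v) (blinfun_apply x (blinfun_apply (E B) v))
    = (\<integral>z. indicator B z *\<^sub>R z \<partial>scalar_measure E v)"
proof -
  have "scalar_measure E (E B v) = density (scalar_measure E v) (indicator B)"
  proof (rule measure_eqI)
    fix A assume "A \<in> sets (scalar_measure E (E B v))"
    then have A: "A \<in> sets borel" by simp
    have "E B v \<bullet> E A (E B v) = v \<bullet> E (B \<inter> A) v"
    proof -
      have "E (B \<inter> A) = E B o\<^sub>L (E A o\<^sub>L E B)"
        using E_Int[OF B, of "A \<inter> B"] E_Int[OF A B] A B by (simp add: Int_ac)
      then show ?thesis by (simp add: orthproj_sa[OF E_orthproj[OF B]])
    qed
    then show "emeasure (scalar_measure E (E B v)) A = emeasure (density (scalar_measure E v) (indicator B)) A"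
      using A B by (simp add: emeasure_restricted emeasure_scalar_measure)
  qed simp
  then have "scalar_measure E (E B v) = density (scalar_measure E v) (\<lambda>z. ennreal (indicator B z))"
    by (simp add: ennreal_indicator)
  moreover have "(\<integral>z. z \<partial>density (scalar_measure E v) (\<lambda>z. ennreal (indicator B z)))
      = (\<integral>z. indicator B z *\<^sub>R z \<partial>scalar_measure E v)"
    using B by (intro integral_density) auto
  ultimately show ?thesis using E by (simp add: is_spectral_measure_def)
qed

lemma integrable_localized:
  assumes "B \<in> sets borel" shows "integrable (scalar_measure E v) (\<lambda>z. indicator B z *\<^sub>R z)"
  using E assms by (intro integrable_mult_indicator) (simp_all add: is_spectral_measure_def)

lemma inner_localized:
  assumes B: "B \<in> sets borel"
  shows "E B v \<bullet> x (E B v) = (\<integral>z. indicator B z * Re z \<partial>scalar_measure E v)"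
  using arg_cong[OF cinner_localized[OF B, of v], of Re] integral_Re[OF integrable_localized[OF B, of v]]
  by (simp add: Re_cinner)

lemma integrable_Re_localized:
  "B \<in> sets borel \<Longrightarrow> integrable (scalar_measure E v) (\<lambda>z. indicator B z * Re z)"
  using integrable_Re[OF integrable_localized[of B v]] by simp

text \<open>The definition gives x only through its quadratic forms, so commutation is obtained by
  splitting the integral into B and its complement.\<close>

lemma E_commute: assumes B: "B \<in> sets borel" shows "x o\<^sub>L E B = E B o\<^sub>L x"
proof (rule commute_of_quadratic_split[OF E_orthproj[OF B] x(2)])
  fix v
  have cB: "- B \<in> sets borel" using B by simp
  have "v \<bullet> x v = (\<integral>z. indicator UNIV z * Re z \<partial>scalar_measure E v)"
    using inner_localized[of UNIV v] E by (simp add: is_spectral_measure_def)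
  also have "\<dots> = (\<integral>z. indicator B z * Re z + indicator (- B) z * Re z \<partial>scalar_measure E v)"
    by (intro Bochner_Integration.integral_cong) (auto simp: indicator_def)
  also have "\<dots> = E B v \<bullet> x (E B v) + E (- B) v \<bullet> x (E (- B) v)"
    using integrable_Re_localized[OF B] integrable_Re_localized[OF cB]
    by (simp add: inner_localized[OF B] inner_localized[OF cB])
  finally show "v \<bullet> x v = E B v \<bullet> x (E B v) + (v - E B v) \<bullet> x (v - E B v)"
    by (simp add: E_compl[OF B] op_simps)
qed

text \<open>A spectral measure lives a priori on the plane. Localized to the open upper or lower
  half-plane, the integral of Im z is the imaginary part of a form of the self-adjoint x, hence 0,
  while the integrand has one sign.\<close>

lemma AE_real: "AE z in scalar_measure E v. Im z = 0"
proof -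
  have int: "AE z in scalar_measure E v. indicator B z * Im z = 0"
    if B: "B \<in> sets borel" and sgn: "(\<forall>z\<in>B. 0 \<le> Im z) \<or> (\<forall>z\<in>B. Im z \<le> 0)" for B
  proof -
    have "integrable (scalar_measure E v) (\<lambda>z. indicator B z * Im z)"
      using integrable_Im[OF integrable_localized[OF B, of v]] by simp
    moreover have "(\<integral>z. indicator B z * Im z \<partial>scalar_measure E v) = 0"
      using arg_cong[OF cinner_localized[OF B, of v], of Im] integral_Im[OF integrable_localized[OF B, of v]]
      by (simp add: cinner_quadratic_real[OF x])
    ultimately have *: "integrable (scalar_measure E v) (\<lambda>z. c * (indicator B z * Im z))"
      "(\<integral>z. c * (indicator B z * Im z) \<partial>scalar_measure E v) = 0" for c :: real
      by auto
    show ?thesis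
    proof (cases "\<forall>z\<in>B. 0 \<le> Im z")
      case True
      then have "AE z in scalar_measure E v. 1 * (indicator B z * Im z) = 0"
        using integral_nonneg_eq_0_iff_AE[OF *(1)[of 1]] *(2)[of 1] by (auto simp: indicator_def)
      then show ?thesis by simp
    next
      case False
      then have "AE z in scalar_measure E v. (- 1) * (indicator B z * Im z) = 0"
        using integral_nonneg_eq_0_iff_AE[OF *(1)[of "- 1"]] *(2)[of "- 1"] sgn by (auto simp: indicator_def)
      then show ?thesis by simp
    qed
  qed
  have b: "{z. Im z > 0} \<in> sets borel" "{z. Im z < 0} \<in> sets borel" by measurable
  have "AE z in scalar_measure E v. indicator {z. Im z > 0} z * Im z = 0"
    "AE z in scalar_measure E v. indicator {z. Im z < 0} z * Im z = 0"
    by (rule int[OF b(1)], force, rule int[OF b(2)], force)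
  then show ?thesis
    by eventually_elim (auto simp: indicator_def split: if_splits)
qed

text \<open>On the range, equality in the bound would make Re z - a vanish almost everywhere on the
  half-line, so the half-line would be null although it carries all the mass of v. On the kernel the
  measure lives on real z at most a.\<close>

lemma is_gtproj_spectral_measure: "is_gtproj x a (E (complex_of_real ` {a<..}))"
proof -
  let ?B = "complex_of_real ` {a<..}"
  note B = image_greaterThan_borel[of a]
  interpret finite_measure "scalar_measure E v" for v by (rule finite_scalar_measure)
  show ?thesis
    unfolding is_gtproj_def
  proof (intro conjI allI impI E_orthproj[OF B] E_commute[OF B])
    fix v assume v: "E ?B v = v \<and> v \<noteq> 0"
    have int: "integrable (scalar_measure E v) (\<lambda>z. indicator ?B z * (Re z - a))"
      using Bochner_Integration.integrable_diff[OF integrable_Re_localized[OF B, of v]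
          integrable_real_mult_indicator[OF _ integrable_const, of ?B v a]] B
      by (simp add: algebra_simps)
    have "(\<integral>z. indicator ?B z * (Re z - a) \<partial>scalar_measure E v)
        = (\<integral>z. indicator ?B z * Re z - a * indicator ?B z \<partial>scalar_measure E v)"
      by (simp add: algebra_simps)
    also have "\<dots> = v \<bullet> x v - a * (v \<bullet> v)"
      using inner_localized[OF B, of v] integrable_Re_localized[OF B, of v] v B measure_scalar_measure[OF B, of v]
      by (subst Bochner_Integration.integral_diff) (auto simp: emeasure_eq_measure)
    finally have eq: "(\<integral>z. indicator ?B z * (Re z - a) \<partial>scalar_measure E v) = v \<bullet> x v - a * (v \<bullet> v)" .
    have nonneg: "AE z in scalar_measure E v. 0 \<le> indicator ?B z * (Re z - a)"
      by (intro AE_I2) (auto simp: indicator_def)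
    show "a * (v \<bullet> v) < v \<bullet> x v"
    proof (rule ccontr)
      assume "\<not> a * (v \<bullet> v) < v \<bullet> x v"
      moreover have "0 \<le> (\<integral>z. indicator ?B z * (Re z - a) \<partial>scalar_measure E v)"
        by (rule integral_nonneg_AE[OF nonneg])
      ultimately have "(\<integral>z. indicator ?B z * (Re z - a) \<partial>scalar_measure E v) = 0" using eq by linarith
      then have "AE z in scalar_measure E v. indicator ?B z * (Re z - a) = 0"
        using integral_nonneg_eq_0_iff_AE[OF int nonneg] by simp
      then have "AE z in scalar_measure E v. z \<notin> ?B"
        by eventually_elim (auto simp: indicator_def split: if_splits)
      then have "measure (scalar_measure E v) ?B = measure (scalar_measure E v) {}"
        using B by (intro finite_measure_eq_AE) auto
      then show False using measure_scalar_measure[OF B, of v] v by simp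
    qed
  next
    fix v assume v: "E ?B v = 0"
    have "emeasure (scalar_measure E v) ?B = 0" using v by (simp add: emeasure_scalar_measure[OF B])
    then have "AE z in scalar_measure E v. z \<notin> ?B" using B by (intro AE_not_in) (simp add: null_sets_def)
    with AE_real[of v] have le: "AE z in scalar_measure E v. Re z \<le> a"
      by eventually_elim (force simp: image_greaterThan_eq)
    have "v \<bullet> x v = (\<integral>z. Re z \<partial>scalar_measure E v)"
      using inner_localized[of UNIV v] E by (simp add: is_spectral_measure_def)
    also have "\<dots> \<le> (\<integral>z. a \<partial>scalar_measure E v)"
      using integrable_Re_localized[of UNIV v] le by (intro integral_mono_AE) auto
    also have "\<dots> = a * (v \<bullet> v)" by (simp add: measure_scalar_measure_UNIV)
    finally show "v \<bullet> x v \<le> a * (v \<bullet> v)" .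
  qed
qed

end

text \<open>The description selects the single operator \<open>E B\<close>, so agreement of all
  spectral measures on half-lines suffices.\<close>

theorem real_spectral_projection_eq:
  assumes "x \<in> bounded_operators" "selfadj x"
  shows "real_spectral_projection {a<..} x = gtproj x a"
  unfolding real_spectral_projection_def spectral_projection_def
proof (rule the_equality)
  have unique: "E (complex_of_real ` {a<..}) = gtproj x a" if "is_spectral_measure x E" for E
    by (rule gtproj_unique[OF assms(2) is_gtproj_spectral_measure[OF that assms]])
  obtain E where "is_spectral_measure x E" using spectral_measure_exists[OF assms(2,1)] by blast
  with unique show "\<exists>E. is_spectral_measure x E \<and> gtproj x a = E (complex_of_real ` {a<..})" by metis
  show "P = gtproj x a" if "\<exists>E. is_spectral_measure x E \<and> P = E (complex_of_real ` {a<..})" for P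
    using that unique by blast
qed

section \<open>The absolute value\<close>

lemma posop_square_le:
  assumes A: "posop A" and "0 \<le> a" and le: "\<And>v. v \<bullet> A v \<le> a * (v \<bullet> v)"
  shows "A v \<bullet> A v \<le> a\<^sup>2 * (v \<bullet> v)"
proof (cases "a = 0")
  case True
  then have "v \<bullet> A v \<le> v \<bullet> v" for v using le[of v] inner_ge_zero[of v] by (simp add: order_trans)
  then have "pcontr A" using A by (simp add: pcontr_def)
  then show ?thesis using pcontr_square_le[of A v] le[of v] True by simp
next
  case False
  then have a: "0 < a" using \<open>0 \<le> a\<close> by simp
  have "pcontr ((1 / a) *\<^sub>R A)"
    using posop_scaleR[OF A, of "1 / a"] a le
    by (simp add: pcontr_def op_simps pos_divide_le_eq mult.commute)
  from pcontr_norm_le[OF this, of v] have "norm (A v) \<le> a * norm v"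
    using a by (simp add: op_simps pos_divide_le_eq mult.commute)
  then have "(norm (A v))\<^sup>2 \<le> (a * norm v)\<^sup>2" by (intro power_mono) auto
  then show ?thesis by (simp add: power_mult_distrib power2_norm_eq_inner)
qed

text \<open>For nonnegative t and a the conditions t > a and t^2 > a^2 coincide. The strict bound on
  the range is Cauchy-Schwarz.\<close>

lemma is_gtproj_square:
  assumes y: "posop y" and "0 \<le> a" and P: "is_gtproj y a P"
  shows "is_gtproj (y o\<^sub>L y) (a\<^sup>2) P"
proof -
  have p: "orthproj P" and comm: "y o\<^sub>L P = P o\<^sub>L y" using P by (auto simp: is_gtproj_def)
  have sa: "y u \<bullet> v = u \<bullet> y v" for u v using y by (simp add: posop_def selfadjD)
  let ?Q = "id_blinfun - P"
  have Q: "orthproj ?Q" by (rule orthproj_compl[OF p])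
  have commQ: "y o\<^sub>L ?Q = ?Q o\<^sub>L y" using comm by (simp add: compose_bilinear blinfun_eqI)
  show ?thesis
    unfolding is_gtproj_def
  proof (intro conjI allI impI p)
    show "(y o\<^sub>L y) o\<^sub>L P = P o\<^sub>L (y o\<^sub>L y)"
      by (rule commuteI) (simp add: commute_apply[OF comm])
    fix v
    show "a\<^sup>2 * (v \<bullet> v) < v \<bullet> (y o\<^sub>L y) v" if v: "P v = v \<and> v \<noteq> 0"
    proof -
      have "a * (v \<bullet> v) < v \<bullet> y v" using P v by (simp add: is_gtproj_def)
      also have "\<dots> \<le> norm v * norm (y v)" by (rule norm_cauchy_schwarz)
      finally have "a * norm v < norm (y v)" using v by (simp add: dot_square_norm power2_eq_square)
      then have "(a * norm v)\<^sup>2 < (norm (y v))\<^sup>2" using \<open>0 \<le> a\<close> by (intro power_strict_mono) auto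
      then show ?thesis by (simp add: power_mult_distrib power2_norm_eq_inner sa)
    qed
    show "v \<bullet> (y o\<^sub>L y) v \<le> a\<^sup>2 * (v \<bullet> v)" if v: "P v = 0"
    proof -
      \<comment> \<open>Cutting y down to the kernel of P gives a positive operator bounded by a
        everywhere, to which \<open>posop_square_le\<close> applies.\<close>
      have "posop (y o\<^sub>L ?Q)"
        using orthproj_pcontr[OF Q] by (intro posop_compose y commQ) (simp add: pcontr_def)
      moreover have "u \<bullet> (y o\<^sub>L ?Q) u \<le> a * (u \<bullet> u)" for u
      proof -
        have "u \<bullet> (y o\<^sub>L ?Q) u = u \<bullet> ?Q (y (?Q u))"
          using commute_apply[OF commQ, of "?Q u"] orthproj_idem[OF Q, of u] by simp
        also have "\<dots> = ?Q u \<bullet> y (?Q u)" by (rule orthproj_sa[OF Q, symmetric])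
        also have "\<dots> \<le> a * (?Q u \<bullet> ?Q u)"
          by (rule is_gtproj_le[OF P]) (simp add: op_simps orthproj_idem[OF p])
        also have "\<dots> \<le> a * (u \<bullet> u)"
          using pcontr_norm_le[OF orthproj_pcontr[OF Q], of u] \<open>0 \<le> a\<close>
          by (intro mult_left_mono) (auto simp: norm_le)
        finally show ?thesis .
      qed
      ultimately have "(y o\<^sub>L ?Q) v \<bullet> (y o\<^sub>L ?Q) v \<le> a\<^sup>2 * (v \<bullet> v)"
        using \<open>0 \<le> a\<close> by (intro posop_square_le)
      then show ?thesis using v by (simp add: op_simps sa)
    qed
  qed
qed

text \<open>The half-line projections fix the distribution of every vector state, and its first
  moment is the quadratic form.\<close>

lemma selfadj_eq_of_gtproj:
  fixes x y :: "('a::{real_inner, complete_space}) operator"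
  assumes x: "selfadj x" and y: "selfadj y" and eq: "\<And>a. gtproj x a = gtproj y a"
  shows "x = y"
proof (rule selfadj_eqI[OF x y])
  fix v
  interpret X: spectral_functional x "\<lambda>z. v \<bullet> blinfun_apply z v"
    by (rule spectral_functional_vector_state[OF x])
  interpret Y: spectral_functional y "\<lambda>z. v \<bullet> blinfun_apply z v"
    by (rule spectral_functional_vector_state[OF y])
  have "X.cdf_fun = Y.cdf_fun" by (rule ext) (simp add: X.cdf_fun_def Y.cdf_fun_def eq)
  then have "X.dist_measure = Y.dist_measure" by (simp add: X.dist_measure_def Y.dist_measure_def)
  then show "v \<bullet> x v = v \<bullet> y v" using X.integral_power[of 1] Y.integral_power[of 1] by simp
qed

text \<open>For a >= 0 the half-line projections of y and z are both the projection of the common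
  square above a^2; for a < 0 both are the identity.\<close>

lemma posop_sqrt_unique:
  fixes y z :: "('a::{real_inner, complete_space}) operator"
  assumes y: "posop y" and z: "posop z" and eq: "y o\<^sub>L y = z o\<^sub>L z"
  shows "y = z"
proof (rule selfadj_eq_of_gtproj)
  show sa: "selfadj y" "selfadj z" using y z by (auto simp: posop_def)
  fix a
  show "gtproj y a = gtproj z a"
  proof (cases "0 \<le> a")
    case True
    have "is_gtproj (y o\<^sub>L y) (a\<^sup>2) (gtproj y a)"
      by (rule is_gtproj_square[OF y True is_gtproj_gtproj[OF sa(1)]])
    moreover have "is_gtproj (y o\<^sub>L y) (a\<^sup>2) (gtproj z a)"
      unfolding eq by (rule is_gtproj_square[OF z True is_gtproj_gtproj[OF sa(2)]])
    ultimately show ?thesis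
      using gtproj_unique[of "y o\<^sub>L y"] sa(1) by (metis selfadj_compose)
  next
    case False
    have "is_gtproj w a id_blinfun" if "posop w" for w :: "'a operator"
    proof -
      have "a * (v \<bullet> v) < v \<bullet> w v" if "v \<noteq> 0" for v
      proof -
        have "a * (v \<bullet> v) < 0" using False that by (simp add: mult_less_0_iff)
        also have "0 \<le> v \<bullet> w v" using \<open>posop w\<close> by (simp add: posop_def)
        finally show ?thesis .
      qed
      then show ?thesis by (auto simp: is_gtproj_def orthproj_def intro!: blinfun_eqI)
    qed
    then show ?thesis using gtproj_unique[OF sa(1)] gtproj_unique[OF sa(2)] y z by metis
  qed
qed

lemma bicomm_uminus_eq: "bicomm (- x) = bicomm x"
  using bicomm_trans[of _ "- x" x] bicomm_trans[of _ x "- x"] bicomm_uminus[OF bicomm_self, of x]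
    bicomm_uminus[OF bicomm_self, of "- x"] by auto

context
  fixes s :: "('a::chilbert_space) operator"
  assumes s: "s \<in> bounded_operators" "selfadj s"
begin

text \<open>The operator s times its sign: an explicit |s| that acts as s or -s on the two spectral
  halves, which makes its half-line projections computable.\<close>

definition sgn_abs :: "'a operator" where
  "sgn_abs = (s o\<^sub>L gtproj s 0) - (s o\<^sub>L (id_blinfun - gtproj s 0))"

lemma sgn_abs_bicomm: "sgn_abs \<in> bicomm s"
  unfolding sgn_abs_def
  by (intro bicomm_diff bicomm_compose bicomm_self bicomm_id gtproj_bicomm[OF s(2)])

lemma posop_sgn_abs: "posop sgn_abs" and sgn_abs_square: "sgn_abs o\<^sub>L sgn_abs = s o\<^sub>L s"
proof -
  let ?F = "gtproj s 0"
  have F: "orthproj ?F" by (rule orthproj_gtproj[OF s(2)])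
  have comm: "s (?F v) = ?F (s v)" for v
    by (rule commute_apply[OF bicomm_commute[OF bicomm_self gtproj_bicomm[OF s(2)]]])
  have sa: "s u \<bullet> v = u \<bullet> s v" for u v using s(2) by (rule selfadjD)
  show "sgn_abs o\<^sub>L sgn_abs = s o\<^sub>L s"
    by (rule blinfun_eqI) (simp add: sgn_abs_def op_simps comm orthproj_idem[OF F])
  show "posop sgn_abs"
    unfolding posop_def
  proof (intro conjI allI)
    show "selfadj sgn_abs"
      by (simp add: selfadj_def sgn_abs_def op_simps sa orthproj_sa[OF F] comm)
    fix v
    let ?f = "?F v" and ?g = "v - ?F v"
    have 1: "v \<bullet> sgn_abs v = ?f \<bullet> s ?f - ?g \<bullet> s ?g"
      by (simp add: sgn_abs_def op_simps sa comm orthproj_sa[OF F] orthproj_idem[OF F])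
    have "?F ?f = ?f" "?F ?g = 0" by (simp_all add: op_simps orthproj_idem[OF F])
    then have "?f \<noteq> 0 \<longrightarrow> 0 < ?f \<bullet> s ?f" "?g \<bullet> s ?g \<le> 0"
      using is_gtproj_gtproj[OF s(2), of 0] unfolding is_gtproj_def by (metis mult_zero_left)+
    then show "0 \<le> v \<bullet> sgn_abs v" unfolding 1 by (cases "?f = 0") auto
  qed
qed

lemma op_abs_eq: "op_abs s = sgn_abs"
  unfolding op_abs_def
proof (rule the_equality)
  have adj: "adj s = s" using adj_eq_self_iff s by blast
  have b: "sgn_abs \<in> bounded_operators" by (rule bicomm_bounded[OF sgn_abs_bicomm s(1)])
  show "positive_op sgn_abs \<and> sgn_abs o\<^sub>L sgn_abs = adj s o\<^sub>L s"
    using b posop_sgn_abs sgn_abs_square by (simp add: positive_op_iff adj)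
  show "y = sgn_abs" if "positive_op y \<and> y o\<^sub>L y = adj s o\<^sub>L s" for y
    by (rule posop_sqrt_unique) (use that posop_sgn_abs sgn_abs_square in \<open>simp_all add: positive_op_iff adj\<close>)
qed

text \<open>For r > 0 the projection for s > r lies below that for s > 0, and the one for -s > r is
  orthogonal to it. On their ranges |s| is s and -s respectively, so the sum meets the
  characterisation.\<close>

lemma gtproj_op_abs:
  assumes r: "0 < r"
  shows "gtproj (op_abs s) r = gtproj s r + gtproj (- s) r"
proof -
  let ?F = "gtproj s 0" and ?P = "gtproj s r" and ?Q = "gtproj (- s) r" and ?z = "sgn_abs"
  have ms: "selfadj (- s)" by (rule selfadj_uminus[OF s(2)])
  note gP = is_gtproj_gtproj[OF s(2), of r] and gQ = is_gtproj_gtproj[OF ms, of r]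
    and gF = is_gtproj_gtproj[OF s(2), of 0]
  have F: "orthproj ?F" and P: "orthproj ?P" and Q: "orthproj ?Q"
    using orthproj_gtproj s(2) ms by blast+
  have bc: "?F \<in> bicomm s" "?P \<in> bicomm s" "?Q \<in> bicomm s"
    using gtproj_bicomm[OF s(2)] gtproj_bicomm[OF ms] by (auto simp: bicomm_uminus_eq)
  have PF: "?P (?F v) = ?P v" for v
    using gtproj_compose[OF s(2), of r 0] r by (metis blinfun_apply_blinfun_compose less_eq_real_def max.absorb1)
  have comm: "?F (?P v) = ?P (?F v)" "?F (?Q v) = ?Q (?F v)" "?P (?Q v) = ?Q (?P v)"
    "?z (?P v) = ?P (?z v)" "?z (?Q v) = ?Q (?z v)" "s (?F v) = ?F (s v)" for v
    using bc sgn_abs_bicomm bicomm_self by (auto intro!: commute_apply bicomm_commute[of _ s])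
  have QF: "?Q (?F w) = 0" for w
  proof (rule ccontr)
    let ?v = "?Q (?F w)"
    assume "?v \<noteq> 0"
    moreover have "?Q ?v = ?v" "?F ?v = ?v" by (simp_all add: orthproj_idem[OF Q] orthproj_idem[OF F] comm)
    ultimately have "r * (?v \<bullet> ?v) < ?v \<bullet> (- s) ?v" "0 * (?v \<bullet> ?v) < ?v \<bullet> s ?v"
      using gQ gF unfolding is_gtproj_def by blast+
    moreover have "0 \<le> r * (?v \<bullet> ?v)" using r by simp
    ultimately show False by (simp add: op_simps)
  qed
  have PQ: "?P (?Q v) = 0" for v
    using PF[of "?Q v"] QF[of v] comm(2)[of v] by (simp add: op_simps)
  have QP: "?Q (?P v) = 0" for v using PQ comm(3) by simp
  have zP: "?z p = s p" if "?F p = p" for p using that by (simp add: sgn_abs_def op_simps)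
  have zQ: "?z q = - s q" if "?F q = 0" for q using that by (simp add: sgn_abs_def op_simps)
  have sa: "s u \<bullet> v = u \<bullet> s v" for u v using s(2) by (rule selfadjD)
  have "is_gtproj ?z r (?P + ?Q)"
    unfolding is_gtproj_def
  proof (intro conjI allI impI)
    have "?P o\<^sub>L ?Q = 0" by (rule blinfun_eqI) (simp add: PQ)
    then show "orthproj (?P + ?Q)" by (rule orthproj_add[OF P Q])
    show "?z o\<^sub>L (?P + ?Q) = (?P + ?Q) o\<^sub>L ?z"
      by (rule commuteI) (simp add: op_simps comm)
    fix v
    show "r * (v \<bullet> v) < v \<bullet> ?z v" if v: "(?P + ?Q) v = v \<and> v \<noteq> 0"
    proof -
      let ?p = "?P v" and ?q = "?Q v"
      have vpq: "v = ?p + ?q" using v by (simp add: op_simps)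
      have pq: "?p \<bullet> ?q = 0" using orthproj_sa[OF P, of v ?q] by (simp add: PQ)
      have "?F ?p = ?p" by (simp add: comm PF)
      then have zp: "?z ?p = s ?p" by (rule zP)
      have "?F ?q = 0" by (simp add: comm QF)
      then have zq: "?z ?q = - s ?q" by (rule zQ)
      have "?p \<bullet> ?z ?q = 0" "?q \<bullet> ?z ?p = 0"
        using orthproj_sa[OF P, of v "?z ?q"] orthproj_sa[OF Q, of v "?z ?p"]
        by (simp_all add: PQ QP op_simps flip: comm(4,5))
      then have "(?p + ?q) \<bullet> ?z (?p + ?q) = ?p \<bullet> s ?p + ?q \<bullet> (- s) ?q"
        by (simp add: inner_simps blinfun.add_right zp zq blinfun.minus_left)
      with arg_cong[OF vpq, of "\<lambda>w. w \<bullet> ?z w"]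
      have "v \<bullet> ?z v = ?p \<bullet> s ?p + ?q \<bullet> (- s) ?q" by (rule trans)
      moreover have "(?p + ?q) \<bullet> (?p + ?q) = ?p \<bullet> ?p + ?q \<bullet> ?q"
        using pq inner_commute[of ?p ?q] by (simp add: inner_simps)
      with arg_cong[OF vpq, of "\<lambda>w. w \<bullet> w"] have "v \<bullet> v = ?p \<bullet> ?p + ?q \<bullet> ?q" by (rule trans)
      moreover have "?p \<noteq> 0 \<longrightarrow> r * (?p \<bullet> ?p) < ?p \<bullet> s ?p" "?q \<noteq> 0 \<longrightarrow> r * (?q \<bullet> ?q) < ?q \<bullet> (- s) ?q"
        using gP gQ orthproj_idem[OF P, of v] orthproj_idem[OF Q, of v] unfolding is_gtproj_def by blast+
      moreover have "?p \<noteq> 0 \<or> ?q \<noteq> 0" using vpq v by auto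
      ultimately show ?thesis
        by (cases "?p = 0"; cases "?q = 0") (auto simp: distrib_left blinfun.zero_right)
    qed
    show "v \<bullet> ?z v \<le> r * (v \<bullet> v)" if v: "(?P + ?Q) v = 0"
    proof -
      have "?P v = ?P ((?P + ?Q) v)" "?Q v = ?Q ((?P + ?Q) v)"
        by (simp_all add: op_simps PQ QP orthproj_idem[OF P] orthproj_idem[OF Q])
      then have pv: "?P v = 0" "?Q v = 0" using v by (simp_all add: blinfun.zero_right)
      \<comment> \<open>On the kernel the splitting is by the sign of s: each half has a one-sided
        bound by r, and |s| leaves both halves invariant.\<close>
      let ?f = "?F v" and ?g = "v - ?F v"
      have "?P ?f = 0" using pv PF by simp
      moreover have "?Q ?g = 0" using pv QF by (simp add: op_simps)
      ultimately have le: "?f \<bullet> s ?f \<le> r * (?f \<bullet> ?f)" "?g \<bullet> (- s) ?g \<le> r * (?g \<bullet> ?g)"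
        by (auto intro!: is_gtproj_le[OF gP] is_gtproj_le[OF gQ] simp del: blinfun.minus_left)
      have "v \<bullet> ?z v = ?f \<bullet> s ?f + ?g \<bullet> (- s) ?g"
        by (simp add: sgn_abs_def op_simps sa comm orthproj_sa[OF F] orthproj_idem[OF F])
      moreover have "v \<bullet> v = ?f \<bullet> ?f + ?g \<bullet> ?g"
        using orthproj_inner[OF F, of v] inner_commute[of "?F v" v] by (simp add: inner_simps)
      ultimately show ?thesis using le by (simp add: distrib_left)
    qed
  qed
  moreover have "selfadj ?z" using posop_sgn_abs by (simp add: posop_def)
  ultimately show ?thesis unfolding op_abs_eq by (intro gtproj_unique[symmetric])
qed

end

section \<open>Tracial von Neumann algebras\<close>

lemma commutant_closed:
  "id_blinfun \<in> commutant S"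
  "a \<in> commutant S \<Longrightarrow> b \<in> commutant S \<Longrightarrow> a + b \<in> commutant S"
  "a \<in> commutant S \<Longrightarrow> b \<in> commutant S \<Longrightarrow> a - b \<in> commutant S"
  by (auto simp: commutant_def bounded_operators_iff compose_bilinear)

lemma commutant_compose:
  assumes "a \<in> commutant S" "b \<in> commutant S" shows "a o\<^sub>L b \<in> commutant S"
proof -
  have *: "x o\<^sub>L (a o\<^sub>L b) = (a o\<^sub>L b) o\<^sub>L x" if "x o\<^sub>L a = a o\<^sub>L x" "x o\<^sub>L b = b o\<^sub>L x" for x
    by (rule commuteI) (simp add: commute_apply[OF that(1)] commute_apply[OF that(2)])
  have "a o\<^sub>L b \<in> bounded_operators"
    using assms by (simp add: commutant_def bounded_operators_def)
  with * assms show ?thesis by (simp add: commutant_def)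
qed

lemma vN_closed:
  assumes "von_neumann_algebra N"
  shows "id_blinfun \<in> N"
    and "a \<in> N \<Longrightarrow> b \<in> N \<Longrightarrow> a + b \<in> N"
    and "a \<in> N \<Longrightarrow> b \<in> N \<Longrightarrow> a - b \<in> N"
    and "a \<in> N \<Longrightarrow> b \<in> N \<Longrightarrow> a o\<^sub>L b \<in> N"
proof -
  have "commutant (commutant N) = N" using assms by (simp add: von_neumann_algebra_def)
  then show "id_blinfun \<in> N"
    and "a \<in> N \<Longrightarrow> b \<in> N \<Longrightarrow> a + b \<in> N"
    and "a \<in> N \<Longrightarrow> b \<in> N \<Longrightarrow> a - b \<in> N"
    and "a \<in> N \<Longrightarrow> b \<in> N \<Longrightarrow> a o\<^sub>L b \<in> N"
    using commutant_closed[where S = "commutant N"] commutant_compose[of _ "commutant N"] by auto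
qed

lemma vN_generated_closed:
  "id_blinfun \<in> vN_generated S"
  "a \<in> vN_generated S \<Longrightarrow> b \<in> vN_generated S \<Longrightarrow> a + b \<in> vN_generated S"
  "a \<in> vN_generated S \<Longrightarrow> b \<in> vN_generated S \<Longrightarrow> a - b \<in> vN_generated S"
  "a \<in> vN_generated S \<Longrightarrow> b \<in> vN_generated S \<Longrightarrow> a o\<^sub>L b \<in> vN_generated S"
  "a \<in> S \<Longrightarrow> a \<in> vN_generated S"
  "a \<in> vN_generated S \<Longrightarrow> bicomm a \<subseteq> vN_generated S"
  "von_neumann_algebra N \<Longrightarrow> S \<subseteq> N \<Longrightarrow> vN_generated S \<subseteq> N"
  using bicomm_subset_vN by (auto simp: vN_generated_def vN_closed)

lemma vN_generated_sum:
  "(\<And>i. i \<in> I \<Longrightarrow> f i \<in> vN_generated S) \<Longrightarrow> sum f I \<in> vN_generated S"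
proof (induction I rule: infinite_finite_induct)
  case (insert i I) then show ?case by (simp add: vN_generated_closed(2))
qed (use vN_generated_closed(3)[OF vN_generated_closed(1) vN_generated_closed(1)] in auto)

lemma opow_uminus: "opow (- x) m = (- 1) ^ m *\<^sub>R opow x m"
  by (induction m) (simp_all add: compose_bilinear)

lemma opow_commute:
  fixes x :: "('a::real_inner) operator"
  shows "opow x m o\<^sub>L x = x o\<^sub>L opow x m"
  by (rule bicomm_commute[of _ x]) (intro opow_bicomm bicomm_self)+

lemma opow_commute_of_commute:
  fixes x :: "('a::real_inner) operator"
  shows "x o\<^sub>L y = y o\<^sub>L x \<Longrightarrow> opow y m o\<^sub>L x = x o\<^sub>L opow y m"
  using bicommD[OF opow_bicomm[OF bicomm_self[of y]], of x m] by simp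

context tracial_von_neumann_algebra
begin

lemmas M_closed = vN_closed[OF von_neumann_algebra]

lemma M_bounded: "x \<in> M \<Longrightarrow> x \<in> bounded_operators"
  using von_neumann_algebra by (auto simp: von_neumann_algebra_def)

lemma M_bicomm: "x \<in> M \<Longrightarrow> z \<in> bicomm x \<Longrightarrow> z \<in> M"
  using bicomm_subset_vN[OF von_neumann_algebra] by blast

lemma M_uminus: "x \<in> M \<Longrightarrow> - x \<in> M"
  using M_bicomm bicomm_uminus[OF bicomm_self] by blast

lemma tr_scaleR: "x \<in> M \<Longrightarrow> tr (c *\<^sub>R x) = of_real c * tr x"
  using tr_scaleC[of x "of_real c"] by (simp add: scaleC_op_of_real)

lemma tr_zero: "tr 0 = 0"
  using tr_scaleR[OF M_closed(1), of 0] by simp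

lemma tr_diff: "x \<in> M \<Longrightarrow> y \<in> M \<Longrightarrow> tr (x - y) = tr x - tr y"
  using tr_add[of "x - y" y] M_closed(3)[of x y] by simp

lemma tr_nonneg: "x \<in> M \<Longrightarrow> posop x \<Longrightarrow> 0 \<le> Re (tr x) \<and> Im (tr x) = 0"
  using tr_positive[of x] M_bounded[of x] by (simp add: positive_op_iff complex_nonneg_Reals_iff)

lemma tr_mono: "x \<in> M \<Longrightarrow> y \<in> M \<Longrightarrow> posop (y - x) \<Longrightarrow> Re (tr x) \<le> Re (tr y)"
  using tr_nonneg[of "y - x"] by (simp add: M_closed tr_diff)

text \<open>\<open>norm x *\<^sub>R id_blinfun - x\<close> is positive, so x is a difference of
  positive elements, on which the trace is real.\<close>

lemma tr_selfadj_real: assumes "x \<in> M" "selfadj x" shows "Im (tr x) = 0"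
proof -
  have n: "norm x *\<^sub>R id_blinfun \<in> M"
    by (rule M_bicomm[OF M_closed(1)]) (intro bicomm_scaleR bicomm_self)
  have "posop (norm x *\<^sub>R id_blinfun - x)"
    unfolding posop_def
  proof (intro conjI allI)
    show "selfadj (norm x *\<^sub>R id_blinfun - x)" by (intro selfadj_diff selfadj_scaleR selfadj_id assms)
    show "0 \<le> v \<bullet> (norm x *\<^sub>R id_blinfun - x) v" for v
      using inner_apply_le[of v x] by (simp add: op_simps)
  qed
  then have "Im (tr (norm x *\<^sub>R id_blinfun - x)) = 0"
    using tr_nonneg M_closed(3)[OF n assms(1)] by blast
  then show ?thesis using tr_diff[OF n assms(1)] by (simp add: tr_scaleR[OF M_closed(1)] tr_unit)
qed

lemma M_gtproj: "x \<in> M \<Longrightarrow> selfadj x \<Longrightarrow> gtproj x a \<in> M"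
  using M_bicomm gtproj_bicomm by blast

lemma tr_faithful_posop: "x \<in> M \<Longrightarrow> posop x \<Longrightarrow> Re (tr x) = 0 \<Longrightarrow> x = 0"
  using tr_faithful[of x] tr_nonneg[of x] M_bounded[of x] by (simp add: positive_op_iff complex_eq_iff)

text \<open>Normality enters here. \<open>gtproj y t\<close> is the least upper bound of the
  projections at t + 1/(n+1), because a bound on their forms survives the strong limit; this gives
  the right continuity that a distribution function must have.\<close>

lemma spectral_functional_trace:
  assumes y: "y \<in> M" "selfadj y" shows "spectral_functional y (\<lambda>z. Re (tr z))"
proof
  note inM = M_bicomm[OF y(1)]
  show "selfadj y" by fact
  show "Re (tr (a + b)) = Re (tr a) + Re (tr b)" if "a \<in> bicomm y" "b \<in> bicomm y" for a b
    using that by (simp add: inM tr_add)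
  show "Re (tr (c *\<^sub>R a)) = c * Re (tr a)" if "a \<in> bicomm y" for a c
    using that by (simp add: inM tr_scaleR)
  show "0 \<le> Re (tr a)" if "a \<in> bicomm y" "posop a" for a using that tr_nonneg inM by blast
  fix t
  let ?P = "\<lambda>n. gtproj y (t + 1 / real (Suc n))"
  have sa_part: "gtproj y a \<in> sa_part M" for a
    using M_gtproj[OF y, of a] adj_eq_self_iff[OF M_bounded, of "gtproj y a"]
      orthproj_selfadj[OF orthproj_gtproj[OF y(2)]] by (auto simp: sa_part_def)
  have op_leI: "op_le a b"
    if "a \<in> sa_part M" "b \<in> sa_part M" "\<And>v. v \<bullet> a v \<le> v \<bullet> b v" for a b
  proof -
    have "selfadj a" "selfadj b" "b - a \<in> bounded_operators"
      using that(1,2) M_bounded adj_eq_self_iff by (auto simp: sa_part_def intro!: bounded_operators_diff)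
    then show ?thesis using that(3) by (simp add: op_le_def positive_op_iff posop_def selfadj_diff op_simps)
  qed
  have le: "v \<bullet> gtproj y b v \<le> v \<bullet> gtproj y a v" if "a \<le> b" for a b v
    by (rule gtproj_mono[OF y(2) that])
  have width: "1 / real (Suc n) \<le> 1 / real (Suc m)" if "m \<le> n" for m n
    using that by (simp add: frac_le)
  have inc: "v \<bullet> ?P m v \<le> v \<bullet> ?P n v" if "m \<le> n" for m n v
    using width[OF that] by (intro le) simp
  have "Re (tr (gtproj y t)) = (SUP a\<in>range ?P. Re (tr a))"
  proof (rule tr_normal)
    show "range ?P \<subseteq> sa_part M" using sa_part by blast
    show "range ?P \<noteq> {}" by simp
    show "\<forall>a\<in>range ?P. \<forall>b\<in>range ?P. \<exists>c\<in>range ?P. op_le a c \<and> op_le b c"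
    proof (intro ballI)
      fix a b assume "a \<in> range ?P" "b \<in> range ?P"
      then obtain m n where "a = ?P m" "b = ?P n" by blast
      then show "\<exists>c\<in>range ?P. op_le a c \<and> op_le b c"
        using inc[of m "max m n"] inc[of n "max m n"] sa_part
        by (intro bexI[of _ "?P (max m n)"]) (auto intro!: op_leI)
    qed
    show "gtproj y t \<in> sa_part M" by (rule sa_part)
    show "\<forall>a\<in>range ?P. op_le a (gtproj y t)"
      using sa_part le by (auto intro!: op_leI)
    show "\<forall>s\<in>sa_part M. (\<forall>a\<in>range ?P. op_le a s) \<longrightarrow> op_le (gtproj y t) s"
    proof (intro ballI impI)
      fix s assume s: "s \<in> sa_part M" and ub: "\<forall>a\<in>range ?P. op_le a s"
      show "op_le (gtproj y t) s"
      proof (rule op_leI[OF sa_part s])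
        fix v
        have "(\<lambda>n. v \<bullet> ?P n v) \<longlonglongrightarrow> v \<bullet> gtproj y t v"
          by (rule tendsto_inner[OF tendsto_const gtproj_right_cont[OF y(2)]])
        moreover have "v \<bullet> ?P n v \<le> v \<bullet> s v" for n
        proof -
          have "posop (s - ?P n)" using ub by (simp add: op_le_def positive_op_iff)
          then show ?thesis by (simp add: posop_def op_simps)
        qed
        ultimately show "v \<bullet> gtproj y t v \<le> v \<bullet> s v" by (intro LIMSEQ_le_const2) auto
      qed
    qed
  qed
  moreover have "(\<lambda>n. Re (tr (?P n))) \<longlonglongrightarrow> (SUP n. Re (tr (?P n)))"
  proof (rule LIMSEQ_incseq_SUP)
    have mono: "Re (tr (gtproj y b)) \<le> Re (tr (gtproj y a))" if "a \<le> b" for a b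
    proof (rule tr_mono[OF M_gtproj[OF y] M_gtproj[OF y]])
      show "posop (gtproj y a - gtproj y b)"
        using le[OF that] orthproj_selfadj[OF orthproj_gtproj[OF y(2)]]
        by (simp add: posop_def selfadj_diff op_simps)
    qed
    show "bdd_above (range (\<lambda>n. Re (tr (?P n))))"
      using mono by (intro bdd_aboveI[of _ "Re (tr (gtproj y t))"]) auto
    show "incseq (\<lambda>n. Re (tr (?P n)))"
      using width by (auto simp: incseq_def intro!: mono)
  qed
  ultimately show "(\<lambda>n. Re (tr (?P n))) \<longlonglongrightarrow> Re (tr (gtproj y t))" by (simp add: image_image)
qed

section \<open>Odd moments, medians and sums of commuting independent variables\<close>

definition odd_moments_zero :: "'a operator \<Rightarrow> bool" where
  "odd_moments_zero y \<longleftrightarrow> (\<forall>m. odd m \<longrightarrow> tr (opow y m) = 0)"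

lemma M_opow: "y \<in> M \<Longrightarrow> opow y m \<in> M"
  using M_bicomm opow_bicomm[OF bicomm_self] by blast

lemma tr_opow_uminus: "y \<in> M \<Longrightarrow> tr (opow (- y) m) = (- 1) ^ m * tr (opow y m)"
  using tr_scaleR[OF M_opow, of y "(- 1) ^ m" m] by (simp add: opow_uminus)

lemma odd_moments_zero_uminus: "y \<in> M \<Longrightarrow> odd_moments_zero y \<Longrightarrow> odd_moments_zero (- y)"
  by (simp add: odd_moments_zero_def tr_opow_uminus)

lemma symmetric_rv_M: assumes "symmetric_rv M tr x" shows "x \<in> M" "selfadj x"
  using assms adj_eq_self_iff[OF M_bounded] by (auto simp: symmetric_rv_def sa_part_def)

text \<open>Equal half-line traces give x and -x the same distribution, hence the same moments,
  while odd powers change sign.\<close>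

lemma symmetric_rv_odd_moments_zero:
  assumes "symmetric_rv M tr x" shows "odd_moments_zero x"
proof -
  note x = symmetric_rv_M[OF assms]
  have mx: "- x \<in> M" "selfadj (- x)" using x by (auto intro: M_uminus selfadj_uminus)
  have eq: "tr (gtproj x a) = tr (gtproj (- x) a)" for a
  proof -
    have "complex_of_real ` {a<..} \<in> sets borel" by (rule image_greaterThan_borel)
    then have "tr (real_spectral_projection {a<..} x) = tr (real_spectral_projection {a<..} (- x))"
      using assms by (simp add: symmetric_rv_def identically_distributed_def real_spectral_projection_def)
    then show ?thesis using x mx by (simp add: real_spectral_projection_eq M_bounded)
  qed
  interpret X: spectral_functional x "\<lambda>z. Re (tr z)" by (rule spectral_functional_trace[OF x])
  interpret Y: spectral_functional "- x" "\<lambda>z. Re (tr z)" by (rule spectral_functional_trace[OF mx])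
  have "X.cdf_fun = Y.cdf_fun" by (rule ext) (simp add: X.cdf_fun_def Y.cdf_fun_def eq)
  then have "X.dist_measure = Y.dist_measure" by (simp add: X.dist_measure_def Y.dist_measure_def)
  then have "Re (tr (opow x m)) = Re (tr (opow (- x) m))" for m
    using X.integral_power[of m] Y.integral_power[of m] by simp
  then have re: "Re (tr (opow x m)) = Re (tr (opow (- x) m))" for m .
  have "Re (tr (opow x m)) = 0" if "odd m" for m
    using that re[of m] by (simp add: tr_opow_uminus[OF x(1)])
  then show ?thesis
    using tr_selfadj_real[OF M_opow[OF x(1)] X.selfadj_opow[OF x(2)]]
    by (simp add: odd_moments_zero_def complex_eq_iff)
qed

text \<open>All moments of y and -y agree, so {y > 0} and {-y > 0} have the same trace; being
  orthogonal, they share a total of at most 1.\<close>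

lemma odd_moments_zero_median:
  assumes y: "y \<in> M" "selfadj y" and odd: "odd_moments_zero y"
  shows "Re (tr (gtproj y 0)) \<le> 1 / 2"
proof -
  have my: "- y \<in> M" "selfadj (- y)" using y by (auto intro: M_uminus selfadj_uminus)
  interpret X: spectral_functional y "\<lambda>z. Re (tr z)" by (rule spectral_functional_trace[OF y])
  interpret Y: spectral_functional "- y" "\<lambda>z. Re (tr z)" by (rule spectral_functional_trace[OF my])
  have mom: "tr (opow y m) = tr (opow (- y) m)" for m
    using odd by (cases "odd m") (auto simp: odd_moments_zero_def tr_opow_uminus[OF y(1)])
  obtain K where K: "norm y < K" using gt_ex by blast
  have "measure X.dist_measure {0<..} = measure Y.dist_measure {0<..}"
  proof (rule measure_greaterThan_eq_of_moments)
    show "finite_measure X.dist_measure" "finite_measure Y.dist_measure"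
      by (rule X.dist.finite_measure_axioms Y.dist.finite_measure_axioms)+
    show "AE t in X.dist_measure. \<bar>t\<bar> \<le> K" by (rule eventually_mono[OF X.AE_bounded[OF K]]) auto
    show "AE t in Y.dist_measure. \<bar>t\<bar> \<le> K"
      by (rule eventually_mono[OF Y.AE_bounded]) (use K in auto)
    show "(\<integral>t. t ^ m \<partial>X.dist_measure) = (\<integral>t. t ^ m \<partial>Y.dist_measure)" for m
      by (simp add: X.integral_power Y.integral_power mom)
  qed simp_all
  then have eq: "Re (tr (gtproj y 0)) = Re (tr (gtproj (- y) 0))"
    by (simp add: X.measure_greaterThan Y.measure_greaterThan)
  let ?P = "gtproj y 0" and ?Q = "gtproj (- y) 0"
  note gP = is_gtproj_gtproj[OF y(2), of 0] and gQ = is_gtproj_gtproj[OF my(2), of 0]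
  have P: "orthproj ?P" and Q: "orthproj ?Q" using orthproj_gtproj y my by blast+
  have comm: "?P (?Q v) = ?Q (?P v)" for v
    using gtproj_bicomm[OF y(2)] gtproj_bicomm[OF my(2)]
    by (auto intro!: commute_apply bicomm_commute[of _ y] simp: bicomm_uminus_eq)
  have "?P o\<^sub>L ?Q = 0"
  proof (rule blinfun_eqI, rule ccontr)
    fix w
    let ?v = "?P (?Q w)"
    assume "(?P o\<^sub>L ?Q) w \<noteq> blinfun_apply 0 w"
    then have "?v \<noteq> 0" by simp
    moreover have "?P ?v = ?v" "?Q ?v = ?v"
      by (simp_all add: orthproj_idem[OF P], simp add: comm orthproj_idem[OF Q])
    ultimately have "0 * (?v \<bullet> ?v) < ?v \<bullet> y ?v" "0 * (?v \<bullet> ?v) < ?v \<bullet> (- y) ?v"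
      by (intro is_gtproj_less[OF gP] is_gtproj_less[OF gQ]; simp)+
    then show False by (simp add: op_simps)
  qed
  then have "orthproj (?P + ?Q)" by (rule orthproj_add[OF P Q])
  then have "posop (id_blinfun - (?P + ?Q))" by (rule orthproj_posop[OF orthproj_compl])
  then have "Re (tr (?P + ?Q)) \<le> Re (tr id_blinfun)"
    using y my by (intro tr_mono M_closed M_gtproj)
  then show ?thesis using eq y my by (simp add: tr_add tr_unit M_gtproj)
qed

lemma odd_moments_zero_add:
  assumes M: "a \<in> M" "b \<in> M" and comm: "a o\<^sub>L b = b o\<^sub>L a"
    and indep: "\<And>i j. tr (opow a i o\<^sub>L opow b j) = tr (opow a i) * tr (opow b j)"
    and odd: "odd_moments_zero a" "odd_moments_zero b"
  shows "odd_moments_zero (a + b)"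
proof -
  \<comment> \<open>The factors a^i b^j absorb the terms split off from (a + b)^m one at a time, so
    the induction stands in for the binomial expansion. At m = 0 one of i and j is odd.\<close>
  have "odd (m + i + j) \<Longrightarrow> tr (opow a i o\<^sub>L opow b j o\<^sub>L opow (a + b) m) = 0" for m i j
  proof (induction m arbitrary: i j)
    case 0
    then have "odd i \<or> odd j" by auto
    then show ?case using odd indep[of i j] by (auto simp: odd_moments_zero_def)
  next
    case (Suc m)
    have ca: "opow b j o\<^sub>L a = a o\<^sub>L opow b j" by (rule opow_commute_of_commute[OF comm])
    have c1: "opow a i (a v) = a (opow a i v)" "opow b j (b v) = b (opow b j v)"
      "opow b j (a v) = a (opow b j v)" for v
      using commute_apply[OF opow_commute] commute_apply[OF ca] by blast+
    have "opow a i o\<^sub>L opow b j o\<^sub>L opow (a + b) (Suc m)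
        = (opow a (Suc i) o\<^sub>L opow b j o\<^sub>L opow (a + b) m) + (opow a i o\<^sub>L opow b (Suc j) o\<^sub>L opow (a + b) m)"
      by (rule blinfun_eqI) (simp add: op_simps c1)
    moreover have "tr (opow a (Suc i) o\<^sub>L opow b j o\<^sub>L opow (a + b) m) = 0"
      "tr (opow a i o\<^sub>L opow b (Suc j) o\<^sub>L opow (a + b) m) = 0"
      using Suc.prems by (intro Suc.IH; simp)+
    moreover have "opow a i o\<^sub>L opow b j o\<^sub>L opow (a + b) m \<in> M" for i j
      by (intro M_closed(4) M_opow M_closed(2) M)
    ultimately show ?case by (simp add: tr_add del: opow.simps)
  qed
  from this[of _ 0 0] show ?thesis by (simp add: odd_moments_zero_def)
qed

text \<open>By independence the conditional expectation of \<open>s + y\<close> onto \<open>N\<close> is \<open>y\<close> plus a scalar. It commutes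
  with \<open>a\<close> because \<open>s + y\<close> does, which the trace expresses without constructing the expectation.\<close>

lemma commute_of_indep_sum:
  assumes N: "N \<subseteq> M" "\<And>b c. b \<in> N \<Longrightarrow> c \<in> N \<Longrightarrow> b o\<^sub>L c \<in> N" "\<And>b c. b \<in> N \<Longrightarrow> c \<in> N \<Longrightarrow> b - c \<in> N"
    and s: "s \<in> M" and y: "y \<in> N" "selfadj y" and a: "a \<in> N" "selfadj a"
    and indep: "\<And>b. b \<in> N \<Longrightarrow> tr (s o\<^sub>L b) = tr s * tr b"
    and comm: "(s + y) o\<^sub>L a = a o\<^sub>L (s + y)"
  shows "y o\<^sub>L a = a o\<^sub>L y"
proof -
  \<comment> \<open>The commutator of two self-adjoint operators is skew, so -z^2 is positive.
    Faithfulness reduces the claim to \<open>tr (z o\<^sub>L z) = 0\<close>.\<close>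
  define z where "z = (y o\<^sub>L a) - (a o\<^sub>L y)"
  have z: "z \<in> N" unfolding z_def by (intro N y a)
  note NM = subsetD[OF N(1)]
  have split: "tr (w o\<^sub>L (s + y)) = tr s * tr w + tr (w o\<^sub>L y)" if w: "w \<in> N" for w
  proof -
    have "tr (w o\<^sub>L (s + y)) = tr (w o\<^sub>L s) + tr (w o\<^sub>L y)"
      using w s y NM by (simp add: compose_bilinear tr_add M_closed(4))
    then show ?thesis using tr_commute[of w s] indep[OF w] w s NM by simp
  qed
  \<comment> \<open>Cyclicity lets a pass around because it commutes with s + y. The terms with
    \<open>tr s\<close> then cancel, leaving the same identity with y in place of s + y.\<close>
  have "tr (z o\<^sub>L a o\<^sub>L (s + y)) = tr (a o\<^sub>L z o\<^sub>L (s + y))"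
  proof -
    have "z o\<^sub>L a o\<^sub>L (s + y) = (z o\<^sub>L (s + y)) o\<^sub>L a" using comm by (simp add: compose_assoc)
    moreover have "z o\<^sub>L (s + y) \<in> M" "a \<in> M" using z s y a NM by (auto intro!: M_closed)
    ultimately show ?thesis using tr_commute[of "z o\<^sub>L (s + y)" a] by (simp add: compose_assoc)
  qed
  moreover have "tr (z o\<^sub>L a) = tr (a o\<^sub>L z)" using z a NM by (intro tr_commute) auto
  ultimately have "tr (z o\<^sub>L a o\<^sub>L y) = tr (a o\<^sub>L z o\<^sub>L y)"
    using split[of "z o\<^sub>L a"] split[of "a o\<^sub>L z"] z a by (simp add: N)
  also have "\<dots> = tr (z o\<^sub>L y o\<^sub>L a)"
    using tr_commute[of a "z o\<^sub>L y"] z a y NM by (simp add: compose_assoc M_closed(4))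
  finally have eq: "tr (z o\<^sub>L a o\<^sub>L y) = tr (z o\<^sub>L y o\<^sub>L a)" .
  have "tr (z o\<^sub>L z) = 0"
  proof -
    have "z o\<^sub>L z = (z o\<^sub>L y o\<^sub>L a) - (z o\<^sub>L a o\<^sub>L y)"
      by (subst (2) z_def) (simp add: compose_bilinear compose_assoc)
    then show ?thesis using eq z a y NM by (simp add: tr_diff M_closed(4))
  qed
  have anti: "z u \<bullet> v = - (u \<bullet> z v)" for u v
    by (simp add: z_def op_simps selfadjD[OF a(2)] selfadjD[OF y(2)])
  have mz: "- (z o\<^sub>L z) \<in> M" using z NM by (intro M_uminus M_closed(4)) auto
  moreover have "posop (- (z o\<^sub>L z))"
    unfolding posop_def selfadj_def
  proof (intro conjI allI)
    show "(- (z o\<^sub>L z)) u \<bullet> v = u \<bullet> (- (z o\<^sub>L z)) v" for u v by (simp add: op_simps anti)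
    show "0 \<le> v \<bullet> (- (z o\<^sub>L z)) v" for v
      using anti[of v "z v"] inner_ge_zero[of "z v"] by (simp add: op_simps)
  qed
  moreover have "tr (- (z o\<^sub>L z)) = 0"
    using tr_scaleR[of "z o\<^sub>L z" "- 1"] \<open>tr (z o\<^sub>L z) = 0\<close> z NM by (simp add: M_closed(4))
  ultimately have 0: "- (z o\<^sub>L z) = 0" by (intro tr_faithful_posop) auto
  have "z (z v) = 0" for v using arg_cong[OF 0, of "\<lambda>T. blinfun_apply T v"] by (simp add: op_simps)
  then have "z v = 0" for v using anti[of v "z v"] by simp
  then have "z = 0" by (simp add: blinfun_eqI)
  then show ?thesis by (simp add: z_def)
qed

lemma levy_indep_sum:
  assumes s: "s \<in> M" "selfadj s" and y: "y \<in> M" "selfadj y" and comm: "s o\<^sub>L y = y o\<^sub>L s"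
    and indep: "\<And>a b. a \<in> bicomm s \<Longrightarrow> b \<in> bicomm y \<Longrightarrow> tr (a o\<^sub>L b) = tr a * tr b"
    and odd: "odd_moments_zero y"
  shows "Re (tr (gtproj s r)) \<le> 2 * Re (tr (gtproj (s + y) r))"
proof -
  have my: "- y \<in> M" "selfadj (- y)" using y by (auto intro: M_uminus selfadj_uminus)
  have sy: "s + y \<in> M" "selfadj (s + y)" using s y by (auto intro: M_closed selfadj_add)
  let ?P = "gtproj s r" and ?Q' = "gtproj (- y) 0" and ?R = "gtproj (s + y) r"
  \<comment> \<open>The event y >= 0, as the complement of -y > 0: an atom at 0 must be counted for
    its trace to be at least 1/2.\<close>
  let ?Q = "id_blinfun - ?Q'"
  have P: "orthproj ?P" and Q': "orthproj ?Q'" and R: "orthproj ?R"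
    using orthproj_gtproj s my sy by blast+
  have Q: "orthproj ?Q" by (rule orthproj_compl[OF Q'])
  have bP: "?P \<in> bicomm s" and bR: "?R \<in> bicomm (s + y)" using gtproj_bicomm s sy by blast+
  have bQ: "?Q \<in> bicomm y"
    using gtproj_bicomm[OF my(2)] by (intro bicomm_diff bicomm_id) (simp add: bicomm_uminus_eq)
  have "(s + y) o\<^sub>L s = s o\<^sub>L (s + y)" "(s + y) o\<^sub>L y = y o\<^sub>L (s + y)" using comm by (simp_all add: compose_bilinear)
  from bicommD[OF bP this(1)] bicommD[OF bQ this(2)]
  have PR: "?P o\<^sub>L ?R = ?R o\<^sub>L ?P" and QR: "?Q o\<^sub>L ?R = ?R o\<^sub>L ?Q"
    using bicommD[OF bR, of ?P] bicommD[OF bR, of ?Q] by auto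
  have "y o\<^sub>L ?P = ?P o\<^sub>L y" by (rule bicommD[OF bP]) (rule comm[symmetric])
  then have PQ: "?P o\<^sub>L ?Q = ?Q o\<^sub>L ?P" using bicommD[OF bQ, of ?P] by simp
  \<comment> \<open>A nonzero difference would be a vector with the form of s above r, that of y
    nonnegative and that of s + y at most r.\<close>
  have key: "?P (?Q (?R w)) = ?P (?Q w)" for w
  proof (rule ccontr)
    let ?v = "?P (?Q w) - ?P (?Q (?R w))"
    assume "?P (?Q (?R w)) \<noteq> ?P (?Q w)"
    then have nz: "?v \<noteq> 0" by simp
    note c = commute_apply[OF PR] commute_apply[OF QR] commute_apply[OF PQ]
    have Pv: "?P ?v = ?v" by (simp only: blinfun.diff_right orthproj_idem[OF P])
    have "?Q ?v = ?v" by (simp only: blinfun.diff_right c(3)[symmetric] orthproj_idem[OF Q])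
    then have Qv: "?Q' ?v = 0" by (simp only: blinfun.diff_left blinfun_apply_id_blinfun) simp
    have Rv: "?R ?v = 0"
      by (simp only: blinfun.diff_right c(1,2)[symmetric] orthproj_idem[OF R]) simp
    have "r * (?v \<bullet> ?v) < ?v \<bullet> s ?v" by (rule is_gtproj_less[OF is_gtproj_gtproj[OF s(2)] Pv nz])
    moreover have "?v \<bullet> (- y) ?v \<le> 0 * (?v \<bullet> ?v)"
      by (rule is_gtproj_le[OF is_gtproj_gtproj[OF my(2)] Qv])
    moreover have "?v \<bullet> (s + y) ?v \<le> r * (?v \<bullet> ?v)"
      by (rule is_gtproj_le[OF is_gtproj_gtproj[OF sy(2)] Rv])
    ultimately show False
      by (simp only: blinfun.add_left blinfun.minus_left inner_add_right inner_minus_right mult_zero_left)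
  qed
  let ?W = "?P o\<^sub>L ?Q"
  have W: "orthproj ?W"
  proof -
    have "selfadj ?W" by (intro selfadj_compose orthproj_selfadj P Q PQ)
    moreover have "?W o\<^sub>L ?W = ?W"
      using commute_apply[OF PQ] by (intro blinfun_eqI) (simp only: blinfun_apply_blinfun_compose orthproj_idem[OF P] orthproj_idem[OF Q])
    ultimately show ?thesis by (simp add: orthproj_def)
  qed
  have inM: "?P \<in> M" "?Q \<in> M" "?R \<in> M" using s my sy by (auto intro!: M_gtproj M_closed)
  have "posop (?R - ?W)"
    unfolding posop_def
  proof (intro conjI allI)
    show "selfadj (?R - ?W)" by (intro selfadj_diff orthproj_selfadj R W)
    fix v
    \<comment> \<open>By \<open>key\<close> the contraction ?W takes the same value at v and at ?R
      v; for projections, comparing norms is comparing quadratic forms.\<close>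
    have "norm (?W v) \<le> norm (?R v)"
      using pcontr_norm_le[OF orthproj_pcontr[OF W], of "?R v"] key[of v] by (simp only: blinfun_apply_blinfun_compose)
    then have "v \<bullet> ?W v \<le> v \<bullet> ?R v"
      unfolding orthproj_inner[OF W] orthproj_inner[OF R] by (simp only: norm_le)
    then show "0 \<le> v \<bullet> (?R - ?W) v" by (simp only: blinfun.diff_left inner_diff_right diff_ge_0_iff_ge)
  qed
  then have "Re (tr ?W) \<le> Re (tr ?R)" by (intro tr_mono M_closed(4) inM)
  moreover have "tr ?W = tr ?P * tr ?Q" by (rule indep[OF bP bQ])
  moreover have "Im (tr ?P) = 0" "0 \<le> Re (tr ?P)" "Im (tr ?Q) = 0"
    using tr_nonneg[OF inM(1) orthproj_posop[OF P]] tr_nonneg[OF inM(2) orthproj_posop[OF Q]] by auto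
  moreover have "1 / 2 \<le> Re (tr ?Q)"
    using odd_moments_zero_median[OF my odd_moments_zero_uminus[OF y(1) odd]]
      tr_diff[OF M_closed(1) M_gtproj[OF my, of 0]] by (simp add: tr_unit)
  then have "Re (tr ?P) * (1 / 2) \<le> Re (tr ?P) * Re (tr ?Q)"
    using \<open>0 \<le> Re (tr ?P)\<close> by (intro mult_left_mono)
  ultimately show ?thesis by simp
qed

end

section \<open>Levy's inequality\<close>

lemma real_spectral_projection_op_abs:
  assumes s: "s \<in> bounded_operators" "selfadj s" and r: "0 < r"
  shows "real_spectral_projection {r<..} (op_abs s) = gtproj s r + gtproj (- s) r"
proof -
  have "op_abs s \<in> bounded_operators" "selfadj (op_abs s)"
    using bicomm_bounded[OF sgn_abs_bicomm[OF s] s(1)] posop_sgn_abs[OF s]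
    by (auto simp: op_abs_eq[OF s] posop_def)
  then show ?thesis using gtproj_op_abs[OF s r] by (simp add: real_spectral_projection_eq)
qed

context tracial_von_neumann_algebra
begin

context
  fixes x s :: "nat \<Rightarrow> 'a operator" and n :: nat
  assumes sym: "\<And>k. k \<in> {1..n} \<Longrightarrow> symmetric_rv M tr (x k)"
    and indep: "weakly_fully_independent tr x n"
    and s: "\<And>k. s k = (\<Sum>i=1..k. x i)"
    and comm: "\<And>k. k \<in> {1..n} \<Longrightarrow> s k o\<^sub>L s n = s n o\<^sub>L s k"
begin

lemma x_props: "k \<in> {1..n} \<Longrightarrow> x k \<in> M" "k \<in> {1..n} \<Longrightarrow> selfadj (x k)"
  "k \<in> {1..n} \<Longrightarrow> odd_moments_zero (x k)"
  using sym symmetric_rv_M symmetric_rv_odd_moments_zero by blast+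

lemma generated_M: "A \<subseteq> {1..n} \<Longrightarrow> vN_generated (x ` A) \<subseteq> M"
  using x_props by (intro vN_generated_closed(7) von_neumann_algebra) auto

text \<open>The cut between k and k+1 is the case j = k+1 of independence; 1 < j is why k starts at
  1.\<close>

lemma tr_indep:
  assumes "1 \<le> k" "k < n" "a \<in> vN_generated (x ` {1..<Suc k})" "b \<in> vN_generated (x ` {Suc k..n})"
  shows "tr (a o\<^sub>L b) = tr a * tr b"
  using indep[unfolded weakly_fully_independent_def, rule_format, of "Suc k" a b] assms by simp

lemma sum_generated: "A \<subseteq> B \<Longrightarrow> (\<Sum>i\<in>A. x i) \<in> vN_generated (x ` B)"
  by (intro vN_generated_sum vN_generated_closed(5)) auto

lemma s_generated: "s k \<in> vN_generated (x ` {1..<Suc k})"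
  unfolding s by (rule sum_generated) auto

lemma tail_eq: "k \<le> n \<Longrightarrow> s n - s k = (\<Sum>i=Suc k..n. x i)"
  using sum.ub_add_nat[of 1 k x "n - k"] by (simp add: s)

lemma tail_generated: "k \<le> n \<Longrightarrow> s n - s k \<in> vN_generated (x ` {Suc k..n})"
  unfolding tail_eq by (rule sum_generated) auto

lemma s_M: assumes "k \<le> n" shows "s k \<in> M"
  by (rule subsetD[OF generated_M s_generated]) (use assms in auto)

lemma tail_M: assumes "k \<le> n" shows "s n - s k \<in> M"
  by (rule subsetD[OF generated_M tail_generated]) (use assms in auto)

lemma s_selfadj: "k \<le> n \<Longrightarrow> selfadj (s k)"
  unfolding s by (rule selfadj_sum) (use x_props in auto)

lemma tail_selfadj: "k \<le> n \<Longrightarrow> selfadj (s n - s k)"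
  by (intro selfadj_diff s_selfadj) auto

lemma x_Suc: "x (Suc k) = s (Suc k) - s k"
  by (simp add: s)

lemma tail_Suc: "s n - s k = x (Suc k) + (s n - s (Suc k))"
  by (simp add: x_Suc)

lemma s_n_commute: "k \<le> n \<Longrightarrow> s n o\<^sub>L s k = s k o\<^sub>L s n"
  using comm[of k] by (cases "k = 0") (auto simp: s compose_bilinear)

lemma tail_commute:
  assumes "1 \<le> k" "Suc k \<le> n"
  shows "(s n - s k) o\<^sub>L x (Suc k) = x (Suc k) o\<^sub>L (s n - s k)"
proof (rule commute_of_indep_sum[where N = "vN_generated (x ` {Suc k..n})" and s = "s k"])
  show "vN_generated (x ` {Suc k..n}) \<subseteq> M" using assms by (intro generated_M) auto
  show "s k \<in> M" "selfadj (s n - s k)" "s n - s k \<in> vN_generated (x ` {Suc k..n})"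
    using assms by (auto intro: s_M tail_selfadj tail_generated)
  show "x (Suc k) \<in> vN_generated (x ` {Suc k..n})" "selfadj (x (Suc k))"
    using assms by (auto intro!: vN_generated_closed(5) x_props(2))
  show "tr (s k o\<^sub>L b) = tr (s k) * tr b" if "b \<in> vN_generated (x ` {Suc k..n})" for b
    using tr_indep[OF _ _ s_generated that] assms by simp
  show "(s k + (s n - s k)) o\<^sub>L x (Suc k) = x (Suc k) o\<^sub>L (s k + (s n - s k))"
    using s_n_commute[of k] s_n_commute[of "Suc k"] assms unfolding x_Suc by (simp add: compose_bilinear)
qed (auto intro: vN_generated_closed(3,4))

lemma tail_odd_moments_zero: "1 \<le> k \<Longrightarrow> k < n \<Longrightarrow> odd_moments_zero (s n - s k)"
proof (induction "n - k" arbitrary: k)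
  case 0 then show ?case by simp
next
  case (Suc d)
  show ?case
  proof (cases "Suc k = n")
    case True
    then have "s n - s k = x n" using x_Suc[of k] by simp
    then show ?thesis using x_props(3)[of n] Suc.prems by simp
  next
    case False
    then have k: "1 \<le> Suc k" "Suc k < n" using Suc.prems by auto
    let ?y = "s n - s (Suc k)"
    have "odd_moments_zero (x (Suc k) + ?y)"
    proof (rule odd_moments_zero_add)
      show "x (Suc k) \<in> M" "?y \<in> M" using k x_props(1) by (auto intro: tail_M)
      have "?y = (s n - s k) - x (Suc k)" by (simp add: x_Suc)
      then show "x (Suc k) o\<^sub>L ?y = ?y o\<^sub>L x (Suc k)"
        using tail_commute[of k] Suc.prems k by (simp only: compose_bilinear)
      show "odd_moments_zero (x (Suc k))" using k by (intro x_props(3)) auto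
      show "odd_moments_zero ?y" using Suc.hyps(2) Suc.prems k by (intro Suc.hyps(1)) auto
      fix i j
      \<comment> \<open>Here x_{k+1} counts among the first k+1 variables, so independence from the
        tail is used one cut later than in \<open>tail_commute\<close>.\<close>
      have "x (Suc k) \<in> vN_generated (x ` {1..<Suc (Suc k)})" by (rule vN_generated_closed(5)) auto
      then have "opow (x (Suc k)) i \<in> vN_generated (x ` {1..<Suc (Suc k)})"
        using vN_generated_closed(6) opow_bicomm[OF bicomm_self] by blast
      moreover have "opow ?y j \<in> vN_generated (x ` {Suc (Suc k)..n})"
        using vN_generated_closed(6)[OF tail_generated, of "Suc k"] k opow_bicomm[OF bicomm_self] by auto
      ultimately show "tr (opow (x (Suc k)) i o\<^sub>L opow ?y j) = tr (opow (x (Suc k)) i) * tr (opow ?y j)"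
        by (rule tr_indep[OF k])
    qed
    then show ?thesis by (simp only: tail_Suc[of k, symmetric])
  qed
qed

text \<open>The lower side is the upper side for -s_k and minus the tail: an operator and its
  negative have the same double commutant, and odd moments only change sign. For k = n both bounds
  are t <= 2 t with t >= 0.\<close>

lemma levy_single:
  assumes k: "k \<in> {1..n}"
  shows "Re (tr (gtproj (s k) r)) \<le> 2 * Re (tr (gtproj (s n) r))" (is ?pos)
    and "Re (tr (gtproj (- s k) r)) \<le> 2 * Re (tr (gtproj (- s n) r))" (is ?neg)
proof -
  have "?pos \<and> ?neg"
  proof (cases "k = n")
    case True
    have sn: "s n \<in> M" "selfadj (s n)" "- s n \<in> M" "selfadj (- s n)"
      using s_M s_selfadj by (auto intro: M_uminus selfadj_uminus)
    have "0 \<le> Re (tr (gtproj (s n) r))" "0 \<le> Re (tr (gtproj (- s n) r))"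
      using sn by (auto intro!: conjunct1[OF tr_nonneg] M_gtproj orthproj_posop orthproj_gtproj)
    then show ?thesis using True by simp
  next
    case False
    let ?y = "s n - s k"
    have kn: "1 \<le> k" "k < n" using k False by auto
    have M: "s k \<in> M" "?y \<in> M" and sa: "selfadj (s k)" "selfadj ?y"
      using kn by (auto intro: s_M tail_M s_selfadj tail_selfadj)
    have comm: "s k o\<^sub>L ?y = ?y o\<^sub>L s k" using s_n_commute[of k] kn by (simp add: compose_bilinear)
    have ind: "tr (a o\<^sub>L b) = tr a * tr b" if "a \<in> bicomm (s k)" "b \<in> bicomm ?y" for a b
      using that vN_generated_closed(6)[OF s_generated, of k] vN_generated_closed(6)[OF tail_generated, of k] kn
      by (intro tr_indep[OF kn]) auto
    have odd: "odd_moments_zero ?y" by (rule tail_odd_moments_zero[OF kn])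
    have "Re (tr (gtproj (s k) r)) \<le> 2 * Re (tr (gtproj (s k + ?y) r))"
      by (rule levy_indep_sum[OF M(1) sa(1) M(2) sa(2) comm ind odd])
    moreover have neg: "- a o\<^sub>L - b = a o\<^sub>L b" for a b :: "'a operator"
      by (simp add: compose_bilinear)
    have "Re (tr (gtproj (- s k) r)) \<le> 2 * Re (tr (gtproj (- s k + - ?y) r))"
    proof (rule levy_indep_sum)
      show "- s k o\<^sub>L - ?y = - ?y o\<^sub>L - s k" using comm by (simp only: neg)
      show "odd_moments_zero (- ?y)" by (rule odd_moments_zero_uminus[OF M(2) odd])
    qed (use M sa ind in \<open>simp_all only: M_uminus selfadj_uminus bicomm_uminus_eq\<close>)
    ultimately show ?thesis by simp
  qed
  then show ?pos ?neg by auto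
qed

end

end

theorem theorem2p4:
  fixes M :: "('a::chilbert_space) operator set"
    and \<tau> :: "'a operator \<Rightarrow> complex"
    and x s :: "nat \<Rightarrow> 'a operator"
    and n :: nat
    and r :: real
  assumes "tracial_von_neumann_algebra M \<tau>"
    and "1 \<le> n"
    and "\<And>k. k \<in> {1..n} \<Longrightarrow> symmetric_rv M \<tau> (x k)"
    and "weakly_fully_independent \<tau> x n"
    and "\<And>k. s k = (\<Sum>i=1..k. x i)"
    and "\<And>k. k \<in> {1..n} \<Longrightarrow> s k o\<^sub>L s n = s n o\<^sub>L s k"
    and "0 < r"
  shows "\<exists>p\<in>M. \<exists>q\<in>M. projection_op p \<and> projection_op q \<and>
    (MAX k\<in>{1..n}. 1 / 2 ^ (k - 1) * Re (\<tau> (real_spectral_projection {r<..} (s k))))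
      \<le> Re (\<tau> p) \<and>
    Re (\<tau> p) \<le> 2 * Re (\<tau> (real_spectral_projection {r<..} (s n))) \<and>
    (MAX k\<in>{1..n}. 1 / 2 ^ (k - 1) * Re (\<tau> (real_spectral_projection {r<..} (op_abs (s k)))))
      \<le> Re (\<tau> (p + q)) \<and>
    Re (\<tau> (p + q)) \<le> 2 * Re (\<tau> (real_spectral_projection {r<..} (op_abs (s n)))) \<and>
    ((\<exists>k\<in>{1..n}. real_spectral_projection {r<..} (s k) \<noteq> 0) \<longrightarrow> p \<noteq> 0) \<and>
    ((\<exists>k\<in>{1..n}. real_spectral_projection {r<..} (- s k) \<noteq> 0) \<longrightarrow> q \<noteq> 0)"
proof -
  interpret tracial_von_neumann_algebra M \<tau> by fact
  note hyps = assms(3-6)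
  \<comment> \<open>The sign \<sigma> is 1 for the events s_k > r and -1 for -s_k > r, so that p and
    q come from one construction.\<close>
  define T where "T \<sigma> k = Re (\<tau> (gtproj (\<sigma> *\<^sub>R s k) r))" for \<sigma> :: real and k
  have sM: "\<sigma> *\<^sub>R s k \<in> M" and sa: "selfadj (\<sigma> *\<^sub>R s k)" if "k \<in> {1..n}" for \<sigma> k
    using that M_bicomm[OF s_M[OF hyps], of k] s_selfadj[OF hyps, of k]
    by (auto intro: bicomm_scaleR bicomm_self selfadj_scaleR)
  have b: "\<sigma> *\<^sub>R s k \<in> bounded_operators" if "k \<in> {1..n}" for \<sigma> k by (rule M_bounded[OF sM[OF that]])
  have PM: "gtproj (\<sigma> *\<^sub>R s k) r \<in> M" and P: "orthproj (gtproj (\<sigma> *\<^sub>R s k) r)" if "k \<in> {1..n}" for \<sigma> k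
    by (rule M_gtproj[OF sM sa] orthproj_gtproj[OF sa]; fact)+
  have T_nonneg: "0 \<le> T \<sigma> k" if "k \<in> {1..n}" for \<sigma> k
    using tr_nonneg[OF PM orthproj_posop[OF P]] that by (simp add: T_def)
  have levy: "T 1 k \<le> 2 * T 1 n" "T (- 1) k \<le> 2 * T (- 1) n" if "k \<in> {1..n}" for k
    using levy_single[OF hyps that, of r] by (simp_all add: T_def)
  have proj: "real_spectral_projection {r<..} (\<sigma> *\<^sub>R s k) = gtproj (\<sigma> *\<^sub>R s k) r" if "k \<in> {1..n}" for \<sigma> k
    by (rule real_spectral_projection_eq[OF b[OF that] sa[OF that]])
  have abs: "Re (\<tau> (real_spectral_projection {r<..} (op_abs (s k)))) = T 1 k + T (- 1) k"
    if "k \<in> {1..n}" for k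
    using real_spectral_projection_op_abs[of "s k" r] b[OF that, of 1] sa[OF that, of 1] \<open>0 < r\<close>
      tr_add[OF PM[OF that, of 1] PM[OF that, of "- 1"]] by (simp add: T_def)
  \<comment> \<open>Largest means of largest trace: the projections themselves need not be
    comparable. The maximising indices for the two signs may differ.\<close>
  have "\<exists>m\<in>{1..n}. \<forall>k\<in>{1..n}. T \<sigma> k \<le> T \<sigma> m" for \<sigma>
  proof -
    have "Max (T \<sigma> ` {1..n}) \<in> T \<sigma> ` {1..n}" using \<open>1 \<le> n\<close> by (intro Max_in) auto
    then obtain m where "m \<in> {1..n}" "Max (T \<sigma> ` {1..n}) = T \<sigma> m" by blast
    then show ?thesis by (metis Max_ge finite_atLeastAtMost finite_imageI imageI)
  qed
  then obtain m where m: "\<And>\<sigma>. m \<sigma> \<in> {1..n}" "\<And>\<sigma> k. k \<in> {1..n} \<Longrightarrow> T \<sigma> k \<le> T \<sigma> (m \<sigma>)" by metis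
  define p where "p \<sigma> = gtproj (\<sigma> *\<^sub>R s (m \<sigma>)) r" for \<sigma> :: real
  have pM: "p \<sigma> \<in> M" and p_proj: "projection_op (p \<sigma>)" and tr_p: "Re (\<tau> (p \<sigma>)) = T \<sigma> (m \<sigma>)" for \<sigma>
    using PM[OF m(1)] P[OF m(1)] M_bounded by (auto simp: p_def T_def projection_op_iff)
  \<comment> \<open>If the largest trace is 0, all traces are 0, and faithfulness makes every one of
    the projections vanish.\<close>
  have p_nz: "p \<sigma> \<noteq> 0" if k: "k \<in> {1..n}" and nz: "gtproj (\<sigma> *\<^sub>R s k) r \<noteq> 0" for \<sigma> k
  proof
    assume "p \<sigma> = 0"
    then have "T \<sigma> k \<le> 0" using tr_p[of \<sigma>] m(2)[OF k, of \<sigma>] by (simp add: tr_zero)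
    then have "T \<sigma> k = 0" using T_nonneg[OF k] by (simp add: antisym)
    then show False using tr_faithful_posop[OF PM[OF k] orthproj_posop[OF P[OF k]]] nz by (simp add: T_def)
  qed
  have weight: "1 / 2 ^ (k - 1) * t \<le> t" if "0 \<le> t" for t :: real and k :: nat
    using that by (intro mult_left_le_one_le) auto
  have n: "n \<in> {1..n}" using \<open>1 \<le> n\<close> by simp
  show ?thesis
  proof (rule bexI[OF _ pM[of 1]], rule bexI[OF _ pM[of "- 1"]], intro conjI impI p_proj)
    show "(MAX k\<in>{1..n}. 1 / 2 ^ (k - 1) * Re (\<tau> (real_spectral_projection {r<..} (s k)))) \<le> Re (\<tau> (p 1))"
    proof (rule Max.boundedI)
      fix t assume "t \<in> (\<lambda>k. 1 / 2 ^ (k - 1) * Re (\<tau> (real_spectral_projection {r<..} (s k)))) ` {1..n}"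
      then obtain k where k: "k \<in> {1..n}" and t: "t = 1 / 2 ^ (k - 1) * T 1 k"
        using proj[of _ 1] by (auto simp: T_def)
      show "t \<le> Re (\<tau> (p 1))"
        unfolding t tr_p using weight[OF T_nonneg[OF k], of k 1] m(2)[OF k, of 1] by linarith
    qed (use \<open>1 \<le> n\<close> in auto)
    show "(MAX k\<in>{1..n}. 1 / 2 ^ (k - 1) * Re (\<tau> (real_spectral_projection {r<..} (op_abs (s k)))))
      \<le> Re (\<tau> (p 1 + p (- 1)))"
    proof (rule Max.boundedI)
      fix t assume "t \<in> (\<lambda>k. 1 / 2 ^ (k - 1) * Re (\<tau> (real_spectral_projection {r<..} (op_abs (s k))))) ` {1..n}"
      then obtain k where k: "k \<in> {1..n}" and t: "t = 1 / 2 ^ (k - 1) * (T 1 k + T (- 1) k)"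
        using abs by auto
      have "t \<le> T 1 k + T (- 1) k" unfolding t by (intro weight add_nonneg_nonneg T_nonneg k)
      then show "t \<le> Re (\<tau> (p 1 + p (- 1)))"
        using m(2)[OF k, of 1] m(2)[OF k, of "- 1"] by (simp add: tr_add pM tr_p)
    qed (use \<open>1 \<le> n\<close> in auto)
    show "Re (\<tau> (p 1)) \<le> 2 * Re (\<tau> (real_spectral_projection {r<..} (s n)))"
      using levy(1)[OF m(1), of 1] proj[OF n, of 1] by (simp add: tr_p T_def)
    show "Re (\<tau> (p 1 + p (- 1))) \<le> 2 * Re (\<tau> (real_spectral_projection {r<..} (op_abs (s n))))"
      using levy(1)[OF m(1), of 1] levy(2)[OF m(1), of "- 1"] abs[OF n] by (simp add: tr_add pM tr_p)
    show "p 1 \<noteq> 0" if "\<exists>k\<in>{1..n}. real_spectral_projection {r<..} (s k) \<noteq> 0"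
    proof -
      from that obtain k where k: "k \<in> {1..n}" "real_spectral_projection {r<..} (s k) \<noteq> 0" by blast
      then show ?thesis using p_nz[OF k(1), of 1] proj[OF k(1), of 1] by simp
    qed
    show "p (- 1) \<noteq> 0" if "\<exists>k\<in>{1..n}. real_spectral_projection {r<..} (- s k) \<noteq> 0"
    proof -
      from that obtain k where k: "k \<in> {1..n}" "real_spectral_projection {r<..} (- s k) \<noteq> 0" by blast
      then show ?thesis using p_nz[OF k(1), of "- 1"] proj[OF k(1), of "- 1"] by simp
    qed
  qed
qed

end
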